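(* Consider the system $$\frac{dx}{dt}=xy,\qquad \frac{dy}{dt}=-\frac{y^2}{2}+4x .$$ After a series of blowing-ups in $\mathbb{P}^2$ one obtains a rational surface of type $E_7^{(1)}$. The phase space $\mathcal{X}$ of the system can be obtained by gluing three copies $U_j\times\mathbb{C}=\mathbb{C}^2\times\mathbb{C}\ni(x_j,y_j,t)$, $j=0,1,2$, via the birational and symplectic transformations $$\begin{aligned} 0)\;& x_0=x,\quad y_0=y,\\ 1)\;& x_1=-\Bigl(x-\frac{y^2}{4}\Bigr)y^2,\quad y_1=\frac1y,\\ 2)\;& x_2=-xy^2,\quad y_2=\frac1y . \end{aligned}$$
   Context: Symplectic means $dx_j\wedge dy_j=dx\wedge dy$ for fixed $t$. Gluing: points of different charts with the same $t$ are identified through the given birational relations wherever these are biregular. Phase space: the resulting complex manifold $\mathcal{X}$, fibred over the $t$-line $B$ (here $B=\mathbb{C}$), is the phase space (space of initial conditions) of the system if (i) rewritten in the coordinates $(x_j,y_j)$ of every chart, the system has right-hand sides that are polynomials in $(x_j,y_j)$ with coefficients holomorphic in $t$; and (ii) every solution $(x(t),y(t))$ that is meromorphic near a point $t_0\in B$ extends holomorphically across $t_0$ as a map into $\mathcal{X}$. Type: a rational surface of type $R$ (an affine Dynkin diagram) here means a smooth projective rational surface $S$ (obtained by successively blowing up $\mathbb{P}^2\supset\mathbb{C}^2\ni(x,y)$) containing the fibre $\mathcal{X}_t$ as an open subset such that $S\setminus\mathcal{X}_t$ is a union of smooth rational curves of self-intersection $-2$ whose dual intersection graph is the diagram $R$.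 *)

theory Defs
  imports "HOL-Complex_Analysis.Complex_Analysis" "HOL-Computational_Algebra.Polynomial"
begin

section \<open>Holomorphic maps in several variables\<close>

class complex_space = real_normed_vector +
  fixes scaleC :: "complex \<Rightarrow> 'a \<Rightarrow> 'a"
  assumes scaleC_add_right: "scaleC c (v + w) = scaleC c v + scaleC c w"
    and scaleC_add_left: "scaleC (c + d) v = scaleC c v + scaleC d v"
    and scaleC_scaleC: "scaleC c (scaleC d v) = scaleC (c * d) v"
    and scaleC_of_real: "scaleC (of_real r) v = r *\<^sub>R v"

instantiation complex :: complex_space
begin
definition scaleC_complex :: "complex \<Rightarrow> complex \<Rightarrow> complex"
  where "scaleC_complex c v = c * v"
instance
  by standard (simp_all add: scaleC_complex_def algebra_simps scaleR_conv_of_real)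
end

instantiation prod :: (complex_space, complex_space) complex_space
begin
definition scaleC_prod :: "complex \<Rightarrow> 'a \<times> 'b \<Rightarrow> 'a \<times> 'b"
  where "scaleC_prod c v = (scaleC c (fst v), scaleC c (snd v))"
instance
  by standard (simp_all add: scaleC_prod_def scaleC_add_right scaleC_add_left
      scaleC_scaleC scaleC_of_real prod_eq_iff)
end

type_synonym c2 = "complex \<times> complex"
type_synonym c3 = "complex \<times> complex \<times> complex"

definition cholomorphic_on :: "('m::complex_space \<Rightarrow> 'n::complex_space) \<Rightarrow> 'm set \<Rightarrow> bool"
  where "cholomorphic_on f U \<longleftrightarrow>
    (\<forall>z\<in>U. \<exists>D. (f has_derivative D) (at z) \<and> (\<forall>c v. D (scaleC c v) = scaleC c (D v)))"

section \<open>Complex manifolds\<close>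

text \<open>A chart \<open>(V, \<psi>)\<close> is a local parametrisation: \<open>\<psi>\<close> maps the open subset \<open>V\<close> of the model
  space into the manifold, and only its values on \<open>V\<close> matter.  The underlying set and the topology
  are determined by the atlas.\<close>

type_synonym ('m, 'a) chart = "'m set \<times> ('m \<Rightarrow> 'a)"
type_synonym ('m, 'a) atlas = "('m, 'a) chart set"

definition points :: "('m, 'a) atlas \<Rightarrow> 'a set"
  where "points A = (\<Union>(V, \<psi>)\<in>A. \<psi> ` V)"

definition mopen :: "('m::topological_space, 'a) atlas \<Rightarrow> 'a set \<Rightarrow> bool"
  where "mopen A U \<longleftrightarrow> U \<subseteq> points A \<and> (\<forall>(V, \<psi>)\<in>A. open {z\<in>V. \<psi> z \<in> U})"

definition mtop :: "('m::topological_space, 'a) atlas \<Rightarrow> 'a topology"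
  where "mtop A = topology (mopen A)"

lemma istopology_mopen: "istopology (mopen A)"
  unfolding istopology_def
proof (intro conjI allI impI)
  fix S T assume S: "mopen A S" and T: "mopen A T"
  have "open {z\<in>V. \<psi> z \<in> S \<inter> T}" if "(V, \<psi>) \<in> A" for V \<psi>
  proof -
    have "{z\<in>V. \<psi> z \<in> S \<inter> T} = {z\<in>V. \<psi> z \<in> S} \<inter> {z\<in>V. \<psi> z \<in> T}" by blast
    moreover have "open {z\<in>V. \<psi> z \<in> S}" "open {z\<in>V. \<psi> z \<in> T}"
      using S T that by (auto simp: mopen_def)
    ultimately show ?thesis by (simp add: open_Int)
  qed
  then show "mopen A (S \<inter> T)" using S by (auto simp: mopen_def)
next
  fix K assume K: "Ball K (mopen A)"
  have "open {z\<in>V. \<psi> z \<in> \<Union>K}" if "(V, \<psi>) \<in> A" for V \<psi>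
  proof -
    have "{z\<in>V. \<psi> z \<in> \<Union>K} = (\<Union>U\<in>K. {z\<in>V. \<psi> z \<in> U})" by blast
    moreover have "\<forall>U\<in>K. open {z\<in>V. \<psi> z \<in> U}"
      using K that by (auto simp: mopen_def)
    ultimately show ?thesis by (simp add: open_UN)
  qed
  then show "mopen A (\<Union>K)" using K by (auto simp: mopen_def)
qed

lemma openin_mtop: "openin (mtop A) = mopen A"
  unfolding mtop_def by (rule topology_inverse'[OF istopology_mopen])

definition transition :: "('m, 'a) chart \<Rightarrow> ('n, 'a) chart \<Rightarrow> 'm \<Rightarrow> 'n"
  where "transition c d z = inv_into (fst d) (snd d) (snd c z)"

definition overlap :: "('m, 'a) chart \<Rightarrow> ('n, 'a) chart \<Rightarrow> 'm set"
  where "overlap c d = {z \<in> fst c. snd c z \<in> snd d ` fst d}"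

definition compatible :: "('m::complex_space, 'a) chart \<Rightarrow> ('m, 'a) chart \<Rightarrow> bool"
  where "compatible c d \<longleftrightarrow>
    open (fst c) \<and> open (fst d) \<and> inj_on (snd c) (fst c) \<and> inj_on (snd d) (fst d) \<and>
    open (overlap c d) \<and> cholomorphic_on (transition c d) (overlap c d) \<and>
    open (overlap d c) \<and> cholomorphic_on (transition d c) (overlap d c)"

definition complex_manifold :: "('m::complex_space, 'a) atlas \<Rightarrow> bool"
  where "complex_manifold A \<longleftrightarrow> (\<forall>c\<in>A. \<forall>d\<in>A. compatible c d) \<and>
    Hausdorff_space (mtop A) \<and> second_countable (mtop A)"

text \<open>A chart belonging to the maximal atlas; it need not be in \<open>A\<close> itself.\<close>

definition local_coordinates :: "('m::complex_space, 'a) atlas \<Rightarrow> ('m, 'a) chart \<Rightarrow> bool"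
  where "local_coordinates A c \<longleftrightarrow> snd c ` fst c \<subseteq> points A \<and> (\<forall>d\<in>A. compatible c d)"

definition holomorphic_map ::
    "('m::complex_space, 'a) atlas \<Rightarrow> ('n::complex_space, 'b) atlas \<Rightarrow> ('a \<Rightarrow> 'b) \<Rightarrow> bool"
  where "holomorphic_map A B f \<longleftrightarrow> f ` points A \<subseteq> points B \<and>
    (\<forall>(V, \<psi>)\<in>A. \<forall>d\<in>B. open (overlap (V, f \<circ> \<psi>) d) \<and>
       cholomorphic_on (transition (V, f \<circ> \<psi>) d) (overlap (V, f \<circ> \<psi>) d))"

definition biholomorphic ::
    "('m::complex_space, 'a) atlas \<Rightarrow> ('n::complex_space, 'b) atlas \<Rightarrow> ('a \<Rightarrow> 'b) \<Rightarrow> bool"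
  where "biholomorphic A B f \<longleftrightarrow> bij_betw f (points A) (points B) \<and>
    holomorphic_map A B f \<and> holomorphic_map B A (inv_into (points A) f)"

definition restrict_atlas :: "('m, 'a) atlas \<Rightarrow> 'a set \<Rightarrow> ('m, 'a) atlas"
  where "restrict_atlas A U = (\<lambda>(V, \<psi>). ({z\<in>V. \<psi> z \<in> U}, \<psi>)) ` A"

definition open_embedding ::
    "('m::complex_space, 'a) atlas \<Rightarrow> ('n::complex_space, 'b) atlas \<Rightarrow> ('a \<Rightarrow> 'b) \<Rightarrow> bool"
  where "open_embedding A B f \<longleftrightarrow> mopen B (f ` points A) \<and>
    biholomorphic A (restrict_atlas B (f ` points A)) f"

section \<open>Iterated blow-ups of the projective plane\<close>

text \<open>Points of a projective space are the lines through the origin, so \<open>line (z, x, y)\<close> is the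
  point with homogeneous coordinates \<open>[z : x : y]\<close>.\<close>

definition line :: "'m::complex_space \<Rightarrow> 'm set"
  where "line v = range (\<lambda>c. scaleC c v)"

definition proj_line :: "(complex, c2 set) atlas"
  where "proj_line = {(UNIV, \<lambda>z. line (1, z)), (UNIV, \<lambda>z. line (z, 1))}"

text \<open>\<open>Exc p l\<close> is the point of the exceptional curve over \<open>p\<close> with tangent direction \<open>l\<close>.\<close>

datatype ipoint = Plane "c3 set" | Exc ipoint "c2 set"

definition proj_plane :: "(c2, ipoint) atlas"
  where "proj_plane =
    {(UNIV, \<lambda>(a, b). Plane (line (1, a, b))),
     (UNIV, \<lambda>(a, b). Plane (line (a, 1, b))),
     (UNIV, \<lambda>(a, b). Plane (line (a, b, 1)))}"

text \<open>Blow-up of the point \<open>\<psi> 0\<close>, where \<open>(V, \<psi>)\<close> are local coordinates centred at it: the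
  punctured surface glued with the preimage of \<open>V\<close> in the incidence variety
  \<open>{(w, l). w \<in> l}\<close>, whose two charts are \<open>w = (u, u * v)\<close>, \<open>l = line (1, v)\<close> and
  \<open>w = (u * v, v)\<close>, \<open>l = line (u, 1)\<close>.\<close>

definition blow_up :: "(c2, ipoint) atlas \<Rightarrow> (c2, ipoint) chart \<Rightarrow> (c2, ipoint) atlas"
  where "blow_up A = (\<lambda>(V, \<psi>).
    restrict_atlas A (points A - {\<psi> (0, 0)}) \<union>
    {({(u, v). (u, u * v) \<in> V},
      \<lambda>(u, v). if u = 0 then Exc (\<psi> (0, 0)) (line (1, v)) else \<psi> (u, u * v)),
     ({(u, v). (u * v, v) \<in> V},
      \<lambda>(u, v). if v = 0 then Exc (\<psi> (0, 0)) (line (u, 1)) else \<psi> (u * v, v))})"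

definition blow_down :: "ipoint \<Rightarrow> ipoint \<Rightarrow> ipoint"
  where "blow_down p q =
    (case q of Plane l \<Rightarrow> q | Exc p' l \<Rightarrow> if p' = p then p else q)"

text \<open>The surfaces obtained from the projective plane by finitely many successive point blow-ups,
  with their projections to the plane.  These are the smooth projective rational surfaces
  that occur here: an iterated point blow-up of the plane is automatically projective and rational.\<close>

inductive blown_up_plane :: "(c2, ipoint) atlas \<Rightarrow> (ipoint \<Rightarrow> ipoint) \<Rightarrow> bool"
  where
    plane: "blown_up_plane proj_plane id"
  | blow_up: "blown_up_plane S \<pi> \<Longrightarrow> local_coordinates S (V, \<psi>) \<Longrightarrow> (0, 0) \<in> V \<Longrightarrow>
      blown_up_plane (blow_up S (V, \<psi>)) (\<pi> \<circ> blow_down (\<psi> (0, 0)))"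

section \<open>Curves on surfaces and their intersection numbers\<close>

text \<open>Local coordinates \<open>(z, w)\<close> in which the curve \<open>C\<close> has the equation \<open>w = 0\<close>.\<close>

definition adapted :: "(c2, 'a) atlas \<Rightarrow> 'a set \<Rightarrow> (c2, 'a) chart set"
  where "adapted S C = {(V, \<psi>). local_coordinates S (V, \<psi>) \<and>
    (\<forall>(z, w)\<in>V. \<psi> (z, w) \<in> C \<longleftrightarrow> w = 0)}"

definition curve_atlas :: "(c2, 'a) atlas \<Rightarrow> 'a set \<Rightarrow> (complex, 'a) atlas"
  where "curve_atlas S C = (\<lambda>(V, \<psi>). ({z. (z, 0) \<in> V}, \<lambda>z. \<psi> (z, 0))) ` adapted S C"

definition smooth_rational_curve :: "(c2, 'a) atlas \<Rightarrow> 'a set \<Rightarrow> bool"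
  where "smooth_rational_curve S C \<longleftrightarrow> points (curve_atlas S C) = C \<and>
    (\<exists>\<gamma>. biholomorphic proj_line (curve_atlas S C) \<gamma>)"

text \<open>The self-intersection number of a smooth compact curve \<open>C\<close> is the degree of its normal bundle,
  that is, of the divisor of a non-zero meromorphic section.  Over a cover \<open>K\<close> of \<open>C\<close> by adapted
  charts the section is \<open>s c \<cdot> \<partial>/\<partial>w\<close> in the chart \<open>c\<close>, so that the components transform with
  \<open>\<partial>w'/\<partial>w\<close> along \<open>w = 0\<close>.\<close>

definition has_self_intersection :: "(c2, 'a) atlas \<Rightarrow> 'a set \<Rightarrow> int \<Rightarrow> bool"
  where "has_self_intersection S C n \<longleftrightarrow>
    (\<exists>K s ord. K \<subseteq> adapted S C \<and> C \<subseteq> points K \<and>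
      (\<forall>c\<in>K. s c meromorphic_on {z. (z, 0) \<in> fst c}) \<and>
      (\<forall>c\<in>K. \<forall>d\<in>K. \<forall>z. (z, 0) \<in> overlap c d \<longrightarrow>
        (\<forall>\<^sub>F \<zeta> in at z. s d (fst (transition c d (\<zeta>, 0))) =
           deriv (\<lambda>w. snd (transition c d (\<zeta>, w))) 0 * s c \<zeta>)) \<and>
      (\<forall>c\<in>K. \<forall>z. (z, 0) \<in> fst c \<longrightarrow>
        (\<forall>\<^sub>F \<zeta> in at z. s c \<zeta> \<noteq> 0) \<and> zorder (s c) z = ord (snd c (z, 0))) \<and>
      finite {p\<in>C. ord p \<noteq> 0} \<and> n = (\<Sum>p | p \<in> C \<and> ord p \<noteq> 0. ord p))"

text \<open>For distinct smooth curves, the local multiplicity at a common point is the order of vanishing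
  along \<open>C\<close> of a local equation of \<open>D\<close>.\<close>

definition has_intersection_number :: "(c2, 'a) atlas \<Rightarrow> 'a set \<Rightarrow> 'a set \<Rightarrow> int \<Rightarrow> bool"
  where "has_intersection_number S C D n \<longleftrightarrow> finite (C \<inter> D) \<and>
    (\<exists>m. (\<forall>p \<in> C \<inter> D. \<exists>c \<in> adapted S C. \<exists>d \<in> adapted S D. \<exists>z.
        (z, 0) \<in> overlap c d \<and> snd c (z, 0) = p \<and>
        m p = zorder (\<lambda>\<zeta>. snd (transition c d (\<zeta>, 0))) z) \<and>
      n = (\<Sum>p \<in> C \<inter> D. m p))"

text \<open>A diagram consists of its set of nodes and the number of edges joining two given nodes.\<close>

type_synonym diagram = "nat set \<times> (nat \<Rightarrow> nat \<Rightarrow> nat)"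

definition E7_affine :: diagram
  where "E7_affine = ({0..7}, \<lambda>i j.
    if {i, j} \<in> {{0, 1}, {1, 2}, {2, 3}, {3, 4}, {4, 5}, {5, 6}, {3, 7}} then 1 else 0)"

text \<open>\<open>F\<close> is the fibre of the phase space and \<open>\<phi>\<close> its chart with the coordinates \<open>(x, y)\<close>, which are
  the affine coordinates of the plane that has been blown up.\<close>

definition rational_surface_of_type ::
    "diagram \<Rightarrow> (c2, ipoint) atlas \<Rightarrow> (c2, 'a) atlas \<Rightarrow> (c2 \<Rightarrow> 'a) \<Rightarrow> bool"
  where "rational_surface_of_type R S F \<phi> \<longleftrightarrow>
    complex_manifold S \<and>
    (\<exists>\<pi> \<iota>. blown_up_plane S \<pi> \<and> open_embedding F S \<iota> \<and>
      (\<forall>x y. \<pi> (\<iota> (\<phi> (x, y))) = Plane (line (1, x, y))) \<and>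
      (\<exists>C. inj_on C (fst R) \<and> points S - \<iota> ` points F = (\<Union>i\<in>fst R. C i) \<and>
        (\<forall>i\<in>fst R. smooth_rational_curve S (C i) \<and> has_self_intersection S (C i) (-2)) \<and>
        (\<forall>i\<in>fst R. \<forall>j\<in>fst R. i \<noteq> j \<longrightarrow>
          has_intersection_number S (C i) (C j) (int (snd R i j)))))"

section \<open>Birational transformations of the plane\<close>

type_synonym ratmap = "complex poly poly \<times> complex poly poly \<times> complex poly poly"

definition poly2 :: "complex poly poly \<Rightarrow> c2 \<Rightarrow> complex"
  where "poly2 P z = poly (poly P [:snd z:]) (fst z)"

text \<open>The triple \<open>(a, b, d)\<close> represents the rational map \<open>(a / d, b / d)\<close>.\<close>

definition regular :: "ratmap \<Rightarrow> c2 \<Rightarrow> bool"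
  where "regular = (\<lambda>(a, b, d) z. poly2 d z \<noteq> 0)"

definition ratval :: "ratmap \<Rightarrow> c2 \<Rightarrow> c2"
  where "ratval = (\<lambda>(a, b, d) z. (poly2 a z / poly2 d z, poly2 b z / poly2 d z))"

definition generically :: "(c2 \<Rightarrow> bool) \<Rightarrow> bool"
  where "generically P \<longleftrightarrow> (\<exists>e. e \<noteq> 0 \<and> (\<forall>z. poly2 e z \<noteq> 0 \<longrightarrow> P z))"

definition birational :: "(c2 \<Rightarrow> c2) \<Rightarrow> bool"
  where "birational \<phi> \<longleftrightarrow> (\<exists>R R'.
    generically (\<lambda>z. regular R z \<and> ratval R z = \<phi> z) \<and>
    generically (\<lambda>z. regular R z \<and> regular R' (ratval R z) \<and> ratval R' (ratval R z) = z) \<and>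
    generically (\<lambda>z. regular R' z \<and> regular R (ratval R' z) \<and> ratval R (ratval R' z) = z))"

text \<open>For coordinates \<open>\<phi>\<close> and \<open>\<psi>\<close> depending birationally on common coordinates: the rational map
  \<open>\<psi> \<circ> \<phi>\<inverse>\<close> is biregular at \<open>p\<close> and takes the value \<open>q\<close> there, i.e. it and its inverse have
  representatives that are regular at \<open>p\<close> and \<open>q\<close>.\<close>

definition biregular_at :: "(c2 \<Rightarrow> c2) \<Rightarrow> (c2 \<Rightarrow> c2) \<Rightarrow> c2 \<Rightarrow> c2 \<Rightarrow> bool"
  where "biregular_at \<phi> \<psi> p q \<longleftrightarrow> (\<exists>R R'.
    regular R p \<and> ratval R p = q \<and> regular R' q \<and> ratval R' q = p \<and>
    generically (\<lambda>z. regular R (\<phi> z) \<and> ratval R (\<phi> z) = \<psi> z) \<and>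
    generically (\<lambda>z. regular R' (\<psi> z) \<and> ratval R' (\<psi> z) = \<phi> z))"

definition area_form :: "c2 \<Rightarrow> c2 \<Rightarrow> complex"
  where "area_form v w = fst v * snd w - snd v * fst w"

definition symplectic :: "(c2 \<Rightarrow> c2) \<Rightarrow> bool"
  where "symplectic \<phi> \<longleftrightarrow> generically (\<lambda>z. \<exists>D. (\<phi> has_derivative D) (at z) \<and>
    (\<forall>v w. area_form (D v) (D w) = area_form v w))"

section \<open>Gluing and phase spaces\<close>

text \<open>The copy \<open>j\<close> of \<open>\<complex>\<^sup>2 \<times> \<complex>\<close> carries the coordinates \<open>(x\<^sub>j, y\<^sub>j) = \<phi> j (x, y)\<close> and \<open>t\<close>.  For \<open>i = j\<close>
  and birational \<open>\<phi> i\<close> the relation is equality.\<close>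

definition glue :: "nat set \<Rightarrow> (nat \<Rightarrow> c2 \<Rightarrow> c2) \<Rightarrow> ((nat \<times> c2 \<times> complex) \<times> (nat \<times> c2 \<times> complex)) set"
  where "glue J \<phi> = {((i, p, s), (j, q, t)).
    i \<in> J \<and> j \<in> J \<and> s = t \<and> biregular_at (\<phi> i) (\<phi> j) p q}"

type_synonym glued_point = "(nat \<times> c2 \<times> complex) set"

definition glue_pt :: "nat set \<Rightarrow> (nat \<Rightarrow> c2 \<Rightarrow> c2) \<Rightarrow> nat \<Rightarrow> c2 \<times> complex \<Rightarrow> glued_point"
  where "glue_pt J \<phi> j = (\<lambda>(p, t). glue J \<phi> `` {(j, p, t)})"

definition total_space :: "nat set \<Rightarrow> (nat \<Rightarrow> c2 \<Rightarrow> c2) \<Rightarrow> (c2 \<times> complex, glued_point) atlas"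
  where "total_space J \<phi> = (\<lambda>j. (UNIV, glue_pt J \<phi> j)) ` J"

definition fibre :: "nat set \<Rightarrow> (nat \<Rightarrow> c2 \<Rightarrow> c2) \<Rightarrow> complex \<Rightarrow> (c2, glued_point) atlas"
  where "fibre J \<phi> t = (\<lambda>j. (UNIV, \<lambda>p. glue_pt J \<phi> j (p, t))) ` J"

text \<open>A planar system is given by its right-hand side \<open>f t (x, y)\<close>; time is complex.\<close>

type_synonym system = "complex \<Rightarrow> c2 \<Rightarrow> c2"

definition solves_at :: "system \<Rightarrow> (complex \<Rightarrow> c2) \<Rightarrow> complex \<Rightarrow> bool"
  where "solves_at f u t \<longleftrightarrow>
    ((\<lambda>s. fst (u s)) has_field_derivative fst (f t (u t))) (at t) \<and>
    ((\<lambda>s. snd (u s)) has_field_derivative snd (f t (u t))) (at t)"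

definition polynomial_system :: "system \<Rightarrow> bool"
  where "polynomial_system g \<longleftrightarrow> (\<exists>N a b.
    (\<forall>i k. a i k holomorphic_on UNIV \<and> b i k holomorphic_on UNIV) \<and>
    (\<forall>t x y. g t (x, y) =
      ((\<Sum>i\<le>N. \<Sum>k\<le>N. a i k t * x ^ i * y ^ k), (\<Sum>i\<le>N. \<Sum>k\<le>N. b i k t * x ^ i * y ^ k))))"

text \<open>\<open>g\<close> is the system \<open>f\<close> rewritten in the coordinates \<open>\<phi>\<close>.\<close>

definition rewritten :: "system \<Rightarrow> (c2 \<Rightarrow> c2) \<Rightarrow> system \<Rightarrow> bool"
  where "rewritten f \<phi> g \<longleftrightarrow> (\<forall>A u v. open A \<longrightarrow> (\<forall>t\<in>A. biregular_at id \<phi> (u t) (v t)) \<longrightarrow>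
    ((\<forall>t\<in>A. solves_at f u t) \<longleftrightarrow> (\<forall>t\<in>A. solves_at g v t)))"

text \<open>The copy \<open>0\<close> is the one with the original coordinates, and the base is the whole \<open>t\<close>-line.\<close>

definition phase_space :: "system \<Rightarrow> nat set \<Rightarrow> (nat \<Rightarrow> c2 \<Rightarrow> c2) \<Rightarrow> bool"
  where "phase_space f J \<phi> \<longleftrightarrow>
    0 \<in> J \<and> \<phi> 0 = id \<and>
    equiv (J \<times> UNIV) (glue J \<phi>) \<and>
    complex_manifold (total_space J \<phi>) \<and>
    (\<exists>\<tau>. holomorphic_map (total_space J \<phi>) {(UNIV, id)} \<tau> \<and>
      (\<forall>j\<in>J. \<forall>p t. \<tau> (glue_pt J \<phi> j (p, t)) = (t :: complex))) \<and>
    (\<forall>j\<in>J. \<exists>g. polynomial_system g \<and> rewritten f (\<phi> j) g) \<and>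
    (\<forall>t0 x y. x meromorphic_on {t0} \<longrightarrow> y meromorphic_on {t0} \<longrightarrow>
      (\<forall>\<^sub>F t in at t0. solves_at f (\<lambda>t. (x t, y t)) t) \<longrightarrow>
      (\<exists>r>0. \<exists>\<sigma>. holomorphic_map {(ball t0 r, id)} (total_space J \<phi>) \<sigma> \<and>
        (\<forall>t\<in>ball t0 r - {t0}. \<sigma> t = glue_pt J \<phi> 0 ((x t, y t), t))))"

section \<open>The system and its transformations\<close>

definition the_system :: system
  where "the_system t = (\<lambda>(x, y). (x * y, - (y\<^sup>2 / 2) + 4 * x))"

definition coords :: "nat \<Rightarrow> c2 \<Rightarrow> c2"
  where "coords j = (\<lambda>(x, y).
    if j = 0 then (x, y)
    else if j = 1 then (- (x - y\<^sup>2 / 4) * y\<^sup>2, 1 / y)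
    else (- x * y\<^sup>2, 1 / y))"

end

theory Submission
  imports Defs
begin

text \<open>In terms of \<open>v = 1 / y\<close> and \<open>P = x / y\<^sup>2\<close> the system reads \<open>v' = 1 / 2 - 4 P\<close>, \<open>v P' = 2 P (1 - 4 P)\<close>,
  which leaves the values \<open>P = 0\<close> and \<open>P = 1 / 4\<close> at a pole of \<open>y\<close>. Accordingly the surface arises from the plane by
  nine blow-ups: three at points infinitely near to \<open>(0 : 0 : 1)\<close> along \<open>x = - x\<^sub>2 / y\<^sup>2\<close> and six at
  points infinitely near to \<open>(0 : 1 : 0)\<close> along \<open>x = y\<^sup>2 / 4 - x\<^sub>1 / y\<^sup>2\<close>. The two last exceptional
  curves, each without one point, are the lines \<open>y\<^sub>2 = 0\<close> and \<open>y\<^sub>1 = 0\<close>; the line at infinity and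
  the other exceptional curves form the configuration \<open>E\<^sub>7\<^sup>(\<^sup>1\<^sup>)\<close>.

  The gluing is an equality of points of this surface, because each of its coordinate changes is given
  by the rational relations exactly where these are biregular.

  At a pole of \<open>y\<close> the functions \<open>v\<close> and \<open>P\<close> are holomorphic, and \<open>x\<^sub>1\<close> and \<open>x\<^sub>2\<close> solve linear equations
  along the solution; so one of them continues holomorphically, and the solution enters chart 1 or 2.\<close>

section \<open>Complex differentiability\<close>

text \<open>The exponents and the number of blow-ups come from the order of \<open>P - c\<close> at
  a pole of \<open>y\<close>, where \<open>c\<close> is 0 or 1/4. There v' tends to 1/2 or -1/2, so
  (P - c)' / (P - c) behaves like 4 / (t - t0) unless \<open>P\<close> is constantly
  \<open>c\<close>: \<open>P - c\<close> vanishes to order four with a free coefficient. Hence (P -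
  c) / v^4 stays finite and tells apart the solutions that run into the same base point; it is -x_2
  or -x_1. At (0 : 0 : 1) the coordinates are (v, P / v), and three blow-ups lead to P / v^4. At (0
  : 1 : 0) two blow-ups are spent until \<open>P\<close> itself is a coordinate, and four more lead
  to (P - 1/4) / v^4.

  The main burden is to carry charts through nine blow-ups. Points of the surface are explicit terms
  built from \<open>Plane\<close> and \<open>Exc\<close>, so questions such as which chart contains
  a centre, or which curves meet, become equations between constructors and lines.
  Self-intersections are not obtained from a calculus of divisors: each boundary curve is covered by
  two charts glued by (z, w) |-> (1/z, z^2 w), from which its rationality and its number -2 are read
  off.\<close>

lemma scaleC_zero_right [simp]: "scaleC c (0 :: 'a::complex_space) = 0"
  using scaleC_add_right[of c "0 :: 'a" 0] by simp

lemma scaleC_complex [simp]: "scaleC c (z :: complex) = c * z"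
  by (simp add: scaleC_complex_def)

lemma scaleC_Pair [simp]: "scaleC c (a, b) = (scaleC c a, scaleC c b)"
  by (simp add: scaleC_prod_def)

lemma fst_scaleC [simp]: "fst (scaleC c v) = scaleC c (fst v)"
  and snd_scaleC [simp]: "snd (scaleC c v) = scaleC c (snd v)"
  by (simp_all add: scaleC_prod_def)

text \<open>Pointwise form of \<open>cholomorphic_on\<close>, so that germs can be composed and
  compared without naming a common domain.\<close>

definition cdifferentiable_at :: "('m::complex_space \<Rightarrow> 'n::complex_space) \<Rightarrow> 'm \<Rightarrow> bool"
  where "cdifferentiable_at f z \<longleftrightarrow>
    (\<exists>D. (f has_derivative D) (at z) \<and> (\<forall>c v. D (scaleC c v) = scaleC c (D v)))"

lemma cholomorphic_on_iff: "cholomorphic_on f U \<longleftrightarrow> (\<forall>z\<in>U. cdifferentiable_at f z)"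
  by (simp add: cholomorphic_on_def cdifferentiable_at_def)

named_theorems cdiff_intros

lemma cdiff_const [cdiff_intros]: "cdifferentiable_at (\<lambda>z. c) z"
  unfolding cdifferentiable_at_def by (intro exI[of _ "\<lambda>_. 0"]) auto

lemma cdiff_ident [cdiff_intros]: "cdifferentiable_at (\<lambda>z. z) z"
  unfolding cdifferentiable_at_def by (intro exI[of _ "\<lambda>v. v"]) auto

lemma cdiff_compose:
  assumes "cdifferentiable_at f z" "cdifferentiable_at g (f z)"
  shows "cdifferentiable_at (\<lambda>x. g (f x)) z"
proof -
  obtain D where D: "(f has_derivative D) (at z)" "\<And>c v. D (scaleC c v) = scaleC c (D v)"
    using assms(1) by (auto simp: cdifferentiable_at_def)
  obtain E where E: "(g has_derivative E) (at (f z))" "\<And>c v. E (scaleC c v) = scaleC c (E v)"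
    using assms(2) by (auto simp: cdifferentiable_at_def)
  have "((\<lambda>x. g (f x)) has_derivative (\<lambda>x. E (D x))) (at z)"
    by (rule has_derivative_compose[OF D(1) E(1)])
  then show ?thesis
    unfolding cdifferentiable_at_def using D(2) E(2) by (intro exI[of _ "\<lambda>x. E (D x)"]) auto
qed

lemma cdiff_Pair [cdiff_intros]:
  assumes "cdifferentiable_at f z" "cdifferentiable_at g z"
  shows "cdifferentiable_at (\<lambda>x. (f x, g x)) z"
proof -
  obtain D where D: "(f has_derivative D) (at z)" "\<And>c v. D (scaleC c v) = scaleC c (D v)"
    using assms(1) by (auto simp: cdifferentiable_at_def)
  obtain E where E: "(g has_derivative E) (at z)" "\<And>c v. E (scaleC c v) = scaleC c (E v)"
    using assms(2) by (auto simp: cdifferentiable_at_def)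
  show ?thesis
    unfolding cdifferentiable_at_def
    using has_derivative_Pair[OF D(1) E(1)] D(2) E(2)
    by (intro exI[of _ "\<lambda>h. (D h, E h)"]) auto
qed

lemma cdiff_fst [cdiff_intros]:
  assumes "cdifferentiable_at f z" shows "cdifferentiable_at (\<lambda>x. fst (f x)) z"
proof -
  have "cdifferentiable_at fst w" for w :: "'b \<times> 'c"
    unfolding cdifferentiable_at_def
    by (intro exI[of _ fst]) (auto intro!: derivative_eq_intros)
  from cdiff_compose[OF assms this] show ?thesis .
qed

lemma cdiff_snd [cdiff_intros]:
  assumes "cdifferentiable_at f z" shows "cdifferentiable_at (\<lambda>x. snd (f x)) z"
proof -
  have "cdifferentiable_at snd w" for w :: "'b \<times> 'c"
    unfolding cdifferentiable_at_def
    by (intro exI[of _ snd]) (auto intro!: derivative_eq_intros)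
  from cdiff_compose[OF assms this] show ?thesis .
qed

lemma cdiff_add [cdiff_intros]:
  fixes f g :: "'m::complex_space \<Rightarrow> complex"
  assumes "cdifferentiable_at f z" "cdifferentiable_at g z"
  shows "cdifferentiable_at (\<lambda>x. f x + g x) z"
proof -
  obtain D where D: "(f has_derivative D) (at z)" "\<And>c v. D (scaleC c v) = c * D v"
    using assms(1) by (auto simp: cdifferentiable_at_def)
  obtain E where E: "(g has_derivative E) (at z)" "\<And>c v. E (scaleC c v) = c * E v"
    using assms(2) by (auto simp: cdifferentiable_at_def)
  show ?thesis
    unfolding cdifferentiable_at_def
    using has_derivative_add[OF D(1) E(1)] D(2) E(2)
    by (intro exI[of _ "\<lambda>h. D h + E h"]) (auto simp: algebra_simps)
qed

lemma cdiff_mult [cdiff_intros]: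
  fixes f g :: "'m::complex_space \<Rightarrow> complex"
  assumes "cdifferentiable_at f z" "cdifferentiable_at g z"
  shows "cdifferentiable_at (\<lambda>x. f x * g x) z"
proof -
  obtain D where D: "(f has_derivative D) (at z)" "\<And>c v. D (scaleC c v) = c * D v"
    using assms(1) by (auto simp: cdifferentiable_at_def)
  obtain E where E: "(g has_derivative E) (at z)" "\<And>c v. E (scaleC c v) = c * E v"
    using assms(2) by (auto simp: cdifferentiable_at_def)
  show ?thesis
    unfolding cdifferentiable_at_def
    using has_derivative_mult[OF D(1) E(1)] D(2) E(2)
    by (intro exI[of _ "\<lambda>h. f z * E h + D h * g z"]) (auto simp: algebra_simps)
qed

lemma cdiff_field:
  fixes f :: "complex \<Rightarrow> complex"
  assumes "f field_differentiable (at z)" shows "cdifferentiable_at f z"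
proof -
  obtain d where "(f has_derivative (\<lambda>h. d * h)) (at z)"
    using assms by (auto simp: field_differentiable_def has_field_derivative_def)
  then show ?thesis
    unfolding cdifferentiable_at_def by (intro exI[of _ "\<lambda>h. d * h"]) auto
qed

lemma cdiff_minus [cdiff_intros]:
  fixes f :: "'m::complex_space \<Rightarrow> complex"
  assumes "cdifferentiable_at f z" shows "cdifferentiable_at (\<lambda>x. - f x) z"
  using cdiff_mult[OF cdiff_const[of "-1"] assms] by simp

lemma cdiff_diff [cdiff_intros]:
  fixes f g :: "'m::complex_space \<Rightarrow> complex"
  assumes "cdifferentiable_at f z" "cdifferentiable_at g z"
  shows "cdifferentiable_at (\<lambda>x. f x - g x) z"
  using cdiff_add[OF assms(1) cdiff_minus[OF assms(2)]] by simp

lemma cdiff_power [cdiff_intros]: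
  fixes f :: "'m::complex_space \<Rightarrow> complex"
  assumes "cdifferentiable_at f z" shows "cdifferentiable_at (\<lambda>x. f x ^ n) z"
  by (induction n) (auto intro!: cdiff_intros assms)

lemma cdiff_divide [cdiff_intros]:
  fixes f g :: "'m::complex_space \<Rightarrow> complex"
  assumes "cdifferentiable_at f z" "cdifferentiable_at g z" "g z \<noteq> 0"
  shows "cdifferentiable_at (\<lambda>x. f x / g x) z"
proof -
  have "inverse field_differentiable (at (g z))"
    using field_differentiable_inverse[OF field_differentiable_ident assms(3)] by simp
  then have "cdifferentiable_at (\<lambda>x. inverse (g x)) z"
    by (intro cdiff_compose[OF assms(2)] cdiff_field)
  from cdiff_mult[OF assms(1) this] show ?thesis by (simp add: divide_inverse)
qed

lemma cdiff_isCont: "cdifferentiable_at f z \<Longrightarrow> isCont f z"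
  by (auto simp: cdifferentiable_at_def intro: has_derivative_continuous)

lemma cdiff_tendsto: "cdifferentiable_at f z \<Longrightarrow> filterlim f (nhds (f z)) (nhds z)"
  by (drule cdiff_isCont) (simp add: isCont_def tendsto_at_iff_tendsto_nhds)

text \<open>Continuity in filter form. Every shrinking of a neighbourhood below is an instance of
  this.\<close>

lemma cdiff_eventually:
  "cdifferentiable_at f z \<Longrightarrow> \<forall>\<^sub>F w in nhds (f z). P w \<Longrightarrow> \<forall>\<^sub>F x in nhds z. P (f x)"
  by (rule eventually_compose_filterlim[OF _ cdiff_tendsto])

lemma cdiff_cong:
  assumes "cdifferentiable_at f z" "\<forall>\<^sub>F x in nhds z. g x = f x"
  shows "cdifferentiable_at g z"
proof -
  have "\<forall>\<^sub>F x in at z. f x = g x"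
    unfolding eventually_at_filter using assms(2) by eventually_elim simp
  then have "(g has_derivative D) (at z)" if "(f has_derivative D) (at z)" for D
    using has_derivative_transform_eventually[of f D z UNIV g] that
      eventually_nhds_x_imp_x[OF assms(2)] by simp
  then show ?thesis using assms(1) by (auto simp: cdifferentiable_at_def)
qed

section \<open>Charts and coordinate changes\<close>

declare split_paired_All [simp del] split_paired_Ex [simp del]

text \<open>Charts are injections into a bare set, so a coordinate change is handled as a germ
  \<open>f\<close> that expresses \<open>c\<close> through \<open>d\<close> near \<open>z\<close>.
  The two model spaces may differ in dimension.\<close>

abbreviation lifts :: "('m::complex_space \<Rightarrow> 'n::complex_space) \<Rightarrow> ('m, 'a) chart \<Rightarrow> ('n, 'a) chart \<Rightarrow> 'm \<Rightarrow> bool"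
  where "lifts f c d z \<equiv> \<forall>\<^sub>F x in nhds z. x \<in> fst c \<and> f x \<in> fst d \<and> snd d (f x) = snd c x"

text \<open>One direction of \<open>compatible\<close>, but with independent model spaces, so that
  the same notion also expresses holomorphy of a map between manifolds, as in
  \<open>holomorphic_map_iff\<close>.\<close>

definition holomorphic_transition ::
    "('m::complex_space, 'a) chart \<Rightarrow> ('n::complex_space, 'a) chart \<Rightarrow> bool"
  where "holomorphic_transition c d \<longleftrightarrow>
    open (overlap c d) \<and> cholomorphic_on (transition c d) (overlap c d)"

lemma transition_eqI:
  assumes "inj_on (snd d) (fst d)" "w \<in> fst d" "snd d w = snd c z"
  shows "transition c d z = w"
  using assms by (metis transition_def inv_into_f_f)

lemma transition_in:
  assumes "z \<in> overlap c d"
  shows "transition c d z \<in> fst d" "snd d (transition c d z) = snd c z"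
  using assms by (auto simp: transition_def overlap_def inv_into_into f_inv_into_f)

lemma overlapI: "z \<in> fst c \<Longrightarrow> w \<in> fst d \<Longrightarrow> snd c z = snd d w \<Longrightarrow> z \<in> overlap c d"
  by (auto simp: overlap_def)

lemma overlapE:
  assumes "z \<in> overlap c d"
  obtains w where "z \<in> fst c" "w \<in> fst d" "snd c z = snd d w"
  using assms by (auto simp: overlap_def)

text \<open>The germ of a lift \<open>f\<close> of \<open>c\<close> through \<open>d\<close> suffices; this avoids computing the overlaps.\<close>

lemma holomorphic_transition_iff:
  assumes "inj_on (snd d) (fst d)"
  shows "holomorphic_transition c d \<longleftrightarrow> (\<forall>z\<in>overlap c d. \<exists>f. cdifferentiable_at f z \<and> lifts f c d z)"
proof
  assume L: "holomorphic_transition c d"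
  show "\<forall>z\<in>overlap c d. \<exists>f. cdifferentiable_at f z \<and> lifts f c d z"
  proof
    fix z assume z: "z \<in> overlap c d"
    have "\<forall>\<^sub>F x in nhds z. x \<in> overlap c d"
      using L z by (auto simp: holomorphic_transition_def intro: eventually_nhds_in_open)
    then have "\<forall>\<^sub>F x in nhds z. x \<in> fst c \<and> transition c d x \<in> fst d \<and>
        snd d (transition c d x) = snd c x"
      by eventually_elim (simp add: transition_in, simp add: overlap_def)
    then show "\<exists>f. cdifferentiable_at f z \<and> lifts f c d z"
      using L z by (auto simp: holomorphic_transition_def cholomorphic_on_iff)
  qed
next
  assume R: "\<forall>z\<in>overlap c d. \<exists>f. cdifferentiable_at f z \<and> lifts f c d z"
  have "\<forall>\<^sub>F x in nhds z. x \<in> overlap c d" if "z \<in> overlap c d" for z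
  proof -
    from R that obtain f where
      "lifts f c d z" by blast
    then show ?thesis by eventually_elim (metis overlapI)
  qed
  then have "open (overlap c d)"
    by (subst open_subopen) (auto simp: eventually_nhds subset_eq)
  moreover have "cdifferentiable_at (transition c d) z" if "z \<in> overlap c d" for z
  proof -
    from R that obtain f where f: "cdifferentiable_at f z"
      "lifts f c d z" by blast
    from f(2) have "\<forall>\<^sub>F x in nhds z. transition c d x = f x"
      by eventually_elim (metis transition_eqI assms)
    with f(1) show ?thesis by (rule cdiff_cong)
  qed
  ultimately show "holomorphic_transition c d"
    by (simp add: holomorphic_transition_def cholomorphic_on_iff)
qed

lemma holomorphic_transitionI:
  assumes "inj_on (snd d) (fst d)"
    and "\<And>z w. z \<in> fst c \<Longrightarrow> w \<in> fst d \<Longrightarrow> snd c z = snd d w \<Longrightarrow>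
      \<exists>f. cdifferentiable_at f z \<and> lifts f c d z"
  shows "holomorphic_transition c d"
  unfolding holomorphic_transition_iff[OF assms(1)]
proof
  fix z assume "z \<in> overlap c d"
  then obtain w where "z \<in> fst c" "w \<in> fst d" "snd c z = snd d w" by (rule overlapE)
  then show "\<exists>f. cdifferentiable_at f z \<and> lifts f c d z"
    by (rule assms(2))
qed

lemma holomorphic_transitionE:
  assumes "holomorphic_transition c d" "inj_on (snd d) (fst d)"
    and "z \<in> fst c" "w \<in> fst d" "snd c z = snd d w"
  obtains f where "cdifferentiable_at f z" "f z = w"
    "lifts f c d z"
proof -
  obtain f where f: "cdifferentiable_at f z"
    "lifts f c d z"
    using assms(1) overlapI[OF assms(3-5)] unfolding holomorphic_transition_iff[OF assms(2)]
    by blast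
  have "f z = w"
    using eventually_nhds_x_imp_x[OF f(2)] assms by (intro inj_onD[OF assms(2)]) auto
  from that[OF f(1) this f(2)] show ?thesis .
qed

lemma compatible_iff: "compatible c d \<longleftrightarrow> open (fst c) \<and> open (fst d) \<and>
    inj_on (snd c) (fst c) \<and> inj_on (snd d) (fst d) \<and>
    holomorphic_transition c d \<and> holomorphic_transition d c"
  by (auto simp: compatible_def holomorphic_transition_def)

lemma compatible_sym: "compatible c d \<Longrightarrow> compatible d c"
  by (auto simp: compatible_iff)

text \<open>Germs compose, and holomorphy is local; the intermediate chart \<open>e\<close> may
  therefore depend on the point.\<close>

lemma holomorphic_transition_trans:
  fixes c :: "('m::complex_space, 'a) chart" and d :: "('n::complex_space, 'a) chart"
  assumes inj: "inj_on (snd d) (fst d)"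
    and mid: "\<And>z w. z \<in> fst c \<Longrightarrow> w \<in> fst d \<Longrightarrow> snd c z = snd d w \<Longrightarrow>
      \<exists>e :: ('e::complex_space, 'a) chart. snd c z \<in> snd e ` fst e \<and>
        inj_on (snd e) (fst e) \<and> holomorphic_transition c e \<and> holomorphic_transition e d"
  shows "holomorphic_transition c d"
proof (rule holomorphic_transitionI[OF inj])
  fix z w assume zw: "z \<in> fst c" "w \<in> fst d" "snd c z = snd d w"
  from mid[OF this] obtain e :: "('e, 'a) chart" where "snd c z \<in> snd e ` fst e" and e': "inj_on (snd e) (fst e)"
    "holomorphic_transition c e" "holomorphic_transition e d"
    by (elim exE conjE)
  then obtain y where "snd c z = snd e y" "y \<in> fst e" by (elim imageE)
  note e = this e'
  obtain f where f: "cdifferentiable_at f z" "f z = y"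
    "lifts f c e z"
    by (rule holomorphic_transitionE[OF e(4,3) zw(1) e(2,1)])
  obtain g where g: "cdifferentiable_at g y"
    "lifts g e d y"
    by (rule holomorphic_transitionE[OF e(5) inj e(2) zw(2)]) (use e(1) zw(3) in auto)
  have "cdifferentiable_at (\<lambda>x. g (f x)) z"
    using f g by (auto intro: cdiff_compose)
  moreover have "\<forall>\<^sub>F x in nhds z. f x \<in> fst e \<and> g (f x) \<in> fst d \<and> snd d (g (f x)) = snd e (f x)"
    using cdiff_eventually[OF f(1)] g(2) f(2) by blast
  with f(3) have "\<forall>\<^sub>F x in nhds z. x \<in> fst c \<and> g (f x) \<in> fst d \<and> snd d (g (f x)) = snd c x"
    by eventually_elim auto
  ultimately show "\<exists>f. cdifferentiable_at f z \<and> lifts f c d z"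
    by (intro exI[of _ "\<lambda>x. g (f x)"]) simp
qed

lemma holomorphic_transition_via:
  fixes c :: "('m::complex_space, 'a) chart" and d :: "('n::complex_space, 'a) chart"
    and e :: "('e::complex_space, 'a) chart"
  assumes "inj_on (snd d) (fst d)" "inj_on (snd e) (fst e)"
    and "holomorphic_transition c e" "holomorphic_transition e d"
    and "snd c ` fst c \<subseteq> snd e ` fst e \<or> snd d ` fst d \<subseteq> snd e ` fst e"
  shows "holomorphic_transition c d"
proof (rule holomorphic_transition_trans[OF assms(1)])
  fix z w assume zw: "z \<in> fst c" "w \<in> fst d" "snd c z = snd d w"
  have "snd c z \<in> snd e ` fst e"
    using assms(5)
  proof
    assume "snd c ` fst c \<subseteq> snd e ` fst e"
    then show ?thesis using imageI[OF zw(1)] by (rule subsetD)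
  next
    assume "snd d ` fst d \<subseteq> snd e ` fst e"
    then show ?thesis unfolding zw(3) using imageI[OF zw(2)] by (rule subsetD)
  qed
  then show "\<exists>e :: ('e, 'a) chart. snd c z \<in> snd e ` fst e \<and> inj_on (snd e) (fst e) \<and>
      holomorphic_transition c e \<and> holomorphic_transition e d"
    using assms(2-4) by blast
qed

lemma local_coordinates_iff:
  "local_coordinates A c \<longleftrightarrow> snd c ` fst c \<subseteq> points A \<and> (\<forall>d\<in>A. compatible c d)"
  by (simp add: local_coordinates_def)

text \<open>The algebraic half of \<open>complex_manifold\<close>. Hausdorffness and countability
  are treated separately, because the handling of charts rests on this half.\<close>

definition compatible_atlas :: "('m::complex_space, 'a) atlas \<Rightarrow> bool"
  where "compatible_atlas A \<longleftrightarrow> (\<forall>c\<in>A. \<forall>d\<in>A. compatible c d)"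

lemma points_iff: "q \<in> points A \<longleftrightarrow> (\<exists>c\<in>A. q \<in> snd c ` fst c)"
  by (force simp: points_def)

lemma local_coordinates_member: "compatible_atlas A \<Longrightarrow> c \<in> A \<Longrightarrow> local_coordinates A c"
  unfolding local_coordinates_iff compatible_atlas_def points_iff subset_eq by blast

lemma local_coordinates_points: "local_coordinates A c \<Longrightarrow> z \<in> fst c \<Longrightarrow> snd c z \<in> points A"
  unfolding local_coordinates_iff by (elim conjE subsetD imageI)

lemma points_empty [simp]: "points {} = {}"
  by (simp add: points_def)

lemma local_coordinates_open_inj:
  assumes c: "local_coordinates A c"
  shows "open (fst c) \<and> inj_on (snd c) (fst c)"
proof (cases "A = {}")
  \<comment> \<open>Over an empty atlas compatibility says nothing; but then there are no points,
    which forces the domain of the chart to be empty.\<close>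
  case True
  have "snd c ` fst c \<subseteq> points A" using c by (simp add: local_coordinates_iff)
  then have "fst c = {}" by (simp add: True)
  then show ?thesis by simp
next
  case False
  then obtain d where "d \<in> A" by (meson equals0I)
  with c have "compatible c d" by (simp add: local_coordinates_iff)
  then show ?thesis by (simp add: compatible_iff)
qed

lemma local_coordinates_open: "local_coordinates A c \<Longrightarrow> open (fst c)"
  by (simp add: local_coordinates_open_inj)

lemma local_coordinates_inj: "local_coordinates A c \<Longrightarrow> inj_on (snd c) (fst c)"
  by (simp add: local_coordinates_open_inj)

lemma pointsE:
  assumes "q \<in> points A"
  obtains c z where "c \<in> A" "z \<in> fst c" "q = snd c z"
  using assms by (force simp: points_def)

text \<open>Around each common point some chart of the atlas is available as an intermediate
  step.\<close>

lemma local_coordinates_holomorphic_transition: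
  assumes c: "local_coordinates A c" and d: "local_coordinates A d"
  shows "holomorphic_transition c d"
proof (rule holomorphic_transition_trans)
  show "inj_on (snd d) (fst d)" by (rule local_coordinates_inj[OF d])
  fix z w assume "z \<in> fst c" "w \<in> fst d" "snd c z = snd d w"
  have "snd c z \<in> points A" using c \<open>z \<in> fst c\<close> by (rule local_coordinates_points)
  then obtain e y where e: "e \<in> A" "y \<in> fst e" "snd c z = snd e y" by (rule pointsE)
  have "compatible c e" "compatible d e" using c d e(1) by (simp_all add: local_coordinates_iff)
  then show "\<exists>e :: ('a, 'b) chart. snd c z \<in> snd e ` fst e \<and> inj_on (snd e) (fst e) \<and>
      holomorphic_transition c e \<and> holomorphic_transition e d"
    using e by (intro exI[of _ e]) (simp add: compatible_iff)
qed

lemma local_coordinatesI: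
  assumes "compatible_atlas A" "open (fst c)" "inj_on (snd c) (fst c)"
    "snd c ` fst c \<subseteq> points A"
    "\<And>d. d \<in> A \<Longrightarrow> holomorphic_transition c d" "\<And>d. d \<in> A \<Longrightarrow> holomorphic_transition d c"
  shows "local_coordinates A c"
  using assms unfolding local_coordinates_iff compatible_iff compatible_atlas_def by blast

text \<open>A biholomorphic change \<open>h\<close> of parameters, with inverse \<open>k\<close>,
  turns known coordinates \<open>e\<close> on \<open>Y\<close> into new ones on \<open>V\<close>.
  This is the source of the charts that no blow-up provides directly.\<close>

lemma local_coordinates_reparam:
  assumes A: "compatible_atlas A" and e: "local_coordinates A e"
    and "open V" "open Y" "Y \<subseteq> fst e"
    and h: "\<And>z. z \<in> V \<Longrightarrow> cdifferentiable_at h z \<and> h z \<in> Y \<and> k (h z) = z \<and> \<psi> z = snd e (h z)"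
    and k: "\<And>y. y \<in> Y \<Longrightarrow> cdifferentiable_at k y \<and> k y \<in> V \<and> h (k y) = y"
  shows "local_coordinates A (V, \<psi>)"
proof -
  note ei = local_coordinates_inj[OF e]
  have inj: "inj_on (snd (V, \<psi>)) (fst (V, \<psi>))"
  proof (rule inj_onI)
    fix x y assume "x \<in> fst (V, \<psi>)" "y \<in> fst (V, \<psi>)" "snd (V, \<psi>) x = snd (V, \<psi>) y"
    then have "x \<in> V" "y \<in> V" "snd e (h x) = snd e (h y)" using h by auto
    then have "h x = h y" using h \<open>Y \<subseteq> fst e\<close> by (intro inj_onD[OF ei]) auto
    then show "x = y" using h \<open>x \<in> V\<close> \<open>y \<in> V\<close> by metis
  qed
  have 1: "holomorphic_transition (V, \<psi>) e"
  proof (rule holomorphic_transitionI[OF ei])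
    fix z assume "z \<in> fst (V, \<psi>)"
    then have z: "z \<in> V" by simp
    have "\<forall>\<^sub>F x in nhds z. x \<in> V" using \<open>open V\<close> z by (rule eventually_nhds_in_open)
    then have "lifts h (V, \<psi>) e z"
      by eventually_elim (use h \<open>Y \<subseteq> fst e\<close> in auto)
    then show "\<exists>f. cdifferentiable_at f z \<and> lifts f (V, \<psi>) e z"
      using h z by blast
  qed
  have 2: "holomorphic_transition e (V, \<psi>)"
  proof (rule holomorphic_transitionI[OF inj])
    fix z w assume z: "z \<in> fst e" "w \<in> fst (V, \<psi>)" "snd e z = snd (V, \<psi>) w"
    then have "z = h w" using h \<open>Y \<subseteq> fst e\<close> by (intro inj_onD[OF ei]) auto
    then have "z \<in> Y" using h z by auto
    with \<open>open Y\<close> have "\<forall>\<^sub>F x in nhds z. x \<in> Y" by (rule eventually_nhds_in_open)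
    then have "\<forall>\<^sub>F x in nhds z. x \<in> fst e \<and> k x \<in> fst (V, \<psi>) \<and> snd (V, \<psi>) (k x) = snd e x"
      by eventually_elim (use h k \<open>Y \<subseteq> fst e\<close> in auto)
    then show "\<exists>f. cdifferentiable_at f z \<and> lifts f e (V, \<psi>) z"
      using k \<open>z \<in> Y\<close> by blast
  qed
  show ?thesis
  proof (rule local_coordinatesI[OF A])
    show "snd (V, \<psi>) ` fst (V, \<psi>) \<subseteq> points A"
      using h \<open>Y \<subseteq> fst e\<close> local_coordinates_points[OF e] by auto
    fix d assume d: "d \<in> A"
    then have dl: "local_coordinates A d" by (rule local_coordinates_member[OF A])
    note di = local_coordinates_inj[OF dl]
    have im: "snd (V, \<psi>) ` fst (V, \<psi>) \<subseteq> snd e ` fst e"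
      using h \<open>Y \<subseteq> fst e\<close> by auto
    show "holomorphic_transition (V, \<psi>) d"
      using holomorphic_transition_via[OF di ei 1 local_coordinates_holomorphic_transition[OF e dl]]
        im by simp
    show "holomorphic_transition d (V, \<psi>)"
      using holomorphic_transition_via[OF inj ei local_coordinates_holomorphic_transition[OF dl e] 2]
        im by simp
  qed (use \<open>open V\<close> inj in auto)
qed

text \<open>Being a chart is a local property except for injectivity, which has to be supplied
  globally. Used where one formula is covered by two known charts, as for \<open>V0\<close> and
  \<open>H\<close>.\<close>

lemma local_coordinates_patch:
  assumes A: "compatible_atlas A" and inj: "inj_on \<psi> V"
    and cov: "\<And>z. z \<in> V \<Longrightarrow> \<exists>U. z \<in> U \<and> U \<subseteq> V \<and> local_coordinates A (U, \<psi>)"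
  shows "local_coordinates A (V, \<psi>)"
proof (rule local_coordinatesI[OF A])
  show "open (fst (V, \<psi>))"
    using cov local_coordinates_open by (subst open_subopen) fastforce
  show "snd (V, \<psi>) ` fst (V, \<psi>) \<subseteq> points A"
    using cov local_coordinates_points by fastforce
  show inj': "inj_on (snd (V, \<psi>)) (fst (V, \<psi>))" using inj by simp
  fix d assume "d \<in> A"
  then have d: "local_coordinates A d" by (rule local_coordinates_member[OF A])
  show "holomorphic_transition (V, \<psi>) d"
  proof (rule holomorphic_transitionI[OF local_coordinates_inj[OF d]])
    fix z w assume z: "z \<in> fst (V, \<psi>)" and w: "w \<in> fst d" "snd (V, \<psi>) z = snd d w"
    from z cov obtain U where U: "z \<in> U" "U \<subseteq> V" "local_coordinates A (U, \<psi>)" by auto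
    obtain f where "cdifferentiable_at f z"
      "lifts f (U, \<psi>) d z"
      using holomorphic_transitionE[OF local_coordinates_holomorphic_transition[OF U(3) d]
          local_coordinates_inj[OF d], of z w] U(1) w by auto
    then show "\<exists>f. cdifferentiable_at f z \<and> lifts f (V, \<psi>) d z"
      using U(2) by (auto elim!: eventually_mono)
  qed
  show "holomorphic_transition d (V, \<psi>)"
  proof (rule holomorphic_transitionI[OF inj'])
    fix w z assume z: "z \<in> fst (V, \<psi>)" and w: "w \<in> fst d" "snd d w = snd (V, \<psi>) z"
    from z cov obtain U where U: "z \<in> U" "U \<subseteq> V" "local_coordinates A (U, \<psi>)" by auto
    obtain f where "cdifferentiable_at f w"
      "lifts f d (U, \<psi>) w"
      using holomorphic_transitionE[OF local_coordinates_holomorphic_transition[OF d U(3)]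
          local_coordinates_inj[OF U(3)], of w z] U(1) w by auto
    then show "\<exists>f. cdifferentiable_at f w \<and> lifts f d (V, \<psi>) w"
      using U(2) by (auto elim!: eventually_mono)
  qed
qed

lemma local_coordinates_subset:
  assumes A: "compatible_atlas A" and c: "local_coordinates A (W, \<psi>)" and "open V" "V \<subseteq> W"
  shows "local_coordinates A (V, \<psi>)"
  by (rule local_coordinates_reparam[OF A c \<open>open V\<close> \<open>open V\<close>, where h = "\<lambda>z. z" and k = "\<lambda>z. z"])
    (use assms in \<open>auto intro: cdiff_intros\<close>)

lemma local_coordinates_swap:
  fixes W :: "c2 set"
  assumes A: "compatible_atlas A" and c: "local_coordinates A (W, \<psi>)"
  shows "local_coordinates A ({(z, w). (w, z) \<in> W}, \<lambda>(z, w). \<psi> (w, z))"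
proof -
  have W: "open W" using local_coordinates_open[OF c] by simp
  have 1: "continuous_on UNIV (\<lambda>z :: c2. (snd z, fst z))"
    by (intro continuous_intros)
  have "open ((\<lambda>z. (snd z, fst z)) -` W)" by (rule open_vimage[OF W 1])
  moreover have "(\<lambda>z. (snd z, fst z)) -` W = {(z, w). (w, z) \<in> W}" by auto
  ultimately have "open {(z, w). (w, z) \<in> W}" by simp
  then show ?thesis
    by (intro local_coordinates_reparam[OF A c _ W, where h = "\<lambda>z. (snd z, fst z)"
          and k = "\<lambda>z. (snd z, fst z)"]) (auto intro!: cdiff_intros)
qed


section \<open>The topology of an atlas\<close>

lemma mopen_iff: "mopen A U \<longleftrightarrow> U \<subseteq> points A \<and> (\<forall>c\<in>A. open {z \<in> fst c. snd c z \<in> U})"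
  unfolding mopen_def by (simp add: case_prod_unfold)

text \<open>\<open>mopen\<close> tests only the charts of the atlas; openness in other local
  coordinates follows by pulling back along the germ of a coordinate change.\<close>

lemma mopen_preimage:
  assumes c: "local_coordinates A c" and G: "mopen A G"
  shows "open {z \<in> fst c. snd c z \<in> G}"
proof (subst open_subopen, intro ballI)
  fix z assume z: "z \<in> {z \<in> fst c. snd c z \<in> G}"
  then have "snd c z \<in> points A" using local_coordinates_points[OF c] by simp
  then obtain d w where d: "d \<in> A" "w \<in> fst d" "snd c z = snd d w" by (rule pointsE)
  have cd: "compatible c d" using c d(1) by (simp add: local_coordinates_iff)
  then have "holomorphic_transition c d" "inj_on (snd d) (fst d)" "z \<in> fst c"
    using z by (simp_all add: compatible_iff)
  then obtain f where f: "cdifferentiable_at f z" "f z = w"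
    "lifts f c d z"
    using d(2,3) by (rule holomorphic_transitionE)
  have "open {z \<in> fst d. snd d z \<in> G}" using G d(1) by (simp add: mopen_iff)
  moreover have "w \<in> {z \<in> fst d. snd d z \<in> G}" using z d by simp
  ultimately have "\<forall>\<^sub>F y in nhds w. y \<in> {z \<in> fst d. snd d z \<in> G}"
    by (rule eventually_nhds_in_open)
  then have "\<forall>\<^sub>F x in nhds z. f x \<in> {z \<in> fst d. snd d z \<in> G}"
    by (intro cdiff_eventually[OF f(1)]) (simp add: f(2))
  with f(3) have "\<forall>\<^sub>F x in nhds z. x \<in> {z \<in> fst c. snd c z \<in> G}"
    by eventually_elim auto
  then show "\<exists>T. open T \<and> z \<in> T \<and> T \<subseteq> {z \<in> fst c. snd c z \<in> G}"
    unfolding eventually_nhds by blast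
qed

lemma mopen_image:
  assumes A: "compatible_atlas A" and c: "local_coordinates A c" and U: "open U" "U \<subseteq> fst c"
  shows "mopen A (snd c ` U)"
proof -
  obtain V \<psi> where c_eq: "c = (V, \<psi>)" by (cases c)
  have "local_coordinates A (U, \<psi>)"
    using c U unfolding c_eq by (auto intro: local_coordinates_subset[OF A, of V])
  then have "local_coordinates A (U, snd c)" by (simp add: c_eq)
  note cU = this
  have "open {z \<in> fst d. snd d z \<in> snd c ` U}" if "d \<in> A" for d
  proof -
    have "holomorphic_transition d (U, snd c)"
      using local_coordinates_holomorphic_transition[OF local_coordinates_member[OF A that] cU] .
    then show ?thesis by (simp add: holomorphic_transition_def overlap_def)
  qed
  moreover have "snd c ` U \<subseteq> points A" using cU by (simp add: local_coordinates_iff)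
  ultimately show ?thesis by (simp add: mopen_iff)
qed

lemma mopen_points: "compatible_atlas A \<Longrightarrow> mopen A (points A)"
  unfolding mopen_iff
proof (intro conjI ballI)
  fix c assume "compatible_atlas A" "c \<in> A"
  then have c: "local_coordinates A c" by (rule local_coordinates_member)
  then have "{z \<in> fst c. snd c z \<in> points A} = fst c"
    using local_coordinates_points by blast
  then show "open {z \<in> fst c. snd c z \<in> points A}" using local_coordinates_open[OF c] by simp
qed simp

lemma topspace_mtop: "compatible_atlas A \<Longrightarrow> topspace (mtop A) = points A"
proof
  assume "compatible_atlas A"
  then have "openin (mtop A) (points A)" by (simp add: openin_mtop mopen_points)
  then show "points A \<subseteq> topspace (mtop A)" by (rule openin_subset)
  have "mopen A (topspace (mtop A))" using openin_topspace[of "mtop A"] by (simp add: openin_mtop)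
  then show "topspace (mtop A) \<subseteq> points A" by (simp add: mopen_iff)
qed

lemma second_countable_mtop:
  fixes A :: "('m::{complex_space, second_countable_topology}, 'a) atlas"
  assumes A: "compatible_atlas A" and "countable A"
  shows "second_countable (mtop A)"
proof -
  obtain \<B> :: "'m set set" where \<B>: "countable \<B>" "topological_basis \<B>"
    using ex_countable_basis by blast
  define \<C> where "\<C> = (\<Union>c\<in>A. (\<lambda>B. snd c ` (B \<inter> fst c)) ` \<B>)"
  have "countable \<C>" unfolding \<C>_def using \<B>(1) \<open>countable A\<close> by auto
  moreover have "openin (mtop A) C" if "C \<in> \<C>" for C
  proof -
    from that obtain c B where cB: "c \<in> A" "B \<in> \<B>" "C = snd c ` (B \<inter> fst c)"
      unfolding \<C>_def by blast
    have c: "local_coordinates A c" by (rule local_coordinates_member[OF A cB(1)])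
    show ?thesis
      unfolding cB(3) openin_mtop
      using local_coordinates_open[OF c] topological_basis_open[OF \<B>(2) cB(2)]
      by (intro mopen_image[OF A c]) auto
  qed
  moreover have "\<exists>C\<in>\<C>. x \<in> C \<and> C \<subseteq> U" if "openin (mtop A) U" "x \<in> U" for U x
  proof -
    have U: "mopen A U" using that(1) by (simp add: openin_mtop)
    then have "x \<in> points A" using that(2) unfolding mopen_iff by blast
    then obtain c z where cz: "c \<in> A" "z \<in> fst c" "x = snd c z" by (rule pointsE)
    have "open {z \<in> fst c. snd c z \<in> U}" using U cz(1) by (simp add: mopen_iff)
    moreover have "z \<in> {z \<in> fst c. snd c z \<in> U}" using cz that by simp
    ultimately obtain B where "B \<in> \<B>" "z \<in> B" "B \<subseteq> {z \<in> fst c. snd c z \<in> U}"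
      by (rule topological_basisE[OF \<B>(2)])
    then show ?thesis unfolding \<C>_def using cz by (intro bexI[of _ "snd c ` (B \<inter> fst c)"]) auto
  qed
  ultimately show ?thesis unfolding second_countable_def by (intro exI[of _ \<C>]) blast
qed

section \<open>The Hausdorff axiom in terms of charts\<close>

abbreviation apart :: "('m::t2_space, 'a) chart \<Rightarrow> ('n::t2_space, 'a) chart \<Rightarrow> 'm \<Rightarrow> 'n \<Rightarrow> bool"
  where "apart c d z w \<equiv> \<forall>\<^sub>F q in nhds (z, w).
    fst q \<in> fst c \<longrightarrow> snd q \<in> fst d \<longrightarrow> snd c (fst q) \<noteq> snd d (snd q)"

text \<open>The set of pairs of parameters with the same image is closed in the product of the two
  domains. For transitions given by formulas this is visible from their equations.\<close>

definition separated :: "('m::t2_space, 'a) chart \<Rightarrow> ('n::t2_space, 'a) chart \<Rightarrow> bool"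
  where "separated c d \<longleftrightarrow> (\<forall>z\<in>fst c. \<forall>w\<in>fst d. snd c z \<noteq> snd d w \<longrightarrow>
    (apart c d z w))"

lemma separatedI:
  assumes "\<And>z w. z \<in> fst c \<Longrightarrow> w \<in> fst d \<Longrightarrow> snd c z \<noteq> snd d w \<Longrightarrow>
    apart c d z w"
  shows "separated c d"
  using assms unfolding separated_def by blast

lemma separatedD:
  assumes "separated c d" "z \<in> fst c" "w \<in> fst d" "snd c z \<noteq> snd d w"
  shows "apart c d z w"
  using assms unfolding separated_def by blast

lemma separated_sym: "separated c d \<Longrightarrow> separated d c"
proof (rule separatedI)
  fix z w assume s: "separated c d" and zw: "z \<in> fst d" "w \<in> fst c" "snd d z \<noteq> snd c w"
  have "apart c d w z"
    using zw by (intro separatedD[OF s]) auto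
  moreover have "filterlim prod.swap (nhds (w, z)) (nhds (z, w))"
    using isCont_swap[of "(z, w)"] unfolding isCont_def tendsto_at_iff_tendsto_nhds by simp
  ultimately have "\<forall>\<^sub>F q in nhds (z, w). fst (prod.swap q) \<in> fst c \<longrightarrow> snd (prod.swap q) \<in> fst d \<longrightarrow>
      snd c (fst (prod.swap q)) \<noteq> snd d (snd (prod.swap q))"
    by (rule eventually_compose_filterlim)
  then show "apart d c z w"
    by eventually_elim auto
qed

lemma separated_self:
  fixes c :: "('m::{real_normed_vector}, 'a) chart"
  assumes "inj_on (snd c) (fst c)" shows "separated c c"
proof (rule separatedI)
  fix z w assume "z \<in> fst c" "w \<in> fst c" "snd c z \<noteq> snd c w"
  then have "(z, w) \<in> {q. fst q \<noteq> snd q}" by auto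
  moreover have "open {q :: 'm \<times> 'm. fst q \<noteq> snd q}"
    by (intro open_Collect_neq continuous_intros)
  ultimately have "\<forall>\<^sub>F q in nhds (z, w). q \<in> {q. fst q \<noteq> snd q}"
    by (intro eventually_nhds_in_open)
  then show "apart c c z w"
    by eventually_elim (use assms in \<open>auto dest: inj_onD\<close>)
qed

text \<open>A neighbourhood of \<open>(z, w)\<close> contains a product of neighbourhoods, and the
  chart images of its two factors are disjoint open sets.\<close>

lemma Hausdorff_mtop:
  assumes A: "compatible_atlas A" and sep: "\<And>c d. c \<in> A \<Longrightarrow> d \<in> A \<Longrightarrow> separated c d"
  shows "Hausdorff_space (mtop A)"
  unfolding Hausdorff_space_def topspace_mtop[OF A] openin_mtop
proof (intro allI impI, elim conjE)
  fix x y assume "x \<in> points A" "y \<in> points A" "x \<noteq> y"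
  obtain c z where c: "c \<in> A" "z \<in> fst c" "x = snd c z" using \<open>x \<in> points A\<close> by (rule pointsE)
  obtain d w where d: "d \<in> A" "w \<in> fst d" "y = snd d w" using \<open>y \<in> points A\<close> by (rule pointsE)
  have lc: "local_coordinates A c" "local_coordinates A d"
    using A c(1) d(1) by (auto intro: local_coordinates_member)
  have "apart c d z w"
    using c d \<open>x \<noteq> y\<close> by (intro separatedD[OF sep]) auto
  then obtain P Q where PQ: "eventually P (nhds z)" "eventually Q (nhds w)"
    "\<And>a b. P a \<Longrightarrow> Q b \<Longrightarrow> a \<in> fst c \<Longrightarrow> b \<in> fst d \<Longrightarrow> snd c a \<noteq> snd d b"
    unfolding nhds_prod eventually_prod_filter by auto
  obtain U where U: "open U" "z \<in> U" "\<And>a. a \<in> U \<Longrightarrow> P a" using PQ(1) unfolding eventually_nhds by blast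
  obtain W where W: "open W" "w \<in> W" "\<And>a. a \<in> W \<Longrightarrow> Q a" using PQ(2) unfolding eventually_nhds by blast
  have "mopen A (snd c ` (U \<inter> fst c))" "mopen A (snd d ` (W \<inter> fst d))"
    using lc U(1) W(1) local_coordinates_open[OF lc(1)] local_coordinates_open[OF lc(2)]
    by (auto intro!: mopen_image[OF A])
  moreover have "disjnt (snd c ` (U \<inter> fst c)) (snd d ` (W \<inter> fst d))"
    unfolding disjnt_iff using PQ(3) U(3) W(3) by blast
  ultimately show "\<exists>U V. mopen A U \<and> mopen A V \<and> x \<in> U \<and> y \<in> V \<and> disjnt U V"
    using c d U(2) W(2) by blast
qed

text \<open>The converse direction, for all local coordinates. It makes Hausdorffness of a surface
  usable for the charts of its blow-up.\<close>

lemma separated_local_coordinates: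
  assumes A: "compatible_atlas A" "Hausdorff_space (mtop A)"
    and cd: "local_coordinates A c" "local_coordinates A d"
  shows "separated c d"
proof (rule separatedI)
  fix z w assume zw: "z \<in> fst c" "w \<in> fst d" "snd c z \<noteq> snd d w"
  then have "snd c z \<in> points A" "snd d w \<in> points A" using cd by (auto intro: local_coordinates_points)
  with A zw(3) obtain U V where UV: "mopen A U" "mopen A V" "snd c z \<in> U" "snd d w \<in> V" "disjnt U V"
    unfolding Hausdorff_space_def topspace_mtop[OF A(1)] openin_mtop by meson
  have "\<forall>\<^sub>F x in nhds z. x \<in> {z \<in> fst c. snd c z \<in> U}"
    using mopen_preimage[OF cd(1) UV(1)] UV(3) zw(1) by (intro eventually_nhds_in_open) auto
  moreover have "\<forall>\<^sub>F x in nhds w. x \<in> {z \<in> fst d. snd d z \<in> V}"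
    using mopen_preimage[OF cd(2) UV(2)] UV(4) zw(2) by (intro eventually_nhds_in_open) auto
  ultimately have "\<forall>\<^sub>F q in nhds z \<times>\<^sub>F nhds w.
      fst q \<in> {z \<in> fst c. snd c z \<in> U} \<and> snd q \<in> {z \<in> fst d. snd d z \<in> V}"
    unfolding eventually_prod_filter
    by (intro exI[of _ "\<lambda>x. x \<in> {z \<in> fst c. snd c z \<in> U}"] exI[of _ "\<lambda>x. x \<in> {z \<in> fst d. snd d z \<in> V}"])
      simp
  then show "apart c d z w"
    unfolding nhds_prod by eventually_elim (use UV(5) in \<open>auto simp: disjnt_iff\<close>)
qed

lemma complex_manifoldI:
  fixes A :: "('m::{complex_space, second_countable_topology}, 'a) atlas"
  assumes "compatible_atlas A" "finite A" "\<And>c d. c \<in> A \<Longrightarrow> d \<in> A \<Longrightarrow> separated c d"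
  shows "complex_manifold A"
  using assms Hausdorff_mtop[OF assms(1)] second_countable_mtop[OF assms(1) countable_finite]
  by (simp add: complex_manifold_def compatible_atlas_def)

section \<open>Restrictions and open embeddings\<close>

lemma cdiff_eventually_neq:
  fixes f :: "'m::complex_space \<Rightarrow> 'n::complex_space"
  assumes "cdifferentiable_at f z" "f z \<noteq> a" shows "\<forall>\<^sub>F x in nhds z. f x \<noteq> a"
proof -
  have "\<forall>\<^sub>F y in nhds (f z). y \<in> - {a}"
    by (rule eventually_nhds_in_open) (use assms(2) in auto)
  then have "\<forall>\<^sub>F x in nhds z. f x \<in> - {a}" by (rule cdiff_eventually[OF assms(1)])
  then show ?thesis by simp
qed

text \<open>Here \<open>f\<close> is an explicit formula and \<open>e\<close> its denominator:
  common points have nonzero denominator, and this condition is open.\<close>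

lemma holomorphic_transition_explicit:
  fixes e :: "'m::complex_space \<Rightarrow> complex"
  assumes inj: "inj_on (snd d) (fst d)" and c: "open (fst c)"
    and e: "\<And>z. cdifferentiable_at e z"
    and dom: "\<And>z w. z \<in> fst c \<Longrightarrow> w \<in> fst d \<Longrightarrow> snd c z = snd d w \<Longrightarrow> e z \<noteq> 0"
    and f: "\<And>z. z \<in> fst c \<Longrightarrow> e z \<noteq> 0 \<Longrightarrow> cdifferentiable_at f z \<and> f z \<in> fst d \<and> snd d (f z) = snd c z"
  shows "holomorphic_transition c d"
proof (rule holomorphic_transitionI[OF inj])
  fix z w assume zw: "z \<in> fst c" "w \<in> fst d" "snd c z = snd d w"
  then have ez: "e z \<noteq> 0" by (rule dom)
  have "\<forall>\<^sub>F x in nhds z. e x \<noteq> 0" by (rule cdiff_eventually_neq[OF e ez])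
  moreover have "\<forall>\<^sub>F x in nhds z. x \<in> fst c" by (rule eventually_nhds_in_open[OF c zw(1)])
  ultimately have "lifts f c d z"
    by eventually_elim (use f in auto)
  then show "\<exists>f. cdifferentiable_at f z \<and> lifts f c d z"
    using f[OF zw(1) ez] by blast
qed

text \<open>Coincidence of two points is a level set of the continuous function \<open>F\<close>,
  hence closed.\<close>

lemma separated_explicit:
  fixes F :: "'m::complex_space \<times> 'n::complex_space \<Rightarrow> 'o::complex_space"
  assumes F: "\<And>q. cdifferentiable_at F q"
    and iff: "\<And>z w. z \<in> fst c \<Longrightarrow> w \<in> fst d \<Longrightarrow> snd c z = snd d w \<longleftrightarrow> F (z, w) = a"
  shows "separated c d"
proof (rule separatedI)
  fix z w assume zw: "z \<in> fst c" "w \<in> fst d" "snd c z \<noteq> snd d w"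
  then have "F (z, w) \<noteq> a" using iff by blast
  then have "\<forall>\<^sub>F q in nhds (z, w). F q \<noteq> a" by (rule cdiff_eventually_neq[OF F])
  then show "apart c d z w"
    by eventually_elim (use iff in force)
qed

definition restrict_chart :: "'a set \<Rightarrow> ('m, 'a) chart \<Rightarrow> ('m, 'a) chart"
  where "restrict_chart U c = ({z \<in> fst c. snd c z \<in> U}, snd c)"

lemma restrict_atlas_eq: "restrict_atlas A U = restrict_chart U ` A"
  unfolding restrict_atlas_def restrict_chart_def by (simp add: case_prod_unfold)

lemma points_restrict_atlas: "points (restrict_atlas A U) = points A \<inter> U"
  unfolding restrict_atlas_eq points_def by (auto simp: restrict_chart_def)

lemma holomorphic_transition_restrict:
  assumes "holomorphic_transition c d" "inj_on (snd d) (fst d)" "open {z \<in> fst c. snd c z \<in> U}"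
  shows "holomorphic_transition (restrict_chart U c) (restrict_chart U d)"
proof (rule holomorphic_transitionI)
  show "inj_on (snd (restrict_chart U d)) (fst (restrict_chart U d))"
    using assms(2) by (auto simp: restrict_chart_def inj_on_def)
  fix z w assume zw: "z \<in> fst (restrict_chart U c)" "w \<in> fst (restrict_chart U d)"
    "snd (restrict_chart U c) z = snd (restrict_chart U d) w"
  then have "z \<in> fst c" "w \<in> fst d" "snd c z = snd d w" by (auto simp: restrict_chart_def)
  with assms(1,2) obtain f where f: "cdifferentiable_at f z"
    "lifts f c d z"
    by (rule holomorphic_transitionE)
  have "z \<in> {z \<in> fst c. snd c z \<in> U}" using zw(1) by (simp add: restrict_chart_def)
  with assms(3) have "\<forall>\<^sub>F x in nhds z. x \<in> {z \<in> fst c. snd c z \<in> U}"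
    by (rule eventually_nhds_in_open)
  with f(2) have "lifts f (restrict_chart U c) (restrict_chart U d) z"
    by eventually_elim (auto simp: restrict_chart_def)
  with f(1) show "\<exists>f. cdifferentiable_at f z \<and> lifts f (restrict_chart U c) (restrict_chart U d) z"
    by blast
qed

lemma compatible_restrict:
  assumes c: "local_coordinates A c" and d: "local_coordinates A d" and U: "mopen A U"
  shows "compatible (restrict_chart U c) (restrict_chart U d)"
proof -
  have cd: "open {z \<in> fst c. snd c z \<in> U}" "open {z \<in> fst d. snd d z \<in> U}"
    using c d U by (auto intro: mopen_preimage)
  have "inj_on (snd c) (fst c)" "inj_on (snd d) (fst d)"
    using c d by (auto intro: local_coordinates_inj)
  moreover from this
  have "holomorphic_transition (restrict_chart U c) (restrict_chart U d)"
    "holomorphic_transition (restrict_chart U d) (restrict_chart U c)"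
    using cd c d by (auto intro!: holomorphic_transition_restrict
        intro: local_coordinates_holomorphic_transition)
  ultimately show ?thesis
    unfolding compatible_iff using cd by (simp add: restrict_chart_def inj_on_def)
qed

lemma compatible_atlas_restrict:
  assumes "compatible_atlas A" "mopen A U" shows "compatible_atlas (restrict_atlas A U)"
  unfolding compatible_atlas_def restrict_atlas_eq
  using assms by (auto intro!: compatible_restrict intro: local_coordinates_member)

lemma local_coordinates_restrict:
  assumes "compatible_atlas A" "mopen A U" "local_coordinates A c"
  shows "local_coordinates (restrict_atlas A U) (restrict_chart U c)"
proof -
  have "snd (restrict_chart U c) ` fst (restrict_chart U c) \<subseteq> points (restrict_atlas A U)"
    using local_coordinates_points[OF assms(3)]
    by (auto simp: points_restrict_atlas restrict_chart_def)
  moreover have "compatible (restrict_chart U c) d" if "d \<in> restrict_atlas A U" for d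
  proof -
    from that obtain e where "e \<in> A" "d = restrict_chart U e" unfolding restrict_atlas_eq by blast
    then show ?thesis
      using assms by (auto intro: compatible_restrict local_coordinates_member)
  qed
  ultimately show ?thesis by (simp add: local_coordinates_iff)
qed

lemma restrict_chart_id: "(\<And>z. z \<in> fst c \<Longrightarrow> snd c z \<in> U) \<Longrightarrow> restrict_chart U c = c"
  by (cases c) (auto simp: restrict_chart_def)

lemma holomorphic_map_iff:
  "holomorphic_map A B f \<longleftrightarrow> f ` points A \<subseteq> points B \<and>
    (\<forall>c\<in>A. \<forall>d\<in>B. holomorphic_transition (fst c, f \<circ> snd c) d)"
  unfolding holomorphic_map_def holomorphic_transition_def by (simp add: case_prod_unfold)

text \<open>The composites of \<open>f\<close> with the charts of \<open>A\<close> are coordinates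
  on \<open>B\<close>, so a germ that lifts \<open>d\<close> through such a composite also lifts the
  inverse of \<open>f\<close> after \<open>d\<close> through the original chart. Both directions
  thus come from one hypothesis.\<close>

lemma biholomorphicI:
  assumes A: "compatible_atlas A" and B: "compatible_atlas B"
    and bij: "bij_betw f (points A) (points B)"
    and lc: "\<And>c. c \<in> A \<Longrightarrow> local_coordinates B (fst c, f \<circ> snd c)"
  shows "biholomorphic A B f"
proof -
  define g where "g = inv_into (points A) f"
  have gf: "g (f p) = p" if "p \<in> points A" for p
    using bij that unfolding g_def bij_betw_def by (simp add: inv_into_f_f)
  have fg: "f (g q) = q" "g q \<in> points A" if "q \<in> points B" for q
    using bij that unfolding g_def bij_betw_def by (auto simp: f_inv_into_f inv_into_into)
  have "holomorphic_map A B f"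
    unfolding holomorphic_map_iff
    using lc bij local_coordinates_member[OF B] by (auto simp: bij_betw_def
        intro!: local_coordinates_holomorphic_transition[of B])
  moreover have "holomorphic_transition (fst d, g \<circ> snd d) c" if cd: "d \<in> B" "c \<in> A" for c d
  proof (rule holomorphic_transitionI)
    have c: "local_coordinates A c" and d: "local_coordinates B d"
      using A B cd by (auto intro: local_coordinates_member)
    show "inj_on (snd c) (fst c)" by (rule local_coordinates_inj[OF c])
    fix z w assume "z \<in> fst (fst d, g \<circ> snd d)" "w \<in> fst c" "snd (fst d, g \<circ> snd d) z = snd c w"
    then have zw: "z \<in> fst d" "w \<in> fst c" "g (snd d z) = snd c w" by auto
    have "f (g (snd d z)) = snd d z" using fg local_coordinates_points[OF d zw(1)] by simp
    then have eq: "snd d z = snd (fst c, f \<circ> snd c) w" using zw(3) by simp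
    have t: "holomorphic_transition d (fst c, f \<circ> snd c)"
      and i: "inj_on (snd (fst c, f \<circ> snd c)) (fst (fst c, f \<circ> snd c))"
      by (rule local_coordinates_holomorphic_transition[OF d lc[OF cd(2)]],
          rule local_coordinates_inj[OF lc[OF cd(2)]])
    obtain h where h: "cdifferentiable_at h z"
      "lifts h d (fst c, f \<circ> snd c) z"
      using holomorphic_transitionE[OF t i zw(1) _ eq] zw(2) by auto
    from h(2) have "lifts h (fst d, g \<circ> snd d) c z"
    proof eventually_elim
      case (elim x)
      then have e: "snd d x = f (snd c (h x))" and hx: "h x \<in> fst c" by simp_all
      have "g (snd d x) = snd c (h x)"
        unfolding e by (rule gf) (rule local_coordinates_points[OF c hx])
      then show ?case using elim by simp
    qed
    with h(1) show "\<exists>f. cdifferentiable_at f z \<and> lifts f (fst d, g \<circ> snd d) c z"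
      by blast
  qed
  then have "holomorphic_map B A g"
    unfolding holomorphic_map_iff using fg(2) by auto
  ultimately show ?thesis using bij by (simp add: biholomorphic_def g_def)
qed

text \<open>The image is open because its preimage in a chart \<open>d\<close> is the union of the
  overlaps of \<open>d\<close> with the charts composed with \<open>f\<close>.\<close>

lemma open_embeddingI:
  assumes A: "compatible_atlas A" and B: "compatible_atlas B" and inj: "inj_on f (points A)"
    and lc: "\<And>c. c \<in> A \<Longrightarrow> local_coordinates B (fst c, f \<circ> snd c)"
  shows "open_embedding A B f"
proof -
  define U where "U = f ` points A"
  have sub: "U \<subseteq> points B"
  proof
    fix q assume "q \<in> U"
    then obtain p where "p \<in> points A" "q = f p" unfolding U_def by blast
    then obtain c z where "c \<in> A" "z \<in> fst c" "q = f (snd c z)" by (metis pointsE)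
    then show "q \<in> points B" using local_coordinates_points[OF lc[of c], of z] by simp
  qed
  have "open {z \<in> fst d. snd d z \<in> U}" if "d \<in> B" for d
  proof -
    have "open (overlap d (fst c, f \<circ> snd c))" if "c \<in> A" for c
      using local_coordinates_holomorphic_transition[OF local_coordinates_member[OF B \<open>d \<in> B\<close>]
          lc[OF that]] by (simp add: holomorphic_transition_def)
    then have "open (\<Union>c\<in>A. overlap d (fst c, f \<circ> snd c))" by blast
    also have "(\<Union>c\<in>A. overlap d (fst c, f \<circ> snd c)) = {z \<in> fst d. snd d z \<in> U}"
      unfolding U_def points_def overlap_def by (auto simp: image_iff) force+
    finally show ?thesis .
  qed
  with sub have U: "mopen B U" by (simp add: mopen_iff)
  have "local_coordinates (restrict_atlas B U) (fst c, f \<circ> snd c)" if "c \<in> A" for c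
  proof -
    have "restrict_chart U (fst c, f \<circ> snd c) = (fst c, f \<circ> snd c)"
      using local_coordinates_points[OF local_coordinates_member[OF A that]]
      by (intro restrict_chart_id) (auto simp: U_def)
    then show ?thesis using local_coordinates_restrict[OF B U lc[OF that]] by simp
  qed
  moreover have "points (restrict_atlas B U) = U" using sub by (auto simp: points_restrict_atlas)
  ultimately have "biholomorphic A (restrict_atlas B U) f"
    using inj by (intro biholomorphicI[OF A compatible_atlas_restrict[OF B U]])
      (auto simp: bij_betw_def U_def)
  then show ?thesis using U by (simp add: open_embedding_def U_def)
qed

section \<open>Blowing up a point\<close>

lemma scaleC_one [simp]: "scaleC 1 v = (v :: 'm::complex_space)"
  using scaleC_of_real[of 1 v] by simp

lemma line_eqE:
  assumes "line v = line w" obtains c where "v = scaleC c w"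
proof -
  have "scaleC 1 v \<in> line v" unfolding line_def by (rule rangeI)
  then have "scaleC 1 v \<in> range (\<lambda>c. scaleC c w)" unfolding assms by (simp only: line_def)
  then obtain c where "scaleC 1 v = scaleC c w" by (rule rangeE)
  then show ?thesis by (intro that[of c]) simp
qed

lemma line_1_eq_iff [simp]:
  fixes v v' :: "'m::complex_space" shows "line (1::complex, v) = line (1, v') \<longleftrightarrow> v = v'"
proof
  assume "line (1::complex, v) = line (1, v')"
  then obtain c where "(1::complex, v) = scaleC c (1, v')" by (rule line_eqE)
  then show "v = v'" by simp
qed simp

lemma line_scale:
  assumes "c \<noteq> 0" shows "line (scaleC c v) = line v"
proof
  show "line (scaleC c v) \<subseteq> line v" unfolding line_def by (auto simp: scaleC_scaleC)
  show "line v \<subseteq> line (scaleC c v)"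
    unfolding line_def
  proof
    fix w assume "w \<in> range (\<lambda>d. scaleC d v)"
    then obtain d where "w = scaleC d v" by (rule rangeE)
    then have "w = scaleC (d / c) (scaleC c v)" using assms by (simp add: scaleC_scaleC)
    then show "w \<in> range (\<lambda>d. scaleC d (scaleC c v))" by (rule range_eqI)
  qed
qed

lemma line2_eq_iff:
  fixes a b c d :: complex
  assumes "(a, b) \<noteq> (0, 0)" "(c, d) \<noteq> (0, 0)"
  shows "line (a, b) = line (c, d) \<longleftrightarrow> a * d = b * c"
proof
  assume "line (a, b) = line (c, d)"
  then obtain k where "(a, b) = scaleC k (c, d)" by (rule line_eqE)
  then have "a = k * c" "b = k * d" by auto
  then show "a * d = b * c" by simp
next
  assume eq: "a * d = b * c"
  consider "c \<noteq> 0" | "c = 0" "d \<noteq> 0" using assms(2) by auto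
  then obtain k where "k \<noteq> 0" "(a, b) = scaleC k (c, d)"
  proof cases
    case 1
    with eq assms have "a \<noteq> 0" by auto
    with 1 eq show ?thesis by (intro that[of "a / c"]) (auto simp: field_simps)
  next
    case 2
    with eq assms have "a = 0" "b \<noteq> 0" by auto
    with 2 show ?thesis by (intro that[of "b / d"]) auto
  qed
  then show "line (a, b) = line (c, d)" by (metis line_scale)
qed

text \<open>The two charts of a blow-up as operations on charts, so that successive blow-ups become
  nested terms. The exceptional curve is u = 0 in \<open>bl1\<close> and v = 0 in
  \<open>bl2\<close>.\<close>

definition bl1 :: "(c2, ipoint) chart \<Rightarrow> (c2, ipoint) chart"
  where "bl1 c = ({(u, v). (u, u * v) \<in> fst c},
    \<lambda>(u, v). if u = 0 then Exc (snd c (0, 0)) (line (1, v)) else snd c (u, u * v))"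

definition bl2 :: "(c2, ipoint) chart \<Rightarrow> (c2, ipoint) chart"
  where "bl2 c = ({(u, v). (u * v, v) \<in> fst c},
    \<lambda>(u, v). if v = 0 then Exc (snd c (0, 0)) (line (u, 1)) else snd c (u * v, v))"

lemma blow_up_eq:
  "blow_up A c = restrict_atlas A (points A - {snd c (0, 0)}) \<union> {bl1 c, bl2 c}"
  unfolding blow_up_def bl1_def bl2_def by (cases c) (simp only: prod.case fst_conv snd_conv)

text \<open>No point of an iterated blow-up is infinitely near to another one; this is what makes the
  points of a new exceptional curve different from all old points.\<close>

fun ancestors :: "ipoint \<Rightarrow> ipoint set"
  where "ancestors (Plane l) = {}" | "ancestors (Exc p l) = insert p (ancestors p)"

text \<open>The invariant that is preserved by every blow-up. Finiteness of the atlas gives second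
  countability; the clause on ancestors keeps the points of the next exceptional curve new.\<close>

definition surface :: "(c2, ipoint) atlas \<Rightarrow> bool"
  where "surface A \<longleftrightarrow> compatible_atlas A \<and> finite A \<and> complex_manifold A \<and>
    (\<forall>p\<in>points A. \<forall>q\<in>points A. p \<notin> ancestors q)"


text \<open>The clause \<open>e (m z) = e z\<close> says that the equation of the exceptional curve
  is a coordinate which the blow-down leaves unchanged. Hence \<open>m z\<close> avoids the centre
  as soon as \<open>e z\<close> is nonzero.\<close>

definition blow_up_coordinates ::
    "(c2 \<Rightarrow> complex) \<Rightarrow> (c2 \<Rightarrow> c2) \<Rightarrow> (c2 \<Rightarrow> c2) \<Rightarrow> (c2 \<Rightarrow> c2 set) \<Rightarrow> bool"
  where "blow_up_coordinates e m k l \<longleftrightarrow>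
    e (0, 0) = 0 \<and> (\<forall>z. cdifferentiable_at e z \<and> cdifferentiable_at m z \<and> e (m z) = e z) \<and>
    (\<forall>z. e z = 0 \<longrightarrow> m z = (0, 0)) \<and>
    (\<forall>z. e z \<noteq> 0 \<longrightarrow> cdifferentiable_at k z \<and> k (m z) = z \<and> m (k z) = z) \<and>
    (\<forall>z z'. e z = 0 \<longrightarrow> e z' = 0 \<longrightarrow> l z = l z' \<longrightarrow> z = z')"

text \<open>Both charts of a blow-up have this form, with exceptional curve \<open>e = 0\<close>, blow-down \<open>m\<close>,
  its inverse \<open>k\<close> outside the exceptional curve, and tangent direction \<open>l\<close>.\<close>

definition blow_up_chart ::
    "(c2 \<Rightarrow> complex) \<Rightarrow> (c2 \<Rightarrow> c2) \<Rightarrow> (c2 \<Rightarrow> c2 set) \<Rightarrow> (c2, ipoint) chart \<Rightarrow> (c2, ipoint) chart"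
  where "blow_up_chart e m l c = (m -` fst c,
    \<lambda>z. if e z = 0 then Exc (snd c (0, 0)) (l z) else snd c (m z))"

lemma bl1_eq: "bl1 c = blow_up_chart fst (\<lambda>z. (fst z, fst z * snd z)) (\<lambda>z. line (1, snd z)) c"
  by (auto simp: bl1_def blow_up_chart_def fun_eq_iff)

lemma bl2_eq: "bl2 c = blow_up_chart snd (\<lambda>z. (fst z * snd z, snd z)) (\<lambda>z. line (fst z, 1)) c"
  by (auto simp: bl2_def blow_up_chart_def fun_eq_iff)

lemma blow_up_coordinates_1: "blow_up_coordinates fst (\<lambda>z. (fst z, fst z * snd z))
    (\<lambda>z. (fst z, snd z / fst z)) (\<lambda>z. line (1, snd z))"
  by (auto simp: blow_up_coordinates_def prod_eq_iff intro!: cdiff_intros)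

lemma blow_up_coordinates_2: "blow_up_coordinates snd (\<lambda>z. (fst z * snd z, snd z))
    (\<lambda>z. (fst z / snd z, snd z)) (\<lambda>z. line (fst z, 1))"
  by (auto simp: blow_up_coordinates_def prod_eq_iff line2_eq_iff intro!: cdiff_intros)

lemma holomorphic_transition_self:
  assumes "open (fst c)" "inj_on (snd c) (fst c)" shows "holomorphic_transition c c"
proof (rule holomorphic_transitionI[OF assms(2)])
  fix z assume "z \<in> fst c"
  with assms(1) have "\<forall>\<^sub>F x in nhds z. x \<in> fst c" by (rule eventually_nhds_in_open)
  then show "\<exists>f. cdifferentiable_at f z \<and> lifts f c c z"
    by (intro exI[of _ "\<lambda>x. x"]) (auto intro: cdiff_ident)
qed

locale blow_up_point =
  fixes A :: "(c2, ipoint) atlas" and c :: "(c2, ipoint) chart"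
  assumes S: "surface A" and c: "local_coordinates A c" and origin: "(0, 0) \<in> fst c"
begin

abbreviation p :: ipoint where "p \<equiv> snd c (0, 0)"
abbreviation U :: "ipoint set" where "U \<equiv> points A - {p}"

lemma A: "compatible_atlas A" "finite A" "Hausdorff_space (mtop A)"
  using S by (auto simp: surface_def complex_manifold_def)

lemma p_in: "p \<in> points A" by (rule local_coordinates_points[OF c origin])

lemma fresh: "Exc p l \<notin> points A"
proof
  assume "Exc p l \<in> points A"
  then have "p \<notin> ancestors (Exc p l)" using S p_in unfolding surface_def by blast
  then show False by simp
qed

lemma mopen_U: "mopen A U"
proof -
  have "closedin (mtop A) {p}"
    using A(3) p_in by (auto intro: closedin_Hausdorff_singleton simp: topspace_mtop[OF A(1)])
  then have "openin (mtop A) (topspace (mtop A) - {p})" by (rule openin_diff[OF openin_topspace])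
  then show ?thesis by (simp add: topspace_mtop[OF A(1)] openin_mtop)
qed

lemma c_open: "open (fst c)" and c_inj: "inj_on (snd c) (fst c)"
  using local_coordinates_open[OF c] local_coordinates_inj[OF c] by auto

lemma c_eq_p: "z \<in> fst c \<Longrightarrow> snd c z = p \<longleftrightarrow> z = (0, 0)"
  using inj_onD[OF c_inj, of z "(0, 0)"] origin by auto

lemma blow_up_chart_open:
  assumes "blow_up_coordinates e m k l" shows "open (fst (blow_up_chart e m l c))"
proof -
  have "continuous_on UNIV m"
    using assms by (auto simp: continuous_on_eq_continuous_at blow_up_coordinates_def
        intro: cdiff_isCont)
  then show ?thesis using c_open by (simp add: blow_up_chart_def open_vimage)
qed

lemma blow_up_chart_in_U:
  assumes "blow_up_coordinates e m k l" "z \<in> fst (blow_up_chart e m l c)" "e z \<noteq> 0"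
  shows "snd c (m z) \<in> U"
proof -
  have "m z \<in> fst c" using assms(2) by (simp add: blow_up_chart_def)
  moreover have "e (m z) \<noteq> 0" "e (0, 0) = 0" using assms(1,3) by (simp_all add: blow_up_coordinates_def)
  then have "m z \<noteq> (0, 0)" by metis
  ultimately show ?thesis using c_eq_p[of "m z"] local_coordinates_points[OF c, of "m z"] by simp
qed

lemma blow_up_chart_inj:
  assumes b: "blow_up_coordinates e m k l"
  shows "inj_on (snd (blow_up_chart e m l c)) (fst (blow_up_chart e m l c))"
proof (rule inj_onI)
  fix z w assume zw: "z \<in> fst (blow_up_chart e m l c)" "w \<in> fst (blow_up_chart e m l c)"
    and eq: "snd (blow_up_chart e m l c) z = snd (blow_up_chart e m l c) w"
  have in_c: "m z \<in> fst c" "m w \<in> fst c" using zw by (auto simp: blow_up_chart_def)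
  consider "e z = 0" "e w = 0" | "e z = 0" "e w \<noteq> 0" | "e z \<noteq> 0" "e w = 0" | "e z \<noteq> 0" "e w \<noteq> 0"
    by blast
  then show "z = w"
  proof cases
    case 1
    then show ?thesis using eq b by (simp add: blow_up_chart_def blow_up_coordinates_def)
  next
    case 2
    then show ?thesis
      using eq blow_up_chart_in_U[OF b zw(2)] fresh[of "l z"] by (auto simp: blow_up_chart_def)
  next
    case 3
    then show ?thesis
      using eq[symmetric] blow_up_chart_in_U[OF b zw(1)] fresh[of "l w"] by (auto simp: blow_up_chart_def)
  next
    case 4
    then have "m z = m w" using eq in_c by (intro inj_onD[OF c_inj]) (auto simp: blow_up_chart_def)
    then have "k (m z) = k (m w)" by simp
    then show ?thesis using b 4 by (simp add: blow_up_coordinates_def)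
  qed
qed

text \<open>The lift is \<open>k\<close> after the coordinate change \<open>f\<close> into
  \<open>c\<close>. It is holomorphic because a point that survives from the old surface has
  \<open>e\<close> nonzero, and this persists nearby.\<close>

lemma restrict_to_blow_up_chart:
  assumes b: "blow_up_coordinates e m k l" and d: "local_coordinates A d"
  shows "holomorphic_transition (restrict_chart U d) (blow_up_chart e m l c)"
proof (rule holomorphic_transitionI[OF blow_up_chart_inj[OF b]])
  fix z w assume zw: "z \<in> fst (restrict_chart U d)" "w \<in> fst (blow_up_chart e m l c)"
    "snd (restrict_chart U d) z = snd (blow_up_chart e m l c) w"
  have z: "z \<in> fst d" "snd d z \<in> U" using zw(1) by (auto simp: restrict_chart_def)
  have ew: "e w \<noteq> 0"
    using zw(3) z(2) fresh[of "l w"] by (auto simp: restrict_chart_def blow_up_chart_def)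
  then have mw: "m w \<in> fst c" "snd d z = snd c (m w)"
    using zw by (auto simp: restrict_chart_def blow_up_chart_def)
  obtain f where f: "cdifferentiable_at f z" "f z = m w"
    "lifts f d c z"
    by (rule holomorphic_transitionE[OF local_coordinates_holomorphic_transition[OF d c] c_inj z(1) mw])
  have emw: "e (m w) \<noteq> 0" using ew b by (simp add: blow_up_coordinates_def)
  have "cdifferentiable_at e (m w)" using b by (simp add: blow_up_coordinates_def)
  then have "\<forall>\<^sub>F x in nhds (m w). e x \<noteq> 0"
    using emw by (rule cdiff_eventually_neq)
  then have "\<forall>\<^sub>F x in nhds z. e (f x) \<noteq> 0"
    by (intro cdiff_eventually[OF f(1)]) (simp only: f(2))
  moreover have "\<forall>\<^sub>F x in nhds z. x \<in> fst (restrict_chart U d)"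
    using zw(1) mopen_preimage[OF d mopen_U] by (intro eventually_nhds_in_open) (auto simp: restrict_chart_def)
  ultimately have "\<forall>\<^sub>F x in nhds z. x \<in> fst (restrict_chart U d) \<and> k (f x) \<in> fst (blow_up_chart e m l c) \<and>
      snd (blow_up_chart e m l c) (k (f x)) = snd (restrict_chart U d) x"
    using f(3)
  proof eventually_elim
    case (elim x)
    then have "e (f x) \<noteq> 0" by simp
    with b have 1: "m (k (f x)) = f x" by (simp add: blow_up_coordinates_def)
    have "e (m (k (f x))) = e (k (f x))" using b by (simp add: blow_up_coordinates_def)
    then have "e (k (f x)) \<noteq> 0" using \<open>e (f x) \<noteq> 0\<close> by (simp add: 1)
    then show ?case using elim 1 by (simp add: blow_up_chart_def restrict_chart_def)
  qed
  moreover have "cdifferentiable_at (\<lambda>x. k (f x)) z"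
    using b emw f(2) by (intro cdiff_compose[OF f(1)]) (simp add: blow_up_coordinates_def)
  ultimately show "\<exists>f. cdifferentiable_at f z \<and> lifts f (restrict_chart U d) (blow_up_chart e m l c) z"
    by (intro exI[of _ "\<lambda>x. k (f x)"] conjI)
qed

lemma blow_up_chart_to_restrict:
  assumes b: "blow_up_coordinates e m k l" and d: "local_coordinates A d"
  shows "holomorphic_transition (blow_up_chart e m l c) (restrict_chart U d)"
proof (rule holomorphic_transitionI)
  show "inj_on (snd (restrict_chart U d)) (fst (restrict_chart U d))"
    using local_coordinates_inj[OF d] by (auto simp: restrict_chart_def inj_on_def)
  fix w z assume zw: "z \<in> fst (restrict_chart U d)" "w \<in> fst (blow_up_chart e m l c)"
    "snd (blow_up_chart e m l c) w = snd (restrict_chart U d) z"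
  have z: "z \<in> fst d" "snd d z \<in> U" using zw(1) by (auto simp: restrict_chart_def)
  have ew: "e w \<noteq> 0"
    using zw(3)[symmetric] z(2) fresh[of "l w"] by (auto simp: restrict_chart_def blow_up_chart_def)
  then have mw: "m w \<in> fst c" "snd c (m w) = snd d z"
    using zw by (auto simp: restrict_chart_def blow_up_chart_def)
  obtain f where f: "cdifferentiable_at f (m w)"
    "lifts f c d (m w)"
    by (rule holomorphic_transitionE[OF local_coordinates_holomorphic_transition[OF c d]
          local_coordinates_inj[OF d] mw(1) z(1) mw(2)])
  have m: "cdifferentiable_at m w" and e: "cdifferentiable_at e w"
    using b by (simp_all add: blow_up_coordinates_def)
  have "\<forall>\<^sub>F x in nhds w. e x \<noteq> 0"
    using e ew by (rule cdiff_eventually_neq)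
  moreover have "\<forall>\<^sub>F x in nhds w. x \<in> fst (blow_up_chart e m l c)"
    using zw(2) blow_up_chart_open[OF b] by (intro eventually_nhds_in_open)
  moreover have "\<forall>\<^sub>F x in nhds w. m x \<in> fst c \<and> f (m x) \<in> fst d \<and> snd d (f (m x)) = snd c (m x)"
    by (rule cdiff_eventually[OF m f(2)])
  ultimately have "\<forall>\<^sub>F x in nhds w. x \<in> fst (blow_up_chart e m l c) \<and> f (m x) \<in> fst (restrict_chart U d) \<and>
      snd (restrict_chart U d) (f (m x)) = snd (blow_up_chart e m l c) x"
  proof eventually_elim
    case (elim x)
    then show ?case using blow_up_chart_in_U[OF b, of x] by (simp add: blow_up_chart_def restrict_chart_def)
  qed
  moreover have "cdifferentiable_at (\<lambda>x. f (m x)) w" by (rule cdiff_compose[OF m f(1)])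
  ultimately show "\<exists>f. cdifferentiable_at f w \<and> lifts f (blow_up_chart e m l c) (restrict_chart U d) w"
    by (intro exI[of _ "\<lambda>x. f (m x)"] conjI)
qed

text \<open>Separation is pulled back along the blow-down \<open>m\<close>. This covers the
  exceptional curve too: a point of it lies over the centre \<open>p\<close>, which differs from
  \<open>snd d z\<close> in \<open>U\<close>.\<close>

lemma restrict_separated_blow_up_chart:
  assumes b: "blow_up_coordinates e m k l" and d: "local_coordinates A d"
  shows "separated (restrict_chart U d) (blow_up_chart e m l c)"
proof (rule separatedI)
  fix z w assume zw: "z \<in> fst (restrict_chart U d)" "w \<in> fst (blow_up_chart e m l c)"
    "snd (restrict_chart U d) z \<noteq> snd (blow_up_chart e m l c) w"
  have z: "z \<in> fst d" "snd d z \<in> U" using zw(1) by (auto simp: restrict_chart_def)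
  have mw: "m w \<in> fst c" using zw(2) by (auto simp: blow_up_chart_def)
  have "snd d z \<noteq> snd c (m w)"
  proof (cases "e w = 0")
    case True
    then have "m w = (0, 0)" using b by (simp add: blow_up_coordinates_def)
    then show ?thesis using z(2) by simp
  next
    case False
    then show ?thesis using zw(3) by (simp add: blow_up_chart_def restrict_chart_def)
  qed
  then have "\<forall>\<^sub>F q in nhds (z, m w). fst q \<in> fst d \<longrightarrow> snd q \<in> fst c \<longrightarrow> snd d (fst q) \<noteq> snd c (snd q)"
    by (intro separatedD[OF separated_local_coordinates[OF A(1,3) d c]] z mw)
  moreover have m: "cdifferentiable_at m x" for x using b by (simp add: blow_up_coordinates_def)
  have "cdifferentiable_at (\<lambda>q. (fst q, m (snd q))) (z, w)"
    by (intro cdiff_Pair cdiff_fst cdiff_ident cdiff_compose[OF cdiff_snd[OF cdiff_ident]] m)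
  ultimately have "\<forall>\<^sub>F q in nhds (z, w). fst q \<in> fst d \<longrightarrow> m (snd q) \<in> fst c \<longrightarrow> snd d (fst q) \<noteq> snd c (m (snd q))"
    using cdiff_eventually[of "\<lambda>q. (fst q, m (snd q))" "(z, w)"
        "\<lambda>q. fst q \<in> fst d \<longrightarrow> snd q \<in> fst c \<longrightarrow> snd d (fst q) \<noteq> snd c (snd q)"] by simp
  then show "apart (restrict_chart U d) (blow_up_chart e m l c) z w"
  proof eventually_elim
    case (elim q)
    then show ?case using fresh[of "l (snd q)"]
      by (auto simp: restrict_chart_def blow_up_chart_def)
  qed
qed

lemma bl1_apply: "snd (bl1 c) (u, v) = (if u = 0 then Exc p (line (1, v)) else snd c (u, u * v))"
  and bl2_apply: "snd (bl2 c) (u, v) = (if v = 0 then Exc p (line (u, 1)) else snd c (u * v, v))"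
  and bl1_dom: "(u, v) \<in> fst (bl1 c) \<longleftrightarrow> (u, u * v) \<in> fst c"
  and bl2_dom: "(u, v) \<in> fst (bl2 c) \<longleftrightarrow> (u * v, v) \<in> fst c"
  by (simp_all add: bl1_def bl2_def)

lemma bl1_open: "open (fst (bl1 c))" and bl2_open: "open (fst (bl2 c))"
  and bl1_inj: "inj_on (snd (bl1 c)) (fst (bl1 c))" and bl2_inj: "inj_on (snd (bl2 c)) (fst (bl2 c))"
  unfolding bl1_eq bl2_eq
  by (rule blow_up_chart_open[OF blow_up_coordinates_1] blow_up_chart_open[OF blow_up_coordinates_2]
      blow_up_chart_inj[OF blow_up_coordinates_1] blow_up_chart_inj[OF blow_up_coordinates_2])+

text \<open>The coordinate change is (u, v) |-> (1/v, u v), on the exceptional curve as well as off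
  it. In the polynomial form stated here it serves both for the transitions and for the separation
  of the two charts.\<close>

lemma bl1_eq_bl2:
  assumes "(u, v) \<in> fst (bl1 c)" "(u', v') \<in> fst (bl2 c)"
  shows "snd (bl1 c) (u, v) = snd (bl2 c) (u', v') \<longleftrightarrow> v * u' = 1 \<and> v' = u * v"
proof
  assume eq: "snd (bl1 c) (u, v) = snd (bl2 c) (u', v')"
  have 1: "u \<noteq> 0 \<Longrightarrow> snd c (u, u * v) \<in> U" "v' \<noteq> 0 \<Longrightarrow> snd c (u' * v', v') \<in> U"
    using blow_up_chart_in_U[OF blow_up_coordinates_1, of "(u, v)"] assms(1)
      blow_up_chart_in_U[OF blow_up_coordinates_2, of "(u', v')"] assms(2)
    by (auto simp: bl1_eq bl2_eq)
  show "v * u' = 1 \<and> v' = u * v"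
  proof (cases "u = 0")
    case True
    then have "v' = 0" using eq 1(2) fresh[of "line (1, v)"] by (auto simp: bl1_apply bl2_apply split: if_splits)
    with True eq show ?thesis by (simp add: bl1_apply bl2_apply line2_eq_iff mult.commute)
  next
    case False
    then have "v' \<noteq> 0" using eq 1(1) fresh[of "line (u', 1)"] by (auto simp: bl1_apply bl2_apply split: if_splits)
    with False eq have "(u, u * v) = (u' * v', v')"
      using assms by (intro inj_onD[OF c_inj]) (auto simp: bl1_apply bl2_apply bl1_dom bl2_dom)
    with False show ?thesis by (auto simp: mult.commute)
  qed
next
  assume "v * u' = 1 \<and> v' = u * v"
  then have e: "v \<noteq> 0" "u' = 1 / v" "v' = u * v" by (auto simp: eq_divide_eq mult.commute)
  then show "snd (bl1 c) (u, v) = snd (bl2 c) (u', v')"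
    by (auto simp: bl1_apply bl2_apply line2_eq_iff)
qed

lemma bl1_to_bl2: "holomorphic_transition (bl1 c) (bl2 c)"
proof (rule holomorphic_transition_explicit[OF bl2_inj bl1_open, where e = snd])
  fix z w assume "z \<in> fst (bl1 c)" "w \<in> fst (bl2 c)" "snd (bl1 c) z = snd (bl2 c) w"
  then show "snd z \<noteq> 0" using bl1_eq_bl2[of "fst z" "snd z" "fst w" "snd w"] by auto
next
  fix z assume z: "z \<in> fst (bl1 c)" "snd z \<noteq> 0"
  then have d: "(1 / snd z, fst z * snd z) \<in> fst (bl2 c)"
    using bl1_dom[of "fst z" "snd z"] by (simp add: bl2_dom)
  have "cdifferentiable_at (\<lambda>z. (1 / snd z, fst z * snd z)) z" using z(2) by (intro cdiff_intros)
  then show "cdifferentiable_at (\<lambda>z. (1 / snd z, fst z * snd z)) z \<and>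
      (1 / snd z, fst z * snd z) \<in> fst (bl2 c) \<and> snd (bl2 c) (1 / snd z, fst z * snd z) = snd (bl1 c) z"
    using z d bl1_eq_bl2[OF _ d, of "fst z" "snd z"] by simp
qed (intro cdiff_intros)

lemma bl2_to_bl1: "holomorphic_transition (bl2 c) (bl1 c)"
proof (rule holomorphic_transition_explicit[OF bl1_inj bl2_open, where e = fst])
  fix z w assume "z \<in> fst (bl2 c)" "w \<in> fst (bl1 c)" "snd (bl2 c) z = snd (bl1 c) w"
  then show "fst z \<noteq> 0" using bl1_eq_bl2[of "fst w" "snd w" "fst z" "snd z"] by auto
next
  fix z assume z: "z \<in> fst (bl2 c)" "fst z \<noteq> 0"
  then have d: "(fst z * snd z, 1 / fst z) \<in> fst (bl1 c)"
    using bl2_dom[of "fst z" "snd z"] by (simp add: bl1_dom)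
  have "cdifferentiable_at (\<lambda>z. (fst z * snd z, 1 / fst z)) z" using z(2) by (intro cdiff_intros)
  then show "cdifferentiable_at (\<lambda>z. (fst z * snd z, 1 / fst z)) z \<and>
      (fst z * snd z, 1 / fst z) \<in> fst (bl1 c) \<and> snd (bl1 c) (fst z * snd z, 1 / fst z) = snd (bl2 c) z"
    using z d bl1_eq_bl2[OF d, of "fst z" "snd z"] by simp
qed (intro cdiff_intros)

lemma bl1_separated_bl2: "separated (bl1 c) (bl2 c)"
proof (rule separated_explicit[where a = "(1, 0)"])
  fix z w assume "z \<in> fst (bl1 c)" "w \<in> fst (bl2 c)"
  then show "snd (bl1 c) z = snd (bl2 c) w \<longleftrightarrow>
      (\<lambda>q. (snd (fst q) * fst (snd q), snd (snd q) - fst (fst q) * snd (fst q))) (z, w) = (1, 0)"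
    using bl1_eq_bl2[of "fst z" "snd z" "fst w" "snd w"] by simp
qed (intro cdiff_intros)

lemma bl_compatible:
  assumes "d \<in> {bl1 c, bl2 c}" "e \<in> {bl1 c, bl2 c}" shows "compatible d e"
  unfolding compatible_iff
  using assms bl1_open bl2_open bl1_inj bl2_inj bl1_to_bl2 bl2_to_bl1
    holomorphic_transition_self[OF bl1_open bl1_inj] holomorphic_transition_self[OF bl2_open bl2_inj]
  by auto

lemma restrict_bl_compatible:
  assumes d: "local_coordinates A d" and e: "e \<in> {bl1 c, bl2 c}"
  shows "compatible (restrict_chart U d) e"
proof -
  have "open (fst (restrict_chart U d))"
    using mopen_preimage[OF d mopen_U] by (simp add: restrict_chart_def)
  moreover have "inj_on (snd (restrict_chart U d)) (fst (restrict_chart U d))"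
    using local_coordinates_inj[OF d] by (auto simp: restrict_chart_def inj_on_def)
  ultimately show ?thesis
    using e bl1_open bl2_open bl1_inj bl2_inj
      restrict_to_blow_up_chart[OF blow_up_coordinates_1 d]
      restrict_to_blow_up_chart[OF blow_up_coordinates_2 d]
      blow_up_chart_to_restrict[OF blow_up_coordinates_1 d]
      blow_up_chart_to_restrict[OF blow_up_coordinates_2 d]
    by (auto simp: compatible_iff bl1_eq bl2_eq)
qed

lemma compatible_atlas_blow_up: "compatible_atlas (blow_up A c)"
  unfolding compatible_atlas_def
proof (intro ballI)
  have R: "compatible_atlas (restrict_atlas A U)" by (rule compatible_atlas_restrict[OF A(1) mopen_U])
  fix d e assume "d \<in> blow_up A c" "e \<in> blow_up A c"
  then consider "d \<in> restrict_atlas A U" "e \<in> restrict_atlas A U"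
    | "d \<in> restrict_atlas A U" "e \<in> {bl1 c, bl2 c}"
    | "d \<in> {bl1 c, bl2 c}" "e \<in> restrict_atlas A U"
    | "d \<in> {bl1 c, bl2 c}" "e \<in> {bl1 c, bl2 c}"
    unfolding blow_up_eq by blast
  then show "compatible d e"
  proof cases
    case 1 then show ?thesis using R by (simp add: compatible_atlas_def)
  next
    case 2
    then obtain d' where "d' \<in> A" "d = restrict_chart U d'" unfolding restrict_atlas_eq by blast
    with 2 show ?thesis using restrict_bl_compatible[OF local_coordinates_member[OF A(1)]] by simp
  next
    case 3
    then obtain d' where "d' \<in> A" "e = restrict_chart U d'" unfolding restrict_atlas_eq by blast
    with 3 show ?thesis
      using compatible_sym[OF restrict_bl_compatible[OF local_coordinates_member[OF A(1)]]] by simp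
  next
    case 4 then show ?thesis by (rule bl_compatible)
  qed
qed

lemma local_coordinates_bl1: "local_coordinates (blow_up A c) (bl1 c)"
  and local_coordinates_bl2: "local_coordinates (blow_up A c) (bl2 c)"
  by (rule local_coordinates_member[OF compatible_atlas_blow_up]; simp add: blow_up_eq)+

lemma points_blow_up:
  "points (blow_up A c) = U \<union> range (\<lambda>v. Exc p (line (1, v))) \<union> {Exc p (line (0, 1))}"
proof (intro subset_antisym subsetI)
  fix q assume "q \<in> points (blow_up A c)"
  then have "q \<in> points (restrict_atlas A U) \<or> q \<in> snd (bl1 c) ` fst (bl1 c) \<or> q \<in> snd (bl2 c) ` fst (bl2 c)"
    unfolding blow_up_eq points_iff by blast
  then consider "q \<in> U" | u v where "(u, v) \<in> fst (bl1 c)" "q = snd (bl1 c) (u, v)"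
    | u v where "(u, v) \<in> fst (bl2 c)" "q = snd (bl2 c) (u, v)"
    by (force simp: points_restrict_atlas)
  then show "q \<in> U \<union> range (\<lambda>v. Exc p (line (1, v))) \<union> {Exc p (line (0, 1))}"
  proof cases
    case 2
    then show ?thesis
      using blow_up_chart_in_U[OF blow_up_coordinates_1, of "(u, v)"]
      by (cases "u = 0") (auto simp: bl1_apply bl1_eq[symmetric])
  next
    case 3
    show ?thesis
    proof (cases "v = 0")
      case True
      have "line (u, 1) = line (1, 1 / u)" if "u \<noteq> 0" using that by (simp add: line2_eq_iff)
      then show ?thesis using 3 True by (cases "u = 0") (auto simp: bl2_apply)
    next
      case False
      then show ?thesis using 3 blow_up_chart_in_U[OF blow_up_coordinates_2, of "(u, v)"]
        by (auto simp: bl2_apply bl2_eq[symmetric])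
    qed
  qed simp
next
  fix q assume "q \<in> U \<union> range (\<lambda>v. Exc p (line (1, v))) \<union> {Exc p (line (0, 1))}"
  then consider "q \<in> U" | v where "q = snd (bl1 c) (0, v)" | "q = snd (bl2 c) (0, 0)"
    by (auto simp: bl1_apply bl2_apply)
  then show "q \<in> points (blow_up A c)"
  proof cases
    case 1
    then have "q \<in> points (restrict_atlas A U)" by (simp add: points_restrict_atlas)
    then show ?thesis unfolding blow_up_eq points_iff by blast
  next
    case 2
    then show ?thesis
      using local_coordinates_points[OF local_coordinates_bl1, of "(0, v)"] origin by (simp add: bl1_dom)
  next
    case 3
    then show ?thesis
      using local_coordinates_points[OF local_coordinates_bl2, of "(0, 0)"] origin by (simp add: bl2_dom)
  qed
qed

lemma local_coordinates_keep:
  assumes d: "local_coordinates A d"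
  shows "local_coordinates (blow_up A c) (restrict_chart U d)"
proof -
  have l: "local_coordinates (restrict_atlas A U) (restrict_chart U d)"
    by (rule local_coordinates_restrict[OF A(1) mopen_U d])
  have "snd (restrict_chart U d) ` fst (restrict_chart U d) \<subseteq> points (blow_up A c)"
    unfolding points_blow_up by (auto simp: restrict_chart_def)
  moreover have "compatible (restrict_chart U d) e" if "e \<in> blow_up A c" for e
  proof -
    from that consider "e \<in> restrict_atlas A U" | "e \<in> {bl1 c, bl2 c}" unfolding blow_up_eq by blast
    then show ?thesis
      by cases (use l restrict_bl_compatible[OF d] in \<open>auto simp: local_coordinates_iff\<close>)
  qed
  ultimately show ?thesis by (simp add: local_coordinates_iff)
qed

text \<open>Charts that miss the centre survive unchanged, so charts found at an early stage can
  still be used on the last surface.\<close>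

lemma local_coordinates_unaffected:
  assumes "local_coordinates A d" "p \<notin> snd d ` fst d"
  shows "local_coordinates (blow_up A c) d"
proof -
  have "restrict_chart U d = d"
  proof (rule restrict_chart_id)
    fix z assume "z \<in> fst d"
    then have "snd d z \<in> points A" "snd d z \<in> snd d ` fst d"
      by (rule local_coordinates_points[OF assms(1)], rule imageI)
    then show "snd d z \<in> U" using assms(2) by (metis DiffI singletonD)
  qed
  then show ?thesis using local_coordinates_keep[OF assms(1)] by simp
qed

lemma surface_blow_up: "surface (blow_up A c)"
proof -
  have "finite (blow_up A c)" using A(2) by (simp add: blow_up_eq restrict_atlas_eq)
  moreover have "separated d e" if "d \<in> blow_up A c" "e \<in> blow_up A c" for d e
  proof -
    have R: "separated (restrict_chart U d) f" "separated f (restrict_chart U d)"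
      if "d \<in> A" "f \<in> {bl1 c, bl2 c}" for d f
    proof -
      have d: "local_coordinates A d" by (rule local_coordinates_member[OF A(1) that(1)])
      show "separated (restrict_chart U d) f"
        using that(2) restrict_separated_blow_up_chart[OF blow_up_coordinates_1 d]
          restrict_separated_blow_up_chart[OF blow_up_coordinates_2 d]
        by (elim insertE emptyE) (simp_all only: bl1_eq bl2_eq)
      then show "separated f (restrict_chart U d)" by (rule separated_sym)
    qed
    have "separated (restrict_chart U d) (restrict_chart U e)" if "d \<in> A" "e \<in> A" for d e
    proof (rule separatedI)
      fix z w assume "z \<in> fst (restrict_chart U d)" "w \<in> fst (restrict_chart U e)"
        "snd (restrict_chart U d) z \<noteq> snd (restrict_chart U e) w"
      then have "apart d e z w"
        using that by (intro separatedD[OF separated_local_coordinates[OF A(1,3)]]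
            local_coordinates_member[OF A(1)]) (auto simp: restrict_chart_def)
      then show "apart (restrict_chart U d) (restrict_chart U e) z w"
        by eventually_elim (auto simp: restrict_chart_def)
    qed
    note RR = this
    have B: "separated d e" if "d \<in> {bl1 c, bl2 c}" "e \<in> {bl1 c, bl2 c}" for d e
      using that bl1_separated_bl2 separated_sym[OF bl1_separated_bl2] separated_self[OF bl1_inj]
        separated_self[OF bl2_inj] by (elim insertE emptyE) simp_all
    from that show ?thesis
      unfolding blow_up_eq restrict_atlas_eq
      by (elim UnE imageE) (simp_all only: R RR B)
  qed
  moreover have "q \<notin> ancestors r" if "q \<in> points (blow_up A c)" "r \<in> points (blow_up A c)" for q r
  proof -
    have old: "\<And>q r. q \<in> points A \<Longrightarrow> r \<in> points A \<Longrightarrow> q \<notin> ancestors r"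
      using S by (simp add: surface_def)
    \<comment> \<open>With this fact a new point that were an ancestor of an old point would make
      the old point \<open>p\<close> an ancestor of it as well.\<close>
    have anc: "r \<in> ancestors q" if "Exc r l \<in> ancestors q" for r l q
      using that by (induction q) auto
    from that obtain l l' where "q \<in> U \<or> q = Exc p l" "r \<in> U \<or> r = Exc p l'"
      unfolding points_blow_up by blast
    then show ?thesis
      using old p_in anc[of p l r] anc[of p l p] by auto
  qed
  ultimately show ?thesis
    unfolding surface_def using compatible_atlas_blow_up complex_manifoldI[OF compatible_atlas_blow_up]
    by simp
qed

end

lemma compatible_atlasI:
  assumes "\<And>c. c \<in> A \<Longrightarrow> open (fst c) \<and> inj_on (snd c) (fst c)"
    and "\<And>c d. c \<in> A \<Longrightarrow> d \<in> A \<Longrightarrow> c \<noteq> d \<Longrightarrow> holomorphic_transition c d"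
  shows "compatible_atlas A"
  unfolding compatible_atlas_def compatible_iff
  using assms holomorphic_transition_self by metis

section \<open>The projective line and plane\<close>

definition line_chart0 :: "(complex, c2 set) chart" where "line_chart0 = (UNIV, \<lambda>z. line (1, z))"
definition line_chart1 :: "(complex, c2 set) chart" where "line_chart1 = (UNIV, \<lambda>z. line (z, 1))"

lemma proj_line_eq: "proj_line = {line_chart0, line_chart1}"
  by (simp add: proj_line_def line_chart0_def line_chart1_def)

lemma compatible_atlas_proj_line: "compatible_atlas proj_line"
proof -
  have inj: "inj_on (snd line_chart0) (fst line_chart0)" "inj_on (snd line_chart1) (fst line_chart1)"
    by (auto simp: line_chart0_def line_chart1_def inj_on_def line2_eq_iff)
  have op: "open (fst line_chart0)" "open (fst line_chart1)"
    by (simp_all add: line_chart0_def line_chart1_def)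
  have "holomorphic_transition line_chart0 line_chart1"
    by (rule holomorphic_transition_explicit[OF inj(2) op(1), where e = "\<lambda>z. z" and f = "\<lambda>z. 1 / z"])
      (auto simp: line_chart0_def line_chart1_def line2_eq_iff intro!: cdiff_intros)
  moreover have "holomorphic_transition line_chart1 line_chart0"
    by (rule holomorphic_transition_explicit[OF inj(1) op(2), where e = "\<lambda>z. z" and f = "\<lambda>z. 1 / z"])
      (auto simp: line_chart0_def line_chart1_def line2_eq_iff intro!: cdiff_intros)
  ultimately show ?thesis
    unfolding proj_line_eq using inj op
    by (intro compatible_atlasI) (elim insertE emptyE; simp)+
qed

lemma points_proj_line: "points proj_line = insert (line (0, 1)) (range (\<lambda>z. line (1, z)))"
proof -
  have "line (z, 1) \<in> insert (line (0, 1 :: complex)) (range (\<lambda>z. line (1, z)))" for z :: complex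
  proof (cases "z = 0")
    case False
    then have "line (z, 1) = line (1, 1 / z)" by (simp add: line2_eq_iff)
    then show ?thesis by (intro insertI2 range_eqI)
  qed simp
  then show ?thesis
    unfolding proj_line_def points_def by auto
qed

lemma line3_12: "line (1, a, b) = line (c, 1, d) \<longleftrightarrow> a * c = 1 \<and> b * c = d" for a b c d :: complex
proof
  assume "line (1, a, b) = line (c, 1, d)"
  then obtain k where "(1, a, b) = scaleC k (c, 1, d)" by (rule line_eqE)
  then show "a * c = 1 \<and> b * c = d" by (auto simp: algebra_simps)
next
  assume "a * c = 1 \<and> b * c = d"
  then have "(c, 1, d) = scaleC c (1, a, b)" "c \<noteq> 0" by (auto simp: mult.commute)
  then show "line (1, a, b) = line (c, 1, d)" by (metis line_scale)
qed

lemma line3_13: "line (1, a, b) = line (c, d, 1) \<longleftrightarrow> b * c = 1 \<and> a * c = d" for a b c d :: complex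
proof
  assume "line (1, a, b) = line (c, d, 1)"
  then obtain k where "(1, a, b) = scaleC k (c, d, 1)" by (rule line_eqE)
  then show "b * c = 1 \<and> a * c = d" by (auto simp: algebra_simps)
next
  assume "b * c = 1 \<and> a * c = d"
  then have "(c, d, 1) = scaleC c (1, a, b)" "c \<noteq> 0" by (auto simp: mult.commute)
  then show "line (1, a, b) = line (c, d, 1)" by (metis line_scale)
qed

lemma line3_23: "line (a, 1, b) = line (c, d, 1) \<longleftrightarrow> b * d = 1 \<and> a * d = c" for a b c d :: complex
proof
  assume "line (a, 1, b) = line (c, d, 1)"
  then obtain k where "(a, 1, b) = scaleC k (c, d, 1)" by (rule line_eqE)
  then show "b * d = 1 \<and> a * d = c" by (auto simp: algebra_simps)
next
  assume "b * d = 1 \<and> a * d = c"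
  then have "(c, d, 1) = scaleC d (a, 1, b)" "d \<noteq> 0" by (auto simp: mult.commute)
  then show "line (a, 1, b) = line (c, d, 1)" by (metis line_scale)
qed

lemma line3_22 [simp]: "line (a, 1 :: complex, b) = line (c, 1, d) \<longleftrightarrow> a = c \<and> b = d" for a b c d :: complex
proof
  assume "line (a, 1 :: complex, b) = line (c, 1, d)"
  then obtain k where "(a, 1 :: complex, b) = scaleC k (c, 1, d)" by (rule line_eqE)
  then show "a = c \<and> b = d" by simp
qed simp

lemma line3_33 [simp]: "line (a, b, 1 :: complex) = line (c, d, 1) \<longleftrightarrow> a = c \<and> b = d" for a b c d :: complex
proof
  assume "line (a, b, 1 :: complex) = line (c, d, 1)"
  then obtain k where "(a, b, 1 :: complex) = scaleC k (c, d, 1)" by (rule line_eqE)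
  then show "a = c \<and> b = d" by simp
qed simp

lemma line3_21: "line (c, 1, d) = line (1, a, b) \<longleftrightarrow> a * c = 1 \<and> b * c = d"
  and line3_31: "line (c, d, 1) = line (1, a, b) \<longleftrightarrow> b * c = 1 \<and> a * c = d"
  and line3_32: "line (c, d, 1) = line (a, 1, b) \<longleftrightarrow> b * d = 1 \<and> a * d = c" for a b c d :: complex
  by (subst eq_commute, rule line3_12, subst eq_commute, rule line3_13, subst eq_commute, rule line3_23)

definition Z1 :: "(c2, ipoint) chart" where "Z1 = (UNIV, \<lambda>(a, b). Plane (line (1, a, b)))"
definition Z2 :: "(c2, ipoint) chart" where "Z2 = (UNIV, \<lambda>(a, b). Plane (line (a, 1, b)))"
definition Z3 :: "(c2, ipoint) chart" where "Z3 = (UNIV, \<lambda>(a, b). Plane (line (a, b, 1)))"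

lemma fst_Z [simp]: "fst Z1 = UNIV" "fst Z2 = UNIV" "fst Z3 = UNIV"
  by (simp_all add: Z1_def Z2_def Z3_def)

lemma snd_Z: "snd Z1 (a, b) = Plane (line (1, a, b))" "snd Z2 (a, b) = Plane (line (a, 1, b))"
    "snd Z3 (a, b) = Plane (line (a, b, 1))"
  by (simp_all add: Z1_def Z2_def Z3_def)

lemma proj_plane_eq: "proj_plane = {Z1, Z2, Z3}"
  by (simp add: proj_plane_def Z1_def Z2_def Z3_def)

lemma surface_proj_plane: "surface proj_plane"
proof -
  note Z = Z1_def Z2_def Z3_def line3_12 line3_13 line3_23 line3_21 line3_31 line3_32
  have inj: "inj_on (snd Z1) (fst Z1)" "inj_on (snd Z2) (fst Z2)" "inj_on (snd Z3) (fst Z3)"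
    by (auto simp: Z inj_on_def)
  have op: "open (fst Z1)" "open (fst Z2)" "open (fst Z3)" by simp_all
  have t12: "holomorphic_transition Z1 Z2"
    by (rule holomorphic_transition_explicit[OF inj(2) op(1), where e = fst
          and f = "\<lambda>z. (1 / fst z, snd z / fst z)"]) (auto simp: Z split_paired_all intro!: cdiff_intros)
  have t13: "holomorphic_transition Z1 Z3"
    by (rule holomorphic_transition_explicit[OF inj(3) op(1), where e = snd
          and f = "\<lambda>z. (1 / snd z, fst z / snd z)"]) (auto simp: Z split_paired_all intro!: cdiff_intros)
  have t21: "holomorphic_transition Z2 Z1"
    by (rule holomorphic_transition_explicit[OF inj(1) op(2), where e = fst
          and f = "\<lambda>z. (1 / fst z, snd z / fst z)"]) (auto simp: Z split_paired_all intro!: cdiff_intros)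
  have t23: "holomorphic_transition Z2 Z3"
    by (rule holomorphic_transition_explicit[OF inj(3) op(2), where e = snd
          and f = "\<lambda>z. (fst z / snd z, 1 / snd z)"]) (auto simp: Z split_paired_all intro!: cdiff_intros)
  have t31: "holomorphic_transition Z3 Z1"
    by (rule holomorphic_transition_explicit[OF inj(1) op(3), where e = fst
          and f = "\<lambda>z. (snd z / fst z, 1 / fst z)"]) (auto simp: Z split_paired_all intro!: cdiff_intros)
  have t32: "holomorphic_transition Z3 Z2"
    by (rule holomorphic_transition_explicit[OF inj(2) op(3), where e = snd
          and f = "\<lambda>z. (fst z / snd z, 1 / snd z)"]) (auto simp: Z split_paired_all intro!: cdiff_intros)
  have "compatible_atlas proj_plane"
    unfolding proj_plane_eq using inj op t12 t13 t21 t23 t31 t32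
    by (intro compatible_atlasI) (elim insertE emptyE; simp)+
  moreover have s12: "separated Z1 Z2"
    by (rule separated_explicit[where F = "\<lambda>q. (fst (fst q) * fst (snd q), snd (fst q) * fst (snd q) - snd (snd q))"
          and a = "(1, 0)"]) (auto simp: Z split_paired_all intro!: cdiff_intros)
  have s13: "separated Z1 Z3"
    by (rule separated_explicit[where F = "\<lambda>q. (snd (fst q) * fst (snd q), fst (fst q) * fst (snd q) - snd (snd q))"
          and a = "(1, 0)"]) (auto simp: Z split_paired_all intro!: cdiff_intros)
  have s23: "separated Z2 Z3"
    by (rule separated_explicit[where F = "\<lambda>q. (snd (fst q) * snd (snd q), fst (fst q) * snd (snd q) - fst (snd q))"
          and a = "(1, 0)"]) (auto simp: Z split_paired_all intro!: cdiff_intros)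
  have "separated c d" if "c \<in> proj_plane" "d \<in> proj_plane" for c d
    using that s12 s13 s23 s12[THEN separated_sym] s13[THEN separated_sym] s23[THEN separated_sym]
      inj[THEN separated_self] unfolding proj_plane_eq by (elim insertE emptyE; simp)
  moreover have "finite proj_plane" by (simp add: proj_plane_eq)
  moreover have "p \<notin> ancestors q" if q: "q \<in> points proj_plane" for p q
  proof -
    obtain l where "q = Plane l"
      using q unfolding proj_plane_def points_def by auto
    then show ?thesis by simp
  qed
  ultimately show ?thesis unfolding surface_def using complex_manifoldI by blast
qed

lemma points_proj_plane: "points proj_plane = range (\<lambda>(a, b). Plane (line (1, a, b))) \<union>
    range (\<lambda>b. Plane (line (0, 1, b))) \<union> {Plane (line (0, 0, 1))}"
proof (intro subset_antisym subsetI)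
  fix q assume "q \<in> points proj_plane"
  then consider a b where "q = Plane (line (1, a, b))" | a b where "q = Plane (line (a, 1, b))"
    | a b where "q = Plane (line (a, b, 1))"
    unfolding proj_plane_def points_def by auto
  then show "q \<in> range (\<lambda>(a, b). Plane (line (1, a, b))) \<union>
    range (\<lambda>b. Plane (line (0, 1, b))) \<union> {Plane (line (0, 0, 1))}"
  proof cases
    case 2
    have "line (a, 1, b) = line (1, 1 / a, b / a)" if "a \<noteq> 0" using that by (simp add: line3_21)
    with 2 show ?thesis by (cases "a = 0") auto
  next
    case 3
    have "line (a, b, 1) = line (1, b / a, 1 / a)" if "a \<noteq> 0" using that by (simp add: line3_31)
    moreover have "line (0 :: complex, b, 1 :: complex) = line (0, 1, 1 / b)" if "b \<noteq> 0" using that by (simp add: line3_32)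
    ultimately show ?thesis using 3 by (cases "a = 0"; cases "b = 0") auto
  qed auto
next
  fix q assume "q \<in> range (\<lambda>(a, b). Plane (line (1, a, b))) \<union>
    range (\<lambda>b. Plane (line (0, 1, b))) \<union> {Plane (line (0, 0, 1))}"
  then show "q \<in> points proj_plane" unfolding proj_plane_def points_def by auto
qed

section \<open>Smooth rational curves of self-intersection -2\<close>

lemma adapted_iff: "c \<in> adapted S C \<longleftrightarrow> local_coordinates S c \<and>
    (\<forall>z w. (z, w) \<in> fst c \<longrightarrow> (snd c (z, w) \<in> C \<longleftrightarrow> w = 0))"
  unfolding adapted_def by (cases c) auto

definition axis_chart :: "(c2, 'a) chart \<Rightarrow> (complex, 'a) chart"
  where "axis_chart c = ({z. (z, 0) \<in> fst c}, \<lambda>z. snd c (z, 0))"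

lemma curve_atlas_eq: "curve_atlas S C = axis_chart ` adapted S C"
  unfolding curve_atlas_def axis_chart_def by (simp add: case_prod_unfold)

text \<open>Both charts describe the same curve by w = 0, so the ambient coordinate change preserves
  the axis, and its first component is the coordinate change of the curve.\<close>

lemma axis_chart_transition:
  assumes c: "c \<in> adapted S C" and d: "d \<in> adapted S C"
  shows "holomorphic_transition (axis_chart c) (axis_chart d)"
proof (rule holomorphic_transitionI)
  have lc: "local_coordinates S c" "local_coordinates S d" using c d by (simp_all add: adapted_iff)
  show "inj_on (snd (axis_chart d)) (fst (axis_chart d))"
    using local_coordinates_inj[OF lc(2)] by (auto simp: axis_chart_def inj_on_def)
  fix z w assume "z \<in> fst (axis_chart c)" "w \<in> fst (axis_chart d)"
    "snd (axis_chart c) z = snd (axis_chart d) w"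
  then have zw: "(z, 0) \<in> fst c" "(w, 0) \<in> fst d" "snd c (z, 0) = snd d (w, 0)"
    by (auto simp: axis_chart_def)
  obtain f where f: "cdifferentiable_at f (z, 0)"
    "lifts f c d (z, 0)"
    by (rule holomorphic_transitionE[OF local_coordinates_holomorphic_transition[OF lc]
          local_coordinates_inj[OF lc(2)] zw])
  have i: "cdifferentiable_at (\<lambda>x. (x, 0 :: complex)) z" by (intro cdiff_intros)
  have "\<forall>\<^sub>F x in nhds z. (x, 0) \<in> fst c \<and> f (x, 0) \<in> fst d \<and> snd d (f (x, 0)) = snd c (x, 0)"
    using cdiff_eventually[OF i f(2)] .
  then have "\<forall>\<^sub>F x in nhds z. x \<in> fst (axis_chart c) \<and> fst (f (x, 0)) \<in> fst (axis_chart d) \<and>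
      snd (axis_chart d) (fst (f (x, 0))) = snd (axis_chart c) x"
  proof eventually_elim
    case (elim x)
    have "snd c (x, 0) \<in> C" using c elim by (simp add: adapted_iff)
    then have "snd (f (x, 0)) = 0" using d elim unfolding adapted_iff by (metis prod.collapse)
    then have "f (x, 0) = (fst (f (x, 0)), 0)" by (simp add: prod_eq_iff)
    with elim show ?case by (simp add: axis_chart_def)
  qed
  moreover have "cdifferentiable_at (\<lambda>x. fst (f (x, 0))) z"
    by (rule cdiff_fst[OF cdiff_compose[OF i f(1)]])
  ultimately show "\<exists>f. cdifferentiable_at f z \<and> lifts f (axis_chart c) (axis_chart d) z"
    by (intro exI[of _ "\<lambda>x. fst (f (x, 0))"] conjI)
qed

lemma axis_chart_open:
  assumes "local_coordinates S c" shows "open (fst (axis_chart c))"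
proof -
  have "open ((\<lambda>z. (z, 0)) -` fst c)"
    by (intro open_vimage local_coordinates_open[OF assms] continuous_intros)
  then show ?thesis by (simp add: axis_chart_def vimage_def)
qed

lemma compatible_atlas_curve: "compatible_atlas (curve_atlas S C)"
  unfolding compatible_atlas_def curve_atlas_eq
proof (intro ballI, elim imageE, hypsubst)
  fix c d assume cd: "c \<in> adapted S C" "d \<in> adapted S C"
  then have lc: "local_coordinates S c" "local_coordinates S d"
    by (simp_all add: adapted_iff)
  have "inj_on (snd (axis_chart c)) (fst (axis_chart c))" "inj_on (snd (axis_chart d)) (fst (axis_chart d))"
    using local_coordinates_inj[OF lc(1)] local_coordinates_inj[OF lc(2)]
    by (auto simp: axis_chart_def inj_on_def)
  then show "compatible (axis_chart c) (axis_chart d)"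
    unfolding compatible_iff
    using axis_chart_transition[OF cd] axis_chart_transition[OF cd(2,1)]
      axis_chart_open[OF lc(1)] axis_chart_open[OF lc(2)] by blast
qed

lemma transition_deriv:
  assumes "\<forall>\<^sub>F w in nhds 0. snd (transition c d (z, w)) = a * w"
  shows "deriv (\<lambda>w. snd (transition c d (z, w))) 0 = (a :: complex)"
proof -
  have "deriv (\<lambda>w. snd (transition c d (z, w))) 0 = deriv (\<lambda>w. a * w) 0"
    by (rule deriv_cong_ev[OF assms refl])
  also have "\<dots> = a" by (rule DERIV_imp_deriv) (auto intro!: derivative_eq_intros)
  finally show ?thesis .
qed

text \<open>The gluing rule \<open>(z, w) \<mapsto> (1 / z, z\<^sup>2 w)\<close> is that of the line bundle of degree -2 over the
  projective line, and a neighbourhood of its zero section is all that is assumed here.\<close>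

locale minus_two_curve =
  fixes S :: "(c2, 'a) atlas" and c0 c1 :: "(c2, 'a) chart"
  assumes S: "compatible_atlas S"
    and c0: "local_coordinates S c0" and c1: "local_coordinates S c1"
    and axis0: "\<And>z. (z, 0) \<in> fst c0" and origin1: "(0, 0) \<in> fst c1"
    and glue: "\<And>z w. (z, w) \<in> fst c1 \<Longrightarrow> z \<noteq> 0 \<Longrightarrow>
      (1 / z, z\<^sup>2 * w) \<in> fst c0 \<and> snd c1 (z, w) = snd c0 (1 / z, z\<^sup>2 * w)"
begin

definition curve :: "'a set" where "curve = insert (snd c1 (0, 0)) (range (\<lambda>z. snd c0 (z, 0)))"

lemma inj0: "x \<in> fst c0 \<Longrightarrow> y \<in> fst c0 \<Longrightarrow> snd c0 x = snd c0 y \<Longrightarrow> x = y"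
  and inj1: "x \<in> fst c1 \<Longrightarrow> y \<in> fst c1 \<Longrightarrow> snd c1 x = snd c1 y \<Longrightarrow> x = y"
  using inj_onD[OF local_coordinates_inj[OF c0]] inj_onD[OF local_coordinates_inj[OF c1]] by blast+

text \<open>A coordinate change defined at \<open>(0, w)\<close> would have to extend \<open>1 / z\<close> to \<open>z = 0\<close>.\<close>

lemma fibre_at_infinity:
  assumes w: "(0, w) \<in> fst c1" and y: "y \<in> fst c0" shows "snd c1 (0, w) \<noteq> snd c0 y"
proof
  assume eq: "snd c1 (0, w) = snd c0 y"
  obtain f where f: "cdifferentiable_at f (0, w)"
    "lifts f c1 c0 (0, w)"
    by (rule holomorphic_transitionE[OF local_coordinates_holomorphic_transition[OF c1 c0]
          local_coordinates_inj[OF c0] w y eq])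
  have i: "cdifferentiable_at (\<lambda>z. (z, w)) 0" by (intro cdiff_intros)
  have "\<forall>\<^sub>F z in nhds 0. (z, w) \<in> fst c1 \<and> f (z, w) \<in> fst c0 \<and> snd c0 (f (z, w)) = snd c1 (z, w)"
    by (rule cdiff_eventually[OF i f(2)])
  then have "\<forall>\<^sub>F z in nhds 0. z \<noteq> 0 \<longrightarrow> z * fst (f (z, w)) = 1"
  proof eventually_elim
    case (elim z)
    show ?case
    proof
      assume "z \<noteq> 0"
      then have "f (z, w) = (1 / z, z\<^sup>2 * w)" using glue[of z w] elim by (intro inj0) auto
      with \<open>z \<noteq> 0\<close> show "z * fst (f (z, w)) = 1" by simp
    qed
  qed
  then have "\<forall>\<^sub>F z in at 0. z * fst (f (z, w)) = 1" by (simp add: eventually_at_filter)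
  then have "((\<lambda>z. z * fst (f (z, w))) \<longlongrightarrow> 1) (at 0)" by (rule tendsto_eventually)
  moreover have "cdifferentiable_at (\<lambda>z. z * fst (f (z, w))) 0"
    by (intro cdiff_mult cdiff_ident cdiff_fst cdiff_compose[OF i f(1)])
  then have "((\<lambda>z. z * fst (f (z, w))) \<longlongrightarrow> 0 * fst (f (0, w))) (at 0)"
    by (rule cdiff_isCont[unfolded isCont_def])
  ultimately have "1 = 0 * fst (f (0, w))" by (rule tendsto_unique[OF at_neq_bot])
  then show False by simp
qed

lemma adapted0: "c0 \<in> adapted S curve"
proof -
  have "snd c0 (z, w) \<in> curve \<longleftrightarrow> w = 0" if "(z, w) \<in> fst c0" for z w
    using that fibre_at_infinity[OF origin1 that] inj0[OF that axis0] unfolding curve_def by auto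
  then show ?thesis by (simp add: adapted_iff c0)
qed

lemma adapted1: "c1 \<in> adapted S curve"
proof -
  have "snd c1 (z, w) \<in> curve \<longleftrightarrow> w = 0" if zw: "(z, w) \<in> fst c1" for z w
  proof (cases "z = 0")
    case True
    have "snd c1 (0, w) \<noteq> snd c0 (z', 0)" for z'
      using fibre_at_infinity[OF _ axis0] zw True by simp
    then show ?thesis using inj1[OF zw origin1] True unfolding curve_def by auto
  next
    case False
    then show ?thesis using glue[OF zw] adapted0 by (simp add: adapted_iff)
  qed
  then show ?thesis by (simp add: adapted_iff c1)
qed

lemma points_curve_atlas: "points (curve_atlas S curve) = curve"
proof (intro subset_antisym subsetI)
  fix q assume "q \<in> points (curve_atlas S curve)"
  then obtain c z where "c \<in> curve_atlas S curve" "z \<in> fst c" "q = snd c z" by (rule pointsE)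
  then show "q \<in> curve" unfolding curve_atlas_eq by (auto simp: axis_chart_def adapted_iff)
next
  have in_atlas: "axis_chart c0 \<in> curve_atlas S curve" "axis_chart c1 \<in> curve_atlas S curve"
    using adapted0 adapted1 by (simp_all add: curve_atlas_eq)
  fix q assume "q \<in> curve"
  then consider z where "q = snd (axis_chart c0) z" "z \<in> fst (axis_chart c0)"
    | "q = snd (axis_chart c1) 0" "0 \<in> fst (axis_chart c1)"
    using axis0 origin1 by (auto simp: curve_def axis_chart_def)
  then show "q \<in> points (curve_atlas S curve)"
    by cases (use in_atlas in \<open>auto simp only: points_iff\<close>)
qed

text \<open>The axis of \<open>c0\<close> is the affine part of the projective line. The chart at
  infinity is patched, since \<open>c1\<close> is only known near its origin: \<open>c1\<close> is
  used there, and 1/z in \<open>c0\<close> for all nonzero z.\<close>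

lemma smooth_rational: "smooth_rational_curve S curve"
proof -
  note C = compatible_atlas_curve[of S curve]
  have lc: "local_coordinates (curve_atlas S curve) (axis_chart c0)"
    "local_coordinates (curve_atlas S curve) (axis_chart c1)"
    by (rule local_coordinates_member[OF C]; use adapted0 adapted1 in \<open>simp add: curve_atlas_eq\<close>)+
  \<comment> \<open>Every point of the projective line except \<open>line (0, 1)\<close> is
    \<open>line (1, z)\<close> for a unique \<open>z\<close>; the exception is sent to the origin of
    \<open>c1\<close>.\<close>
  define \<gamma> where "\<gamma> q = (if \<exists>z. q = line (1, z) then snd c0 (THE z. q = line (1, z), 0) else snd c1 (0, 0))"
    for q :: "c2 set"
  have \<gamma>1: "\<gamma> (line (1, z)) = snd c0 (z, 0)" for z by (auto simp: \<gamma>_def)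
  have \<gamma>0: "\<gamma> (line (0, 1)) = snd c1 (0, 0)" by (auto simp: \<gamma>_def line2_eq_iff)
  have \<gamma>inv: "\<gamma> (line (z, 1)) = snd c0 (1 / z, 0)" if "z \<noteq> 0" for z
  proof -
    have "line (z, 1) = line (1, 1 / z)" using that by (simp add: line2_eq_iff)
    then show ?thesis by (simp add: \<gamma>1)
  qed
  have bij: "bij_betw \<gamma> (points proj_line) (points (curve_atlas S curve))"
    unfolding points_curve_atlas points_proj_line bij_betw_def
  proof
    show "inj_on \<gamma> (insert (line (0, 1)) (range (\<lambda>z. line (1, z))))"
      using fibre_at_infinity[OF origin1 axis0] fibre_at_infinity[OF origin1 axis0, symmetric]
        inj0[OF axis0 axis0] by (auto simp: inj_on_def \<gamma>0 \<gamma>1)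
    show "\<gamma> ` insert (line (0, 1)) (range (\<lambda>z. line (1, z))) = curve"
      by (auto simp: \<gamma>0 \<gamma>1 curve_def image_iff)
  qed
  have "local_coordinates (curve_atlas S curve) (UNIV, \<lambda>z. \<gamma> (line (1, z)))"
    using lc(1) axis0 by (simp add: \<gamma>1 axis_chart_def)
  moreover have "local_coordinates (curve_atlas S curve) (UNIV, \<lambda>z. \<gamma> (line (z, 1)))"
  proof (rule local_coordinates_patch[OF C])
    have "inj_on \<gamma> (range (\<lambda>z. line (z, 1)))"
      using bij by (rule inj_on_subset[OF bij_betw_imp_inj_on]) (auto simp: proj_line_def points_def)
    moreover have "inj (\<lambda>z::complex. line (z, 1::complex))" by (auto simp: inj_on_def line2_eq_iff)
    ultimately show "inj (\<lambda>z. \<gamma> (line (z, 1)))" using comp_inj_on unfolding comp_def by blast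
    fix z :: complex assume "z \<in> UNIV"
    show "\<exists>U. z \<in> U \<and> U \<subseteq> UNIV \<and> local_coordinates (curve_atlas S curve) (U, \<lambda>z. \<gamma> (line (z, 1)))"
    proof (cases "z = 0")
      case True
      let ?U = "fst (axis_chart c1)"
      have "\<gamma> (line (z, 1)) = snd (axis_chart c1) z" if "z \<in> ?U" for z
      proof (cases "z = 0")
        case True then show ?thesis by (simp add: \<gamma>0 axis_chart_def)
      next
        case False
        then show ?thesis using glue[of z 0] that by (simp add: \<gamma>inv axis_chart_def)
      qed
      then have "local_coordinates (curve_atlas S curve) (?U, \<lambda>z. \<gamma> (line (z, 1)))"
        using local_coordinates_open[OF lc(2)]
        by (intro local_coordinates_reparam[OF C lc(2), of _ ?U "\<lambda>z. z" "\<lambda>z. z"])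
          (auto intro: cdiff_ident)
      then show ?thesis using origin1 True by (intro exI[of _ ?U]) (simp add: axis_chart_def)
    next
      case False
      have "open (- {0 :: complex})" by (intro open_Compl closed_singleton)
      then have "local_coordinates (curve_atlas S curve) (- {0}, \<lambda>z. \<gamma> (line (z, 1)))"
        using axis0
        by (intro local_coordinates_reparam[OF C lc(1), of _ "- {0}" "\<lambda>z. 1 / z" "\<lambda>z. 1 / z"])
          (auto simp: \<gamma>inv axis_chart_def intro!: cdiff_intros)
      then show ?thesis using False by (intro exI[of _ "- {0}"]) simp
    qed
  qed
  ultimately have "biholomorphic proj_line (curve_atlas S curve) \<gamma>"
    by (intro biholomorphicI[OF compatible_atlas_proj_line C bij])
      (auto simp: proj_line_eq line_chart0_def line_chart1_def comp_def)
  then show ?thesis using points_curve_atlas by (auto simp: smooth_rational_curve_def)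
qed

lemma transition_self_eq:
  assumes "c = c0 \<or> c = c1" "x \<in> fst c" shows "transition c c x = x"
  using assms local_coordinates_inj[OF c0] local_coordinates_inj[OF c1] by (auto intro: transition_eqI)

lemma transition_01:
  assumes "(z, w) \<in> overlap c0 c1" shows "z \<noteq> 0" "transition c0 c1 (z, w) = (1 / z, z\<^sup>2 * w)"
proof -
  obtain z' w' where zw: "(z, w) \<in> fst c0" "(z', w') \<in> fst c1" "snd c0 (z, w) = snd c1 (z', w')"
    using overlapE[OF assms] by (metis surj_pair)
  have "z' \<noteq> 0" using fibre_at_infinity[of w' "(z, w)"] zw by auto
  then have "(z, w) = (1 / z', z'\<^sup>2 * w')" using zw glue[of z' w'] by (intro inj0) auto
  then have "z = 1 / z'" "w = z'\<^sup>2 * w'" by simp_all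
  with \<open>z' \<noteq> 0\<close> have e: "z \<noteq> 0" "z' = 1 / z" "w' = z\<^sup>2 * w" by (simp_all add: power_divide)
  show "z \<noteq> 0" by (rule e)
  show "transition c0 c1 (z, w) = (1 / z, z\<^sup>2 * w)"
    using zw e by (intro transition_eqI[OF local_coordinates_inj[OF c1]]) auto
qed

lemma transition_10:
  assumes "(z, w) \<in> fst c1" "z \<noteq> 0" shows "transition c1 c0 (z, w) = (1 / z, z\<^sup>2 * w)"
  using glue[OF assms] by (intro transition_eqI[OF local_coordinates_inj[OF c0]]) auto

lemma overlap_10: "(z, w) \<in> overlap c1 c0 \<Longrightarrow> z \<noteq> 0"
  using fibre_at_infinity by (auto simp: overlap_def)

lemma self_intersection: "has_self_intersection S curve (-2)"
proof -
  let ?p = "snd c1 (0, 0)"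
  have ne: "c1 \<noteq> c0" using fibre_at_infinity[OF origin1 axis0[of 0]] by auto
  \<comment> \<open>The section of the normal bundle that is constantly 1 in \<open>c0\<close>.
    Since w is multiplied by z^2 under z |-> 1/z, it becomes z^(-2) in \<open>c1\<close>, so its
    divisor is -2 times the point at infinity.\<close>
  define s where "s c = (if c = c0 then (\<lambda>_. 1) else (\<lambda>z :: complex. inverse (z\<^sup>2)))" for c :: "(c2, 'a) chart"
  have s: "s c0 = (\<lambda>_. 1)" "s c1 = (\<lambda>z. inverse (z\<^sup>2))" using ne by (auto simp: s_def)
  define ord where "ord q = (if q = ?p then -2 else 0 :: int)" for q
  have open_slice: "\<forall>\<^sub>F w in nhds 0. (z, w) \<in> X" if "open X" "(z, 0) \<in> X" for z :: complex and X :: "c2 set"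
    by (rule cdiff_eventually[where f = "\<lambda>w. (z, w)"])
      (use that in \<open>auto intro!: cdiff_intros eventually_nhds_in_open\<close>)
  have open_axis: "\<forall>\<^sub>F w in at z. (w, 0) \<in> X" if "open X" "(z, 0) \<in> X" for z :: complex and X :: "c2 set"
  proof -
    have "\<forall>\<^sub>F w in nhds z. (w, 0) \<in> X"
      by (rule cdiff_eventually[where f = "\<lambda>w. (w, 0)"])
        (use that in \<open>auto intro!: cdiff_intros eventually_nhds_in_open\<close>)
    then show ?thesis by (simp add: eventually_at_filter eventually_mono)
  qed
  have neq0: "\<forall>\<^sub>F w in at z. w \<noteq> 0" if "z \<noteq> 0" for z :: complex
    using that by (intro tendsto_imp_eventually_ne[of _ z] tendsto_ident_at)
  have op01: "open (overlap c0 c1)"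
    using local_coordinates_holomorphic_transition[OF c0 c1] by (simp add: holomorphic_transition_def)
  have id_deriv: "deriv (\<lambda>w. snd (transition c c (z, w))) 0 = 1"
    if "c = c0 \<or> c = c1" "(z, 0) \<in> fst c" for c z
  proof (rule transition_deriv)
    have "open (fst c)" using that(1) local_coordinates_open[OF c0] local_coordinates_open[OF c1] by auto
    from open_slice[OF this that(2)] show "\<forall>\<^sub>F w in nhds 0. snd (transition c c (z, w)) = 1 * w"
      by eventually_elim (simp add: transition_self_eq[OF that(1)])
  qed
  have trans: "\<forall>\<^sub>F \<zeta> in at z. s d (fst (transition c d (\<zeta>, 0))) =
      deriv (\<lambda>w. snd (transition c d (\<zeta>, w))) 0 * s c \<zeta>"
    if cd: "c \<in> {c0, c1}" "d \<in> {c0, c1}" and z: "(z, 0) \<in> overlap c d" for c d z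
  proof -
    consider "c = d" | "c = c0" "d = c1" | "c = c1" "d = c0" using cd by blast
    then show ?thesis
    proof cases
      case 1
      have c: "c = c0 \<or> c = c1" using cd by blast
      then have "open (fst c)" using local_coordinates_open[OF c0] local_coordinates_open[OF c1] by auto
      moreover have "(z, 0) \<in> fst c" using z by (simp add: overlap_def)
      ultimately have "\<forall>\<^sub>F \<zeta> in at z. (\<zeta>, 0) \<in> fst c" by (rule open_axis)
      then show ?thesis
        unfolding 1[symmetric] by eventually_elim (simp add: id_deriv[OF c] transition_self_eq[OF c])
    next
      case 2
      from z have "(z, 0) \<in> overlap c0 c1" by (simp add: 2)
      from open_axis[OF op01 this] show ?thesis
        unfolding 2
      proof eventually_elim
        case (elim \<zeta>)
        have "deriv (\<lambda>w. snd (transition c0 c1 (\<zeta>, w))) 0 = \<zeta>\<^sup>2"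
          by (rule transition_deriv, rule eventually_mono[OF open_slice[OF op01 elim]])
            (simp add: transition_01)
        then show ?case using transition_01[OF elim] by (simp add: s power_divide)
      qed
    next
      case 3
      from z have z': "(z, 0) \<in> overlap c1 c0" by (simp add: 3)
      then have "(z, 0) \<in> fst c1" by (simp add: overlap_def)
      from open_axis[OF local_coordinates_open[OF c1] this] neq0[OF overlap_10[OF z']]
      show ?thesis
        unfolding 3
      proof eventually_elim
        case (elim \<zeta>)
        have "deriv (\<lambda>w. snd (transition c1 c0 (\<zeta>, w))) 0 = \<zeta>\<^sup>2"
          by (rule transition_deriv, rule eventually_mono[OF open_slice[OF local_coordinates_open[OF c1] elim(1)]])
            (simp add: transition_10 elim)
        then show ?case using elim by (simp add: s)
      qed
    qed
  qed
  have zord: "(\<forall>\<^sub>F \<zeta> in at z. s c \<zeta> \<noteq> 0) \<and> zorder (s c) z = ord (snd c (z, 0))"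
    if "c \<in> {c0, c1}" "(z, 0) \<in> fst c" for c z
  proof (cases "c = c0")
    case True
    then have "snd c (z, 0) \<noteq> ?p" using fibre_at_infinity[OF origin1 axis0[of z]] by auto
    then show ?thesis using True by (simp add: s ord_def)
  next
    case False
    then have c: "c = c1" using that by simp
    have ord: "ord (snd c1 (z, 0)) = (if z = 0 then -2 else 0)"
      using inj1[OF _ origin1, of "(z, 0)"] that(2) by (auto simp: ord_def c)
    have "\<forall>\<^sub>F \<zeta> in at z. \<zeta> \<noteq> 0"
    proof (cases "z = 0")
      case True then show ?thesis by (simp add: eventually_at_filter)
    qed (rule neq0)
    then have "\<forall>\<^sub>F \<zeta> in at z. s c \<zeta> \<noteq> 0" by eventually_elim (simp add: c s)
    moreover have "zorder (s c) z = (if z = 0 then -2 else 0)"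
    proof (cases "z = 0")
      case True
      have "zorder (\<lambda>z :: complex. inverse (z\<^sup>2)) 0 = (-2 :: int)"
        by (rule zorder_eqI[of UNIV 0 "\<lambda>_. 1"]) (auto simp: power_int_minus)
      then show ?thesis using True by (simp add: c s)
    next
      case False
      then have "(\<lambda>z. inverse (z\<^sup>2)) analytic_on {z}" by (auto intro!: analytic_intros)
      then show ?thesis using False by (simp add: c s zorder_eq_0I)
    qed
    ultimately show ?thesis by (simp add: c ord)
  qed
  have mero: "s c meromorphic_on X" for c X by (auto simp: s_def intro!: meromorphic_intros)
  have "{q \<in> curve. ord q \<noteq> 0} = {?p}" by (auto simp: ord_def curve_def)
  then have "finite {q \<in> curve. ord q \<noteq> 0}" "-2 = (\<Sum>q | q \<in> curve \<and> ord q \<noteq> 0. ord q)"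
    by (simp_all add: ord_def)
  moreover have "curve \<subseteq> points {c0, c1}"
    unfolding curve_def points_iff subset_eq using axis0 origin1 by auto
  moreover have "{c0, c1} \<subseteq> adapted S curve" using adapted0 adapted1 by simp
  ultimately show ?thesis
    unfolding has_self_intersection_def using trans zord mero
    by (intro exI[of _ "{c0, c1}"] exI[of _ s] exI[of _ ord]) blast
qed

end

lemma has_intersection_number_0: "C \<inter> D = {} \<Longrightarrow> has_intersection_number S C D 0"
  by (simp add: has_intersection_number_def)

text \<open>Along \<open>C\<close> the local equation of \<open>D\<close> is linear with slope
  \<kappa>, hence it vanishes to first order at the common point; \<open>b\<close> is the position
  of that point on \<open>D\<close>.\<close>

lemma has_intersection_number_1:
  assumes c: "c \<in> adapted S C" and d: "d \<in> adapted S D" and CD: "C \<inter> D = {snd c (a, 0)}"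
    and "\<kappa> \<noteq> 0"
    and ev: "\<forall>\<^sub>F z in nhds a. (z, 0) \<in> fst c \<and> (b, \<kappa> * (z - a)) \<in> fst d \<and>
      snd c (z, 0) = snd d (b, \<kappa> * (z - a))"
  shows "has_intersection_number S C D 1"
proof -
  have d': "local_coordinates S d" using d by (simp add: adapted_iff)
  have "(a, 0) \<in> overlap c d"
    using eventually_nhds_x_imp_x[OF ev] by (auto intro: overlapI)
  moreover have "zorder (\<lambda>z. snd (transition c d (z, 0))) a = 1"
  proof -
    have "\<forall>\<^sub>F z in nhds a. snd (transition c d (z, 0)) = \<kappa> * (z - a)"
      using ev
    proof eventually_elim
      case (elim z)
      then have "transition c d (z, 0) = (b, \<kappa> * (z - a))"
        by (intro transition_eqI[OF local_coordinates_inj[OF d']]) auto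
      then show ?case by simp
    qed
    then have "\<forall>\<^sub>F z in at a. snd (transition c d (z, 0)) = \<kappa> * (z - a)"
      by (simp add: eventually_at_filter eventually_mono)
    then have "zorder (\<lambda>z. snd (transition c d (z, 0))) a = zorder (\<lambda>z. \<kappa> * (z - a)) a"
      by (rule zorder_cong) simp
    also have "\<dots> = 1"
      by (rule zorder_eqI[of UNIV a "\<lambda>_. \<kappa>"]) (use \<open>\<kappa> \<noteq> 0\<close> in auto)
    finally show ?thesis .
  qed
  ultimately show ?thesis
    unfolding has_intersection_number_def CD using c d
    by (intro conjI exI[of _ "\<lambda>_. 1"]) auto
qed

section \<open>The surface\<close>

lemma snd_bl1: "snd (bl1 c) (u, v) = (if u = 0 then Exc (snd c (0, 0)) (line (1, v)) else snd c (u, u * v))"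
  and snd_bl2: "snd (bl2 c) (u, v) = (if v = 0 then Exc (snd c (0, 0)) (line (u, 1)) else snd c (u * v, v))"
  and fst_bl1: "(u, v) \<in> fst (bl1 c) \<longleftrightarrow> (u, u * v) \<in> fst c"
  and fst_bl2: "(u, v) \<in> fst (bl2 c) \<longleftrightarrow> (u * v, v) \<in> fst c"
  by (simp_all add: bl1_def bl2_def)

lemma fst_bl_UNIV [simp]: "fst c = UNIV \<Longrightarrow> fst (bl1 c) = UNIV" "fst c = UNIV \<Longrightarrow> fst (bl2 c) = UNIV"
  by (auto simp: bl1_def bl2_def)

lemma bl1_as_bl2: "v \<noteq> 0 \<Longrightarrow> snd (bl1 c) (u, v) = snd (bl2 c) (1 / v, u * v)"
  by (auto simp: snd_bl1 snd_bl2 line2_eq_iff)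

text \<open>The exceptional curve v = 0 of \<open>bl2 c\<close> meets \<open>bl1 c\<close> through
  (z, w) |-> (1/z, z w), the gluing of degree -1. Blowing up the origin of \<open>bl1 c\<close>
  contributes one more factor z and yields degree -2.\<close>

lemma bl2_bl1: "v \<noteq> 0 \<Longrightarrow> snd (bl2 (bl1 c)) (u, v) = snd (bl2 c) (1 / v, v\<^sup>2 * u)"
  by (simp add: snd_bl2[of "bl1 c"] bl1_as_bl2 power2_eq_square ac_simps)

text \<open>The mirror image, for an exceptional curve that is blown up at the origin of
  \<open>bl2 c\<close>; this happens over \<open>f1\<close>.\<close>

lemma bl1_bl2: "u \<noteq> 0 \<Longrightarrow> snd (bl1 (bl2 c)) (u, v) = snd (bl1 c) (u\<^sup>2 * v, 1 / u)"
  by (simp add: snd_bl1[of "bl2 c"] bl1_as_bl2 power2_eq_square ac_simps)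

text \<open>In these coordinates the curves through \<open>f3\<close> are v = -x_1 u^4, so the
  remaining blow-ups all take place at origins. The excluded point would be the one where the
  exceptional curve over \<open>f2\<close> meets the line at infinity: there y / x = u / (v + 1/4)
  is not a function of (u, v).\<close>

definition V0 :: "(c2, ipoint) chart"
  where "V0 = ({(u, v). u \<noteq> 0 \<or> v \<noteq> - (1 / 4)},
    \<lambda>(u, v). if u = 0 then snd (bl2 (bl2 Z2)) (v + 1 / 4, 0) else snd Z1 ((v + 1 / 4) / u\<^sup>2, 1 / u))"

text \<open>\<open>e1, e2, e3\<close> and \<open>f1, \<dots>, f6\<close> are the centres of the blow-ups, in the notation
  \<open>(z : x : y)\<close> the points infinitely near to \<open>(0 : 0 : 1)\<close> on the curves \<open>x = - x\<^sub>2 / y\<^sup>2\<close> and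
  infinitely near to \<open>(0 : 1 : 0)\<close> on the curves \<open>x = y\<^sup>2 / 4 - x\<^sub>1 / y\<^sup>2\<close>.  The coordinates \<open>V0\<close>
  around \<open>f3\<close> are \<open>(1 / y, x / y\<^sup>2 - 1 / 4)\<close>.\<close>

definition "e1 = Plane (line (0 :: complex, 0 :: complex, 1 :: complex))"
definition "e2 = Exc e1 (line (1, 0))"
definition "e3 = Exc e2 (line (1, 0))"
definition "f1 = Plane (line (0 :: complex, 1 :: complex, 0 :: complex))"
definition "f2 = Exc f1 (line (0, 1))"
definition "f3 = Exc f2 (line (1 / 4, 1))"
definition "f4 = Exc f3 (line (1, 0))"
definition "f5 = Exc f4 (line (1, 0))"
definition "f6 = Exc f5 (line (1, 0))"

lemmas centre_defs = e1_def e2_def e3_def f1_def f2_def f3_def f4_def f5_def f6_def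

text \<open>A chart \<open>Q\<close> continues towards the next centre, which is its origin except
  for the final ones \<open>Q3\<close> and \<open>Q7\<close>; the chart \<open>P\<close> of the same
  index covers the rest of the exceptional curve. Over \<open>f1\<close> the next centre lies in the
  other chart, hence the names \<open>T1\<close> and \<open>R1\<close>.\<close>

abbreviation "P1 \<equiv> bl2 Z3"
abbreviation "Q1 \<equiv> bl1 Z3"
abbreviation "P2 \<equiv> bl2 Q1"
abbreviation "Q2 \<equiv> bl1 Q1"
abbreviation "P3 \<equiv> bl2 Q2"
abbreviation "Q3 \<equiv> bl1 Q2"
abbreviation "R1 \<equiv> bl1 Z2"
abbreviation "T1 \<equiv> bl2 Z2"
abbreviation "R2 \<equiv> bl1 T1"
abbreviation "T2 \<equiv> bl2 T1"
abbreviation "P4 \<equiv> bl2 V0"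
abbreviation "Q4 \<equiv> bl1 V0"
abbreviation "P5 \<equiv> bl2 Q4"
abbreviation "Q5 \<equiv> bl1 Q4"
abbreviation "P6 \<equiv> bl2 Q5"
abbreviation "Q6 \<equiv> bl1 Q5"
abbreviation "P7 \<equiv> bl2 Q6"
abbreviation "Q7 \<equiv> bl1 Q6"

lemma centre_Z: "snd Z3 (0, 0) = e1" "snd Z2 (0, 0) = f1"
  by (simp_all add: snd_Z e1_def f1_def)

lemma centre_Q: "snd Q1 (0, 0) = e2" "snd Q2 (0, 0) = e3" "snd T1 (0, 0) = f2"
  by (simp_all add: snd_bl1 snd_bl2 centre_Z e2_def e3_def f2_def)

lemma fst_V0: "(u, v) \<in> fst V0 \<longleftrightarrow> u \<noteq> 0 \<or> v \<noteq> - (1 / 4)"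
  by (simp add: V0_def)

lemma snd_V0: "snd V0 (u, v) = (if u = 0 then Exc f2 (line (v + 1 / 4, 1))
    else Plane (line (1, (v + 1 / 4) / u\<^sup>2, 1 / u)))"
  by (simp add: V0_def snd_bl2[of T1] centre_Q snd_Z)

lemma centre_V0: "snd V0 (0, 0) = f3"
  by (simp add: snd_V0 f3_def)

lemma centre_Q': "snd Q4 (0, 0) = f4" "snd Q5 (0, 0) = f5" "snd Q6 (0, 0) = f6"
  by (simp_all add: snd_bl1 centre_V0 f4_def f5_def f6_def)

lemmas centres = centre_Z centre_Q centre_V0 centre_Q'

lemma snd_T2: "snd T2 (u, v) = (if v = 0 then Exc f2 (line (u, 1)) else Plane (line (u * v\<^sup>2, 1, v)))"
  unfolding snd_bl2[of T1] centres by (simp add: snd_bl2[of Z2] snd_Z power2_eq_square ac_simps)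

text \<open>These criteria certify that a centre lies outside a chart, by the shapes that the points
  of the chart can have.\<close>

lemma notin_Z1: "(\<And>a b. q \<noteq> Plane (line (1, a, b))) \<Longrightarrow> q \<notin> snd Z1 ` fst Z1"
  and notin_Z2: "(\<And>a b. q \<noteq> Plane (line (a, 1, b))) \<Longrightarrow> q \<notin> snd Z2 ` fst Z2"
  and notin_Z3: "(\<And>a b. q \<noteq> Plane (line (a, b, 1))) \<Longrightarrow> q \<notin> snd Z3 ` fst Z3"
  by (auto simp: Z1_def Z2_def Z3_def)

lemma notin_bl1:
  assumes "q \<notin> snd c ` fst c" "\<And>v. q \<noteq> Exc (snd c (0, 0)) (line (1, v))"
  shows "q \<notin> snd (bl1 c) ` fst (bl1 c)"
proof
  assume "q \<in> snd (bl1 c) ` fst (bl1 c)"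
  then obtain u v where "q = snd (bl1 c) (u, v)" "(u, v) \<in> fst (bl1 c)" by auto
  then show False using assms by (cases "u = 0") (auto simp: snd_bl1 fst_bl1)
qed

lemma notin_bl2:
  assumes "q \<notin> snd c ` fst c" "\<And>u. q \<noteq> Exc (snd c (0, 0)) (line (u, 1))"
  shows "q \<notin> snd (bl2 c) ` fst (bl2 c)"
proof
  assume "q \<in> snd (bl2 c) ` fst (bl2 c)"
  then obtain u v where "q = snd (bl2 c) (u, v)" "(u, v) \<in> fst (bl2 c)" by auto
  then show False using assms by (cases "v = 0") (auto simp: snd_bl2 fst_bl2)
qed

lemma notin_V0:
  assumes "\<And>a b. q \<noteq> Plane (line (1, a, b))" "\<And>u. q \<noteq> Exc f2 (line (u, 1))"
  shows "q \<notin> snd V0 ` fst V0"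
proof
  assume "q \<in> snd V0 ` fst V0"
  then obtain u v where "q = snd V0 (u, v)" by auto
  then show False using assms(1)[of "(v + 1 / 4) / u\<^sup>2" "1 / u"] assms(2)[of "v + 1 / 4"]
    by (cases "u = 0") (simp_all add: snd_V0)
qed

lemmas notin = notin_Z1 notin_Z2 notin_Z3 notin_V0 notin_bl1 notin_bl2
lemmas line3_eqs = line3_12 line3_13 line3_23 line3_21 line3_31 line3_32

text \<open>An iterated blow-up together with a list of charts that are valid on it. The projection
  fixes every term \<open>Plane l\<close>, which finally identifies (x, y) with the affine
  coordinates of the plane.\<close>

definition stage :: "(c2, ipoint) atlas \<Rightarrow> (c2, ipoint) chart list \<Rightarrow> bool"
  where "stage A cs \<longleftrightarrow> surface A \<and> (\<forall>c\<in>set cs. local_coordinates A c) \<and>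
    (\<exists>\<pi>. blown_up_plane A \<pi> \<and> (\<forall>l. \<pi> (Plane l) = Plane l))"

text \<open>The head of the list is the chart centred at the point to be blown up. It is traded for
  its two blow-up charts, and all other listed charts must miss the centre.\<close>

lemma stage_blow_up:
  assumes "stage A (c # cs)" "(0, 0) \<in> fst c" "\<forall>d\<in>set cs. snd c (0, 0) \<notin> snd d ` fst d"
  shows "stage (blow_up A c) (bl1 c # bl2 c # cs)"
proof -
  interpret blow_up_point A c
    using assms(1,2) by unfold_locales (simp_all add: stage_def)
  obtain \<pi> where "blown_up_plane A \<pi>" "\<And>l. \<pi> (Plane l) = Plane l"
    using assms(1) by (auto simp: stage_def)
  moreover obtain V \<psi> where "c = (V, \<psi>)" by (cases c)
  ultimately have "blown_up_plane (blow_up A c) (\<pi> \<circ> blow_down (snd c (0, 0)))"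
    "\<And>l. (\<pi> \<circ> blow_down (snd c (0, 0))) (Plane l) = Plane l"
    using blown_up_plane.blow_up[of A \<pi> V \<psi>] c origin by (simp_all add: blow_down_def)
  moreover have "\<forall>d\<in>set cs. local_coordinates (blow_up A c) d"
    using assms(1,3) local_coordinates_unaffected by (simp add: stage_def)
  ultimately show ?thesis
    using surface_blow_up local_coordinates_bl1 local_coordinates_bl2 unfolding stage_def by auto
qed

lemma stage_subset: "stage A cs \<Longrightarrow> set ds \<subseteq> set cs \<Longrightarrow> stage A ds"
  unfolding stage_def by blast

lemma stage_insert: "stage A cs \<Longrightarrow> local_coordinates A c \<Longrightarrow> stage A (c # cs)"
  unfolding stage_def by simp

text \<open>For a chart that does contain the centre: by injectivity it does so at one parameter,
  and only this parameter is lost.\<close>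

lemma (in blow_up_point) local_coordinates_delete:
  assumes d: "local_coordinates A d" and z: "z \<in> fst d" "snd d z = snd c (0, 0)"
  shows "local_coordinates (blow_up A c) (fst d - {z}, snd d)"
proof -
  have "snd d y \<in> U \<longleftrightarrow> y \<noteq> z" if "y \<in> fst d" for y
    using z that local_coordinates_points[OF d that] inj_onD[OF local_coordinates_inj[OF d], of y z] by auto
  then have "restrict_chart U d = (fst d - {z}, snd d)"
    unfolding restrict_chart_def by blast
  then show ?thesis using local_coordinates_keep[OF d] by simp
qed

section \<open>The nine blow-ups and the charts that survive them\<close>

definition "S1 = blow_up proj_plane Z3"
definition "S2 = blow_up S1 Q1"
definition "S3 = blow_up S2 Q2"
definition "S4 = blow_up S3 Z2"
definition "S5 = blow_up S4 T1"
definition "S6 = blow_up S5 V0"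
definition "S7 = blow_up S6 Q4"
definition "S8 = blow_up S7 Q5"
definition "S9 = blow_up S8 Q6"

lemmas ball_list = list.set ball_simps(7) ball_empty

lemma stage_S0: "stage proj_plane [Z3, Z1, Z2]"
proof -
  have "compatible_atlas proj_plane" using surface_proj_plane by (simp add: surface_def)
  then show ?thesis
    using surface_proj_plane blown_up_plane.plane local_coordinates_member[of proj_plane]
    by (auto simp: stage_def proj_plane_eq)
qed

lemma stage_S1: "stage S1 [Q1, P1, Z1, Z2]"
  unfolding S1_def
  by (rule stage_blow_up, rule stage_subset[OF stage_S0], force, simp,
      simp only: ball_list, intro conjI TrueI notin)
    (simp_all add: centres centre_defs line2_eq_iff line3_eqs)

lemma stage_S2: "stage S2 [Q2, P2, P1, Z1, Z2]"
  unfolding S2_def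
  by (rule stage_blow_up, rule stage_subset[OF stage_S1], force, simp,
      simp only: ball_list, intro conjI TrueI notin)
    (simp_all add: centres centre_defs line2_eq_iff line3_eqs)

lemma stage_S3: "stage S3 [Q3, P3, P2, P1, Z1, Z2]"
  unfolding S3_def
  by (rule stage_blow_up, rule stage_subset[OF stage_S2], force, simp,
      simp only: ball_list, intro conjI TrueI notin)
    (simp_all add: centres centre_defs line2_eq_iff line3_eqs)

lemma stage_S4: "stage S4 [R1, T1, Q3, P3, P2, P1, Z1]"
  unfolding S4_def
  by (rule stage_blow_up, rule stage_subset[OF stage_S3], force, simp,
      simp only: ball_list, intro conjI TrueI notin)
    (simp_all add: centres centre_defs line2_eq_iff line3_eqs)

lemma stage_S5: "stage S5 [R2, T2, R1, Q3, P3, P2, P1, Z1]"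
  unfolding S5_def
  by (rule stage_blow_up, rule stage_subset[OF stage_S4], force, simp,
      simp only: ball_list, intro conjI TrueI notin)
    (simp_all add: centres centre_defs line2_eq_iff line3_eqs)

lemma stage_compatible: "stage A cs \<Longrightarrow> compatible_atlas A"
  by (simp add: stage_def surface_def)

text \<open>Patched from two charts. Where v differs from -1/4 it is \<open>T2\<close>, whose
  coordinates are (x / y^2, y / x) = (v + 1/4, u / (v + 1/4)); where u is nonzero it is the affine
  chart \<open>Z1\<close>.\<close>

lemma local_coordinates_V0: "local_coordinates S5 V0"
proof -
  note A = stage_compatible[OF stage_S5]
  have T2: "local_coordinates S5 T2" and Z1: "local_coordinates S5 Z1"
    using stage_S5 unfolding stage_def by (simp_all only: ball_list)
  let ?U1 = "{z :: c2. snd z \<noteq> - (1 / 4)}" and ?U2 = "{z :: c2. fst z \<noteq> 0}"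
  have op: "open ?U1" "open ?U2" "open {z :: c2. snd z \<noteq> 0}"
    by (intro open_Collect_neq continuous_intros)+
  have 1: "local_coordinates S5 (?U1, snd V0)"
  proof (rule local_coordinates_reparam[OF A T2 op(1) op(2)])
    fix z assume "z \<in> ?U1"
    moreover obtain u v where z: "z = (u, v)" by (cases z)
    ultimately have "v \<noteq> - (1 / 4)" by simp
    then have v: "v + 1 / 4 \<noteq> 0" unfolding eq_neg_iff_add_eq_0 .
    have "cdifferentiable_at (\<lambda>z. (snd z + 1 / 4, fst z / (snd z + 1 / 4))) z"
      by (intro cdiff_intros) (use v in \<open>simp add: z\<close>)
    then show "cdifferentiable_at (\<lambda>z. (snd z + 1 / 4, fst z / (snd z + 1 / 4))) z \<and>
        (snd z + 1 / 4, fst z / (snd z + 1 / 4)) \<in> ?U2 \<and>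
        (\<lambda>z. (snd z * fst z, fst z - 1 / 4)) (snd z + 1 / 4, fst z / (snd z + 1 / 4)) = z \<and>
        snd V0 z = snd T2 (snd z + 1 / 4, fst z / (snd z + 1 / 4))"
      using v by (simp add: z snd_V0 snd_T2 line3_12 power2_eq_square)
  next
    fix z assume "z \<in> ?U2"
    then show "cdifferentiable_at (\<lambda>z. (snd z * fst z, fst z - 1 / 4)) z \<and>
        (snd z * fst z, fst z - 1 / 4) \<in> ?U1 \<and>
        (\<lambda>z. (snd z + 1 / 4, fst z / (snd z + 1 / 4))) (snd z * fst z, fst z - 1 / 4) = z"
      by (auto intro!: cdiff_intros simp: prod_eq_iff)
  qed simp
  have 2: "local_coordinates S5 (?U2, snd V0)"
  proof (rule local_coordinates_reparam[OF A Z1 op(2) op(3)])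
    fix z assume "z \<in> ?U2"
    moreover obtain u v where z: "z = (u, v)" by (cases z)
    ultimately have u: "u \<noteq> 0" by simp
    have "cdifferentiable_at (\<lambda>z. ((snd z + 1 / 4) / (fst z)\<^sup>2, 1 / fst z)) z"
      by (intro cdiff_intros) (use u in \<open>simp_all add: z\<close>)
    then show "cdifferentiable_at (\<lambda>z. ((snd z + 1 / 4) / (fst z)\<^sup>2, 1 / fst z)) z \<and>
        ((snd z + 1 / 4) / (fst z)\<^sup>2, 1 / fst z) \<in> {z. snd z \<noteq> 0} \<and>
        (\<lambda>z. (1 / snd z, fst z / (snd z)\<^sup>2 - 1 / 4)) ((snd z + 1 / 4) / (fst z)\<^sup>2, 1 / fst z) = z \<and>
        snd V0 z = snd Z1 ((snd z + 1 / 4) / (fst z)\<^sup>2, 1 / fst z)"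
      using u by (simp add: z snd_V0 snd_Z power_divide)
  next
    fix z :: c2 assume "z \<in> {z. snd z \<noteq> 0}"
    then show "cdifferentiable_at (\<lambda>z. (1 / snd z, fst z / (snd z)\<^sup>2 - 1 / 4)) z \<and>
        (1 / snd z, fst z / (snd z)\<^sup>2 - 1 / 4) \<in> ?U2 \<and>
        (\<lambda>z. ((snd z + 1 / 4) / (fst z)\<^sup>2, 1 / fst z)) (1 / snd z, fst z / (snd z)\<^sup>2 - 1 / 4) = z"
      by (auto intro!: cdiff_intros simp: prod_eq_iff power_divide)
  qed simp
  have inj: "inj_on (snd V0) (fst V0)"
  proof (rule inj_onI)
    fix z w assume "z \<in> fst V0" "w \<in> fst V0" and eq: "snd V0 z = snd V0 w"
    obtain u v u' v' where zw: "z = (u, v)" "w = (u', v')" by (cases z; cases w)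
    show "z = w"
      using eq by (cases "u = 0"; cases "u' = 0") (auto simp: zw snd_V0 line2_eq_iff)
  qed
  have "local_coordinates S5 (fst V0, snd V0)"
  proof (rule local_coordinates_patch[OF A inj])
    fix z assume z: "z \<in> fst V0"
    have sub: "?U1 \<subseteq> fst V0" "?U2 \<subseteq> fst V0" by (auto simp: V0_def)
    have "z \<in> ?U1 \<or> z \<in> ?U2" using z by (auto simp: V0_def)
    then show "\<exists>U. z \<in> U \<and> U \<subseteq> fst V0 \<and> local_coordinates S5 (U, snd V0)"
    proof
      assume "z \<in> ?U1" with sub(1) 1 show ?thesis by (intro exI[of _ ?U1] conjI)
    next
      assume "z \<in> ?U2" with sub(2) 2 show ?thesis by (intro exI[of _ ?U2] conjI)
    qed
  qed
  then show ?thesis by simp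
qed

text \<open>The removed parameters are those of \<open>f3\<close>: the direction coordinates of
  \<open>T2\<close> and \<open>R2\<close> along the exceptional curve are x / y^2 and its
  reciprocal, so the value 1/4 in one is 4 in the other.\<close>

abbreviation "T2' \<equiv> (- {(1 / 4, 0)}, snd T2)"
abbreviation "R2' \<equiv> (- {(0, 4)}, snd R2)"

text \<open>Here the centre lies inside two charts that are needed later; they are kept with one
  point deleted.\<close>

lemma stage_S6: "stage S6 [Q4, P4, T2', R2', R1, Q3, P3, P2, P1, Z1]"
proof -
  interpret blow_up_point S5 V0
    using stage_S5 local_coordinates_V0 by unfold_locales (simp_all add: stage_def fst_V0)
  have "local_coordinates S6 (fst T2 - {(1 / 4, 0)}, snd T2)"
    unfolding S6_def by (rule local_coordinates_delete)
      (use stage_S5 in \<open>simp_all add: stage_def centres snd_T2 f3_def\<close>)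
  moreover have "local_coordinates S6 (fst R2 - {(0, 4)}, snd R2)"
    unfolding S6_def by (rule local_coordinates_delete)
      (use stage_S5 in \<open>simp_all add: stage_def centres snd_bl1 f3_def line2_eq_iff\<close>)
  moreover have "stage S6 [Q4, P4, R1, Q3, P3, P2, P1, Z1]"
    unfolding S6_def
    by (rule stage_blow_up, rule stage_insert[OF _ local_coordinates_V0],
        rule stage_subset[OF stage_S5], force, simp add: fst_V0,
        simp only: ball_list, intro conjI TrueI notin)
      (simp_all add: centres centre_defs line2_eq_iff line3_eqs)
  ultimately show ?thesis by (simp add: stage_def Compl_eq_Diff_UNIV)
qed

lemma notin_T2: "(\<And>u v. q \<noteq> Plane (line (u, 1, v))) \<Longrightarrow> (\<And>u. q \<noteq> Exc f2 (line (u, 1))) \<Longrightarrow>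
    q \<notin> snd T2' ` fst T2'"
proof
  assume q: "\<And>u v. q \<noteq> Plane (line (u, 1, v))" "\<And>u. q \<noteq> Exc f2 (line (u, 1))" and "q \<in> snd T2' ` fst T2'"
  then obtain u v where "q = snd T2 (u, v)" by auto
  then show False using q by (cases "v = 0") (simp_all add: snd_T2)
qed

lemma notin_R2: "q \<notin> snd R2 ` fst R2 \<Longrightarrow> q \<notin> snd R2' ` fst R2'"
  by auto

lemma stage_S7: "stage S7 [Q5, P5, P4, T2', R2', R1, Q3, P3, P2, P1, Z1]"
  unfolding S7_def
  by (rule stage_blow_up, rule stage_subset[OF stage_S6], force, simp add: fst_bl1 fst_V0,
      simp only: ball_list, intro conjI TrueI notin_T2 notin_R2 notin)
    (simp_all add: centres centre_defs line2_eq_iff line3_eqs)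

lemma stage_S8: "stage S8 [Q6, P6, P5, P4, T2', R2', R1, Q3, P3, P2, P1, Z1]"
  unfolding S8_def
  by (rule stage_blow_up, rule stage_subset[OF stage_S7], force, simp add: fst_bl1 fst_V0,
      simp only: ball_list, intro conjI TrueI notin_T2 notin_R2 notin)
    (simp_all add: centres centre_defs line2_eq_iff line3_eqs)

lemma stage_S9: "stage S9 [Q7, P7, P6, P5, P4, T2', R2', R1, Q3, P3, P2, P1, Z1]"
  unfolding S9_def
  by (rule stage_blow_up, rule stage_subset[OF stage_S8], force, simp add: fst_bl1 fst_V0,
      simp only: ball_list, intro conjI TrueI notin_T2 notin_R2 notin)
    (simp_all add: centres centre_defs line2_eq_iff line3_eqs)

section \<open>The curves at infinity\<close>

text \<open>Adapted charts require the curve to be w = 0, whereas several of the curves are given by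
  the vanishing of the first coordinate.\<close>

definition swap_chart :: "(c2, 'a) chart \<Rightarrow> (c2, 'a) chart"
  where "swap_chart c = ({(z, w). (w, z) \<in> fst c}, \<lambda>(z, w). snd c (w, z))"

lemma fst_swap_chart [simp]: "(z, w) \<in> fst (swap_chart c) \<longleftrightarrow> (w, z) \<in> fst c"
  and snd_swap_chart [simp]: "snd (swap_chart c) (z, w) = snd c (w, z)"
  by (simp_all add: swap_chart_def)

lemma local_coordinates_swap_chart:
  "compatible_atlas A \<Longrightarrow> local_coordinates A c \<Longrightarrow> local_coordinates A (swap_chart c)"
  using local_coordinates_swap[of A "fst c" "snd c"] by (simp add: swap_chart_def)

lemmas S9 = stage_compatible[OF stage_S9]

lemma S9_charts: "local_coordinates S9 Q7" "local_coordinates S9 P7" "local_coordinates S9 P6"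
    "local_coordinates S9 P5" "local_coordinates S9 P4" "local_coordinates S9 T2'"
    "local_coordinates S9 R2'" "local_coordinates S9 R1" "local_coordinates S9 Q3"
    "local_coordinates S9 P3" "local_coordinates S9 P2" "local_coordinates S9 P1"
    "local_coordinates S9 Z1"
  using stage_S9 unfolding stage_def by (simp_all only: ball_list)

text \<open>The coordinates \<open>(z, w)\<close> of \<open>H\<close> and \<open>H_inf\<close> are \<open>x / y\<^sup>2\<close> and its inverse along the
  exceptional curve over \<open>f2\<close>, together with a transversal coordinate that is also adapted to
  the blow-up of \<open>f3\<close>.\<close>

definition H :: "(c2, ipoint) chart"
  where "H = (UNIV, \<lambda>(z, w). if z = 1 / 4 then Exc f3 (line (w / 4, 1)) else snd T2 (z, w * (z - 1 / 4)))"

definition H_inf :: "(c2, ipoint) chart"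
  where "H_inf = ({z. fst z \<noteq> 4}, \<lambda>(z, w). snd R2 (w * (4 - z) / 4, z))"

lemma fst_H [simp]: "fst H = UNIV" by (simp add: H_def)

lemma snd_H: "snd H (z, w) = (if z = 1 / 4 then Exc f3 (line (w / 4, 1)) else snd T2 (z, w * (z - 1 / 4)))"
  by (simp add: H_def)

lemma snd_P4: "snd P4 (u, v) = (if v = 0 then Exc f3 (line (u, 1)) else snd V0 (u * v, v))"
  by (simp add: snd_bl2 centres)

text \<open>In affine terms the coordinates of \<open>H\<close> are z = x / y^2 and w = (y / x) / (z
  - 1/4), while \<open>P4\<close> has the coordinates (1 / y) / (z - 1/4) and z - 1/4. Their first
  coordinates differ by the factor z, which is why z = 0 is excluded.\<close>

lemma H_eq_P4:
  assumes "z \<noteq> 0" shows "snd H (z, w) = snd P4 (w * z, z - 1 / 4)"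
proof (cases "z = 1 / 4")
  case True
  show ?thesis unfolding True by (simp add: snd_H snd_P4)
next
  case False
  define b where "b = w * (z - 1 / 4)"
  have z: "z - 1 / 4 \<noteq> 0" using False by simp
  have "w * z * (z - 1 / 4) = z * b" by (simp add: b_def)
  then have "snd P4 (w * z, z - 1 / 4) = snd V0 (z * b, z - 1 / 4)"
    unfolding snd_P4 using z by (simp only: if_False)
  also have "\<dots> = snd T2 (z, b)"
    using assms by (simp add: snd_V0 snd_T2 line3_12 power2_eq_square)
  finally show ?thesis using False by (simp add: snd_H b_def)
qed

text \<open>\<open>T2'\<close> covers everything except z = 1/4, and \<open>P4\<close> everything
  except z = 0. Injectivity across the two branches holds because points over \<open>f3\<close> are
  neither points over \<open>f2\<close> nor points of the plane.\<close>

lemma local_coordinates_H: "local_coordinates S9 H"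
proof -
  let ?U1 = "{z :: c2. fst z \<noteq> 1 / 4}" and ?U2 = "{z :: c2. fst z \<noteq> 0}" and ?Y = "{z :: c2. snd z \<noteq> - (1 / 4)}"
  have op: "open ?U1" "open ?U2" "open ?Y"
    by (intro open_Collect_neq continuous_intros)+
  have 1: "local_coordinates S9 (?U1, snd H)"
  proof (rule local_coordinates_reparam[OF S9 S9_charts(6) op(1) op(1)])
    show "?U1 \<subseteq> fst T2'" by auto
    fix z assume "z \<in> ?U1"
    moreover obtain u v where z: "z = (u, v)" by (cases z)
    ultimately have u: "u - 1 / 4 \<noteq> 0" by simp
    have "cdifferentiable_at (\<lambda>z. (fst z, snd z * (fst z - 1 / 4))) z" by (intro cdiff_intros) simp_all
    then show "cdifferentiable_at (\<lambda>z. (fst z, snd z * (fst z - 1 / 4))) z \<and>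
        (fst z, snd z * (fst z - 1 / 4)) \<in> ?U1 \<and>
        (\<lambda>z. (fst z, snd z / (fst z - 1 / 4))) (fst z, snd z * (fst z - 1 / 4)) = z \<and>
        snd H z = snd T2' (fst z, snd z * (fst z - 1 / 4))"
      using u by (simp add: z snd_H)
  next
    fix z assume "z \<in> ?U1"
    moreover obtain u v where z: "z = (u, v)" by (cases z)
    ultimately have u: "u - 1 / 4 \<noteq> 0" by simp
    have "cdifferentiable_at (\<lambda>z. (fst z, snd z / (fst z - 1 / 4))) z"
      by (intro cdiff_intros) (use u in \<open>simp_all add: z\<close>)
    then show "cdifferentiable_at (\<lambda>z. (fst z, snd z / (fst z - 1 / 4))) z \<and>
        (fst z, snd z / (fst z - 1 / 4)) \<in> ?U1 \<and>
        (\<lambda>z. (fst z, snd z * (fst z - 1 / 4))) (fst z, snd z / (fst z - 1 / 4)) = z"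
      using u by (simp add: z)
  qed
  have 2: "local_coordinates S9 (?U2, snd H)"
  proof (rule local_coordinates_reparam[OF S9 S9_charts(5) op(2) op(3)])
    show "?Y \<subseteq> fst P4" by (auto simp: fst_bl2 fst_V0)
    fix z assume "z \<in> ?U2"
    moreover obtain u v where z: "z = (u, v)" by (cases z)
    ultimately have u: "u \<noteq> 0" by simp
    then have "u - 1 / 4 \<noteq> - (1 / 4)" by simp
    have "cdifferentiable_at (\<lambda>z. (snd z * fst z, fst z - 1 / 4)) z" by (intro cdiff_intros) simp_all
    then show "cdifferentiable_at (\<lambda>z. (snd z * fst z, fst z - 1 / 4)) z \<and>
        (snd z * fst z, fst z - 1 / 4) \<in> ?Y \<and>
        (\<lambda>z. (snd z + 1 / 4, fst z / (snd z + 1 / 4))) (snd z * fst z, fst z - 1 / 4) = z \<and>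
        snd H z = snd P4 (snd z * fst z, fst z - 1 / 4)"
      using u \<open>u - 1 / 4 \<noteq> - (1 / 4)\<close> by (simp add: z H_eq_P4)
  next
    fix z assume "z \<in> ?Y"
    moreover obtain u v where z: "z = (u, v)" by (cases z)
    ultimately have "v \<noteq> - (1 / 4)" by simp
    then have v: "v + 1 / 4 \<noteq> 0" unfolding eq_neg_iff_add_eq_0 .
    have "cdifferentiable_at (\<lambda>z. (snd z + 1 / 4, fst z / (snd z + 1 / 4))) z"
      by (intro cdiff_intros) (use v in \<open>simp_all add: z\<close>)
    then show "cdifferentiable_at (\<lambda>z. (snd z + 1 / 4, fst z / (snd z + 1 / 4))) z \<and>
        (snd z + 1 / 4, fst z / (snd z + 1 / 4)) \<in> ?U2 \<and>
        (\<lambda>z. (snd z * fst z, fst z - 1 / 4)) (snd z + 1 / 4, fst z / (snd z + 1 / 4)) = z"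
      using v by (simp add: z)
  qed
  have inj: "inj (snd H)"
  proof (rule injI)
    fix z w assume eq: "snd H z = snd H w"
    obtain u v u' v' where zw: "z = (u, v)" "w = (u', v')" by (cases z; cases w)
    have f: "f2 \<noteq> f3" by (simp add: f2_def f3_def f1_def)
    show "z = w"
    proof (cases "u = 1 / 4")
      case True
      have "u' = 1 / 4"
      proof (rule ccontr)
        assume "u' \<noteq> 1 / 4"
        then show False
          using eq f[symmetric] unfolding zw True snd_H snd_T2 by (simp split: if_splits)
      qed
      then show ?thesis using eq unfolding zw True by (simp add: snd_H line2_eq_iff)
    next
      case u: False
      have "u' \<noteq> 1 / 4"
      proof
        assume u': "u' = 1 / 4"
        then show False
          using eq f u unfolding zw u' snd_H snd_T2 by (simp split: if_splits)
      qed
      with u have False: "u \<noteq> 1 / 4" "u' \<noteq> 1 / 4" by auto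
      then have "snd T2 (u, v * (u - 1 / 4)) = snd T2 (u', v' * (u' - 1 / 4))"
        using eq by (simp add: zw snd_H)
      then have "(u, v * (u - 1 / 4)) = (u', v' * (u' - 1 / 4))"
        by (intro inj_onD[OF local_coordinates_inj[OF S9_charts(6)]]) (use False in auto)
      then show ?thesis using False by (auto simp: zw)
    qed
  qed
  have "local_coordinates S9 (UNIV, snd H)"
  proof (rule local_coordinates_patch[OF S9 inj])
    fix z :: c2
    have "z \<in> ?U1 \<or> z \<in> ?U2" by auto
    then show "\<exists>U. z \<in> U \<and> U \<subseteq> UNIV \<and> local_coordinates S9 (U, snd H)"
    proof
      assume "z \<in> ?U1" with 1 show ?thesis by (intro exI[of _ ?U1] conjI subset_UNIV)
    next
      assume "z \<in> ?U2" with 2 show ?thesis by (intro exI[of _ ?U2] conjI subset_UNIV)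
    qed
  qed
  then show ?thesis by (simp add: H_def)
qed

text \<open>The factor (4 - z) / 4 vanishes only at z = 4, the position of \<open>f3\<close>. It is
  normalised so that the gluing with \<open>H\<close> becomes exactly (1/z, z^2 w).\<close>

lemma local_coordinates_H_inf: "local_coordinates S9 H_inf"
  unfolding H_inf_def
proof (rule local_coordinates_reparam[OF S9 S9_charts(7)])
  show "open {z :: c2. fst z \<noteq> 4}" "open {z :: c2. snd z \<noteq> 4}"
    by (intro open_Collect_neq continuous_intros)+
  show "{z :: c2. snd z \<noteq> 4} \<subseteq> fst R2'" by auto
  fix z :: c2 assume "z \<in> {z. fst z \<noteq> 4}"
  moreover obtain u v where z: "z = (u, v)" by (cases z)
  ultimately have u: "4 - u \<noteq> 0" by simp
  have "cdifferentiable_at (\<lambda>z. (snd z * (4 - fst z) / 4, fst z)) z" by (intro cdiff_intros) simp_all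
  then show "cdifferentiable_at (\<lambda>z. (snd z * (4 - fst z) / 4, fst z)) z \<and>
      (snd z * (4 - fst z) / 4, fst z) \<in> {z. snd z \<noteq> 4} \<and>
      (\<lambda>z. (snd z, 4 * fst z / (4 - snd z))) (snd z * (4 - fst z) / 4, fst z) = z \<and>
      (case z of (z, w) \<Rightarrow> snd R2 (w * (4 - z) / 4, z)) = snd R2' (snd z * (4 - fst z) / 4, fst z)"
    using u by (simp add: z)
next
  fix z :: c2 assume "z \<in> {z. snd z \<noteq> 4}"
  moreover obtain u v where z: "z = (u, v)" by (cases z)
  ultimately have v: "4 - v \<noteq> 0" by simp
  have "cdifferentiable_at (\<lambda>z. (snd z, 4 * fst z / (4 - snd z))) z"
    by (intro cdiff_intros) (use v in \<open>simp_all add: z\<close>)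
  then show "cdifferentiable_at (\<lambda>z. (snd z, 4 * fst z / (4 - snd z))) z \<and>
      (snd z, 4 * fst z / (4 - snd z)) \<in> {z. fst z \<noteq> 4} \<and>
      (\<lambda>z. (snd z * (4 - fst z) / 4, fst z)) (snd z, 4 * fst z / (4 - snd z)) = z"
    using v by (simp add: z)
qed

text \<open>An exceptional curve that is blown up at one further point, hence -1 - 1. This settles
  five of the eight curves.\<close>

lemma minus_two_curve_bl2:
  assumes S: "compatible_atlas S" and c: "(0, 0) \<in> fst c"
    and lc: "local_coordinates S (bl2 c)" "local_coordinates S (bl2 (bl1 c))"
  shows "minus_two_curve S (bl2 c) (swap_chart (bl2 (bl1 c)))"
proof
  show "(z, 0) \<in> fst (bl2 c)" for z using c by (simp add: fst_bl2)
  show "(0, 0) \<in> fst (swap_chart (bl2 (bl1 c)))" using c by (simp add: fst_bl1 fst_bl2)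
  fix z w assume "(z, w) \<in> fst (swap_chart (bl2 (bl1 c)))" "z \<noteq> 0"
  then show "(1 / z, z\<^sup>2 * w) \<in> fst (bl2 c) \<and>
      snd (swap_chart (bl2 (bl1 c))) (z, w) = snd (bl2 c) (1 / z, z\<^sup>2 * w)"
    by (auto simp: fst_bl1 fst_bl2 bl2_bl1 power2_eq_square ac_simps)
qed (use S lc in \<open>simp_all add: local_coordinates_swap_chart\<close>)

lemma minus_two_0: "minus_two_curve S9 P2 (swap_chart P3)"
  and minus_two_1: "minus_two_curve S9 P1 (swap_chart P2)"
  by (rule minus_two_curve_bl2[OF S9 _ S9_charts(11,10)] minus_two_curve_bl2[OF S9 _ S9_charts(12,11)]; simp)+

lemma minus_two_4: "minus_two_curve S9 P4 (swap_chart P5)"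
  and minus_two_5: "minus_two_curve S9 P5 (swap_chart P6)"
  and minus_two_6: "minus_two_curve S9 P6 (swap_chart P7)"
  by (rule minus_two_curve_bl2[OF S9 _ S9_charts(5,4)] minus_two_curve_bl2[OF S9 _ S9_charts(4,3)]
      minus_two_curve_bl2[OF S9 _ S9_charts(3,2)]; simp add: fst_bl1 fst_V0)+

text \<open>The line at infinity: its self-intersection 1 drops by one at each of the centres
  \<open>e1\<close>, \<open>f1\<close> and \<open>f2\<close>. Along it the coordinates are x / y in
  \<open>P1\<close> and y / x in \<open>T2'\<close>.\<close>

lemma minus_two_2: "minus_two_curve S9 (swap_chart P1) (swap_chart T2')"
proof
  fix z w :: complex assume "z \<noteq> 0"
  then have "snd T2 (w, z) = snd P1 (z\<^sup>2 * w, 1 / z)"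
    unfolding snd_bl2[of Z3] snd_T2 snd_Z by (simp add: line3_23 power2_eq_square)
  then show "(1 / z, z\<^sup>2 * w) \<in> fst (swap_chart P1) \<and>
      snd (swap_chart T2') (z, w) = snd (swap_chart P1) (1 / z, z\<^sup>2 * w)"
    by simp
qed (use S9 S9_charts in \<open>simp_all add: local_coordinates_swap_chart\<close>)

lemma minus_two_3: "minus_two_curve S9 H H_inf"
proof
  show "(0, 0) \<in> fst H_inf" by (simp add: H_inf_def)
  fix z w assume zw: "(z, w) \<in> fst H_inf" "z \<noteq> 0"
  then have z4: "1 / z \<noteq> 1 / 4" by (simp add: H_inf_def)
  have "snd R2 (w * (4 - z) / 4, z) = snd T2 (1 / z, w * (4 - z) / 4 * z)"
    by (rule bl1_as_bl2[OF zw(2)])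
  also have "w * (4 - z) / 4 * z = z\<^sup>2 * w * (1 / z - 1 / 4)"
    using zw(2) by (simp add: field_simps power2_eq_square)
  also have "snd T2 (1 / z, z\<^sup>2 * w * (1 / z - 1 / 4)) = snd H (1 / z, z\<^sup>2 * w)"
    unfolding snd_H using z4 by (rule if_not_P[symmetric])
  finally show "(1 / z, z\<^sup>2 * w) \<in> fst H \<and> snd H_inf (z, w) = snd H (1 / z, z\<^sup>2 * w)"
    by (simp add: H_inf_def)
qed (use S9 local_coordinates_H local_coordinates_H_inf in simp_all)

text \<open>The exceptional curve over \<open>f1\<close>, with coordinate y in \<open>R1\<close> and
  1 / y in \<open>R2'\<close>.\<close>

lemma minus_two_7: "minus_two_curve S9 (swap_chart R1) R2'"
proof
  fix z w :: complex assume "z \<noteq> 0"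
  then show "(1 / z, z\<^sup>2 * w) \<in> fst (swap_chart R1) \<and>
      snd R2' (z, w) = snd (swap_chart R1) (1 / z, z\<^sup>2 * w)"
    by (simp add: bl1_bl2)
qed (use S9 S9_charts in \<open>simp_all add: local_coordinates_swap_chart\<close>)

text \<open>Numbered as in \<open>E7_affine\<close>: the proper transforms of the exceptional curves
  over \<open>e2\<close> and \<open>e1\<close>, of the line at infinity, and of the exceptional
  curves over \<open>f2\<close>, \<open>f3\<close>, \<open>f4\<close>, \<open>f5\<close> form the
  chain 0 to 6; the curve over \<open>f1\<close> is the branch 7, attached to the curve over
  \<open>f2\<close>.\<close>

definition boundary :: "nat \<Rightarrow> ipoint set"
  where "boundary i = [minus_two_curve.curve P2 (swap_chart P3), minus_two_curve.curve P1 (swap_chart P2),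
    minus_two_curve.curve (swap_chart P1) (swap_chart T2'), minus_two_curve.curve H H_inf,
    minus_two_curve.curve P4 (swap_chart P5), minus_two_curve.curve P5 (swap_chart P6),
    minus_two_curve.curve P6 (swap_chart P7), minus_two_curve.curve (swap_chart R1) R2'] ! i"

lemma nodes: "{0..7 :: nat} = {0, 1, 2, 3, 4, 5, 6, 7}" by auto

lemma boundary_curves:
  assumes "i \<in> {0..7}"
  shows "smooth_rational_curve S9 (boundary i) \<and> has_self_intersection S9 (boundary i) (-2)"
  using assms minus_two_0 minus_two_1 minus_two_2 minus_two_3 minus_two_4 minus_two_5 minus_two_6
    minus_two_7 unfolding nodes boundary_def
  by (elim insertE emptyE) (simp_all add: minus_two_curve.smooth_rational minus_two_curve.self_intersection)

section \<open>Intersection numbers of the boundary curves\<close>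

lemma centre_distinct:
  "e1 \<noteq> e2" "e1 \<noteq> e3" "e1 \<noteq> f1" "e1 \<noteq> f2" "e1 \<noteq> f3" "e1 \<noteq> f4" "e1 \<noteq> f5" "e1 \<noteq> f6"
  "e2 \<noteq> e3" "e2 \<noteq> f1" "e2 \<noteq> f2" "e2 \<noteq> f3" "e2 \<noteq> f4" "e2 \<noteq> f5" "e2 \<noteq> f6"
  "e3 \<noteq> f1" "e3 \<noteq> f2" "e3 \<noteq> f3" "e3 \<noteq> f4" "e3 \<noteq> f5" "e3 \<noteq> f6"
  "f1 \<noteq> f2" "f1 \<noteq> f3" "f1 \<noteq> f4" "f1 \<noteq> f5" "f1 \<noteq> f6"
  "f2 \<noteq> f3" "f2 \<noteq> f4" "f2 \<noteq> f5" "f2 \<noteq> f6"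
  "f3 \<noteq> f4" "f3 \<noteq> f5" "f3 \<noteq> f6" "f4 \<noteq> f5" "f4 \<noteq> f6" "f5 \<noteq> f6"
  by (simp_all add: centre_defs line3_32 line3_23)

lemmas distinct = centre_distinct centre_distinct[symmetric]

lemma range_if: "range (\<lambda>z. if z = a then b else f z) = insert b (f ` (- {a}))"
  by auto

lemma snd_axis:
  "snd P1 (u, 0) = Exc e1 (line (u, 1))" "snd P2 (u, 0) = Exc e2 (line (u, 1))"
  "snd P3 (u, 0) = Exc e3 (line (u, 1))" "snd P4 (u, 0) = Exc f3 (line (u, 1))"
  "snd P5 (u, 0) = Exc f4 (line (u, 1))" "snd P6 (u, 0) = Exc f5 (line (u, 1))"
  "snd P7 (u, 0) = Exc f6 (line (u, 1))" "snd R1 (0, v) = Exc f1 (line (1, v))"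
  "snd R2 (0, v) = Exc f2 (line (1, v))" "snd H_inf (0, 0) = Exc f2 (line (1, 0))"
  by (simp_all add: H_inf_def snd_bl2[of Z3] snd_bl2[of Q1] snd_bl2[of Q2] snd_bl2[of V0] snd_bl2[of Q4]
      snd_bl2[of Q5] snd_bl2[of Q6] snd_bl1[of Z2] snd_bl1[of T1] centres)

lemma snd_P1: "snd P1 (0, v) = (if v = 0 then Exc e1 (line (0, 1)) else Plane (line (0, v, 1)))"
  unfolding snd_bl2[of Z3] centres by (simp add: snd_Z)

lemma snd_H_axis: "snd H (z, 0) = (if z = 1 / 4 then Exc f3 (line (0, 1)) else Exc f2 (line (z, 1)))"
  by (simp add: snd_H snd_T2)

lemmas curve_defs =
  minus_two_curve.curve_def[OF minus_two_0] minus_two_curve.curve_def[OF minus_two_1]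
  minus_two_curve.curve_def[OF minus_two_2] minus_two_curve.curve_def[OF minus_two_3]
  minus_two_curve.curve_def[OF minus_two_4] minus_two_curve.curve_def[OF minus_two_5]
  minus_two_curve.curve_def[OF minus_two_6] minus_two_curve.curve_def[OF minus_two_7]

text \<open>Listing the points of each curve as terms reduces all intersections to comparing centres
  and lines.\<close>

lemma boundary_eqs:
  "boundary 0 = insert (Exc e3 (line (0, 1))) (range (\<lambda>u. Exc e2 (line (u, 1))))"
  "boundary (Suc 0) = insert (Exc e2 (line (0, 1))) (range (\<lambda>u. Exc e1 (line (u, 1))))"
  "boundary 2 = insert (Exc f2 (line (0, 1)))
    (insert (Exc e1 (line (0, 1))) ((\<lambda>z. Plane (line (0, z, 1))) ` (- {0})))"
  "boundary 3 = insert (Exc f2 (line (1, 0)))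
    (insert (Exc f3 (line (0, 1))) ((\<lambda>z. Exc f2 (line (z, 1))) ` (- {1 / 4})))"
  "boundary 4 = insert (Exc f4 (line (0, 1))) (range (\<lambda>u. Exc f3 (line (u, 1))))"
  "boundary 5 = insert (Exc f5 (line (0, 1))) (range (\<lambda>u. Exc f4 (line (u, 1))))"
  "boundary 6 = insert (Exc f6 (line (0, 1))) (range (\<lambda>u. Exc f5 (line (u, 1))))"
  "boundary 7 = insert (Exc f2 (line (1, 0))) (range (\<lambda>v. Exc f1 (line (1, v))))"
  unfolding range_if[symmetric] snd_H_axis[symmetric]
  by (simp_all add: boundary_def curve_defs snd_axis snd_P1 snd_T2)

lemma adapted_boundary:
  "P2 \<in> adapted S9 (boundary 0)" "P1 \<in> adapted S9 (boundary 1)" "swap_chart P2 \<in> adapted S9 (boundary 1)"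
  "swap_chart P1 \<in> adapted S9 (boundary 2)" "swap_chart T2' \<in> adapted S9 (boundary 2)"
  "H \<in> adapted S9 (boundary 3)" "H_inf \<in> adapted S9 (boundary 3)"
  "P4 \<in> adapted S9 (boundary 4)" "swap_chart P5 \<in> adapted S9 (boundary 4)"
  "P5 \<in> adapted S9 (boundary 5)" "swap_chart P6 \<in> adapted S9 (boundary 5)"
  "P6 \<in> adapted S9 (boundary 6)" "R2' \<in> adapted S9 (boundary 7)"
  using minus_two_curve.adapted0[OF minus_two_0] minus_two_curve.adapted0[OF minus_two_1]
    minus_two_curve.adapted0[OF minus_two_2] minus_two_curve.adapted0[OF minus_two_3]
    minus_two_curve.adapted0[OF minus_two_4] minus_two_curve.adapted0[OF minus_two_5]
    minus_two_curve.adapted0[OF minus_two_6] minus_two_curve.adapted1[OF minus_two_1]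
    minus_two_curve.adapted1[OF minus_two_2] minus_two_curve.adapted1[OF minus_two_3]
    minus_two_curve.adapted1[OF minus_two_4] minus_two_curve.adapted1[OF minus_two_5]
    minus_two_curve.adapted1[OF minus_two_7]
  by (simp_all add: boundary_def)

text \<open>Two curves that are the coordinate axes of one chart cross transversally at its origin,
  and swapping the coordinates exchanges their roles.\<close>

lemma has_intersection_number_swap:
  assumes c: "c \<in> adapted S C" "swap_chart c \<in> adapted S D" and CD: "C \<inter> D = {snd c (0, 0)}"
    and "(0, 0) \<in> fst c"
  shows "has_intersection_number S C D 1 \<and> has_intersection_number S D C 1"
proof
  have op: "open (fst c)" using c(1) by (auto simp: adapted_iff intro: local_coordinates_open)
  have 0: "\<forall>\<^sub>F z in nhds (0, 0). z \<in> fst c" by (rule eventually_nhds_in_open[OF op assms(4)])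
  have "cdifferentiable_at (\<lambda>z. (z, 0 :: complex)) (0 :: complex)"
    "cdifferentiable_at (\<lambda>z. (0 :: complex, z)) (0 :: complex)" by (intro cdiff_intros)+
  from cdiff_eventually[OF this(1) 0] cdiff_eventually[OF this(2) 0]
  have ev: "\<forall>\<^sub>F z in nhds 0. (z, 0) \<in> fst c" "\<forall>\<^sub>F z in nhds 0. (0, z) \<in> fst c" .
  show "has_intersection_number S C D 1"
    by (rule has_intersection_number_1[OF c, where a = 0 and b = 0 and \<kappa> = 1])
      (use CD ev(1) in simp_all)
  have "D \<inter> C = {snd (swap_chart c) (0, 0)}" using CD by auto
  then show "has_intersection_number S D C 1"
    by (rule has_intersection_number_1[OF c(2,1), where a = 0 and b = 0 and \<kappa> = 1])
      (use ev(2) in simp_all)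
qed

lemma ev_neq: "a \<noteq> b \<Longrightarrow> \<forall>\<^sub>F z in nhds a. z \<noteq> (b :: complex)"
  by (rule cdiff_eventually_neq[OF cdiff_ident])

lemma Exc_image_disjoint:
  "p \<noteq> q \<Longrightarrow> (\<lambda>u. Exc p (f u)) ` X \<inter> (\<lambda>u. Exc q (g u)) ` Y = {}"
  "(\<lambda>u. Exc p (f u)) ` X \<inter> (\<lambda>u. Plane (h u)) ` Z = {}"
  "(\<lambda>u. Plane (h u)) ` Z \<inter> (\<lambda>u. Exc p (f u)) ` X = {}"
  by auto

lemmas boundary_Int_simps =
  Int_insert_left Int_insert_right image_iff Exc_image_disjoint distinct line2_eq_iff

lemma boundary_Int:
  "boundary 0 \<inter> boundary (Suc 0) = {Exc e2 (line (0, 1))}"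
  "boundary (Suc 0) \<inter> boundary 2 = {Exc e1 (line (0, 1))}"
  "boundary 2 \<inter> boundary 3 = {Exc f2 (line (0, 1))}"
  "boundary 3 \<inter> boundary 4 = {Exc f3 (line (0, 1))}"
  "boundary 4 \<inter> boundary 5 = {Exc f4 (line (0, 1))}"
  "boundary 5 \<inter> boundary 6 = {Exc f5 (line (0, 1))}"
  "boundary 3 \<inter> boundary 7 = {Exc f2 (line (1, 0))}"
  unfolding boundary_eqs by (simp_all add: boundary_Int_simps)

lemma boundary_adjacent:
  "has_intersection_number S9 (boundary 0) (boundary 1) 1 \<and> has_intersection_number S9 (boundary 1) (boundary 0) 1"
  "has_intersection_number S9 (boundary 1) (boundary 2) 1 \<and> has_intersection_number S9 (boundary 2) (boundary 1) 1"
  "has_intersection_number S9 (boundary 4) (boundary 5) 1 \<and> has_intersection_number S9 (boundary 5) (boundary 4) 1"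
  "has_intersection_number S9 (boundary 5) (boundary 6) 1 \<and> has_intersection_number S9 (boundary 6) (boundary 5) 1"
  "has_intersection_number S9 (boundary 2) (boundary 3) 1" "has_intersection_number S9 (boundary 3) (boundary 2) 1"
  "has_intersection_number S9 (boundary 3) (boundary 4) 1" "has_intersection_number S9 (boundary 4) (boundary 3) 1"
  "has_intersection_number S9 (boundary 3) (boundary 7) 1" "has_intersection_number S9 (boundary 7) (boundary 3) 1"
proof -
  show "has_intersection_number S9 (boundary 0) (boundary 1) 1 \<and> has_intersection_number S9 (boundary 1) (boundary 0) 1"
    by (rule has_intersection_number_swap[OF adapted_boundary(1,3)])
      (simp_all add: boundary_Int snd_bl2[of Q1] centres)
  show "has_intersection_number S9 (boundary 1) (boundary 2) 1 \<and> has_intersection_number S9 (boundary 2) (boundary 1) 1"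
    by (rule has_intersection_number_swap[OF adapted_boundary(2,4)])
      (simp_all add: boundary_Int snd_bl2[of Z3] centres)
  show "has_intersection_number S9 (boundary 4) (boundary 5) 1 \<and> has_intersection_number S9 (boundary 5) (boundary 4) 1"
    using has_intersection_number_swap[OF adapted_boundary(10,9)] boundary_Int(5)
    by (simp add: Int_commute snd_bl2[of Q4] centres fst_bl1 fst_bl2 fst_V0)
  show "has_intersection_number S9 (boundary 5) (boundary 6) 1 \<and> has_intersection_number S9 (boundary 6) (boundary 5) 1"
    using has_intersection_number_swap[OF adapted_boundary(12,11)] boundary_Int(6)
    by (simp add: Int_commute snd_bl2[of Q5] centres fst_bl1 fst_bl2 fst_V0)
  \<comment> \<open>At z = 0 the second coordinate of \<open>T2\<close> is w (0 - 1/4), so w is -4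
    times the coordinate along the line at infinity.\<close>
  show "has_intersection_number S9 (boundary 2) (boundary 3) 1"
    by (rule has_intersection_number_1[OF adapted_boundary(5,6), where a = 0 and b = 0 and \<kappa> = "-4"])
      (simp_all add: boundary_Int snd_T2 snd_H)
  have "\<forall>\<^sub>F z in nhds 0. (z, 0) \<in> fst H \<and> (0, 1 * (z - 0)) \<in> fst (swap_chart T2') \<and>
      snd H (z, 0) = snd (swap_chart T2') (0, 1 * (z - 0))"
    using ev_neq[of 0 "1 / 4"] by (rule eventually_mono) (simp_all add: snd_H)
  then show "has_intersection_number S9 (boundary 3) (boundary 2) 1"
    by (rule has_intersection_number_1[OF adapted_boundary(6,5), rotated 2])
      (use boundary_Int(3) in \<open>simp_all add: snd_T2 snd_H Int_commute\<close>)
  have "\<forall>\<^sub>F z in nhds (1 / 4). (z, 0) \<in> fst H \<and> (0, 1 * (z - 1 / 4)) \<in> fst P4 \<and>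
      snd H (z, 0) = snd P4 (0, 1 * (z - 1 / 4))"
    using ev_neq[of "1 / 4" 0] by (rule eventually_mono) (simp_all add: H_eq_P4 fst_bl2 fst_V0)
  then show "has_intersection_number S9 (boundary 3) (boundary 4) 1"
    by (rule has_intersection_number_1[OF adapted_boundary(6,8), rotated 2])
      (use boundary_Int(4) in \<open>simp_all add: snd_H\<close>)
  \<comment> \<open>On z = 1/4 the chart \<open>H\<close> uses the direction
    \<open>line (w / 4, 1)\<close>, so the coordinate u of \<open>P4\<close> corresponds to w = 4
    u.\<close>
  show "has_intersection_number S9 (boundary 4) (boundary 3) 1"
    by (rule has_intersection_number_1[OF adapted_boundary(8,6), where a = 0 and b = "1 / 4" and \<kappa> = 4])
      (use boundary_Int(4) in \<open>simp_all add: snd_P4 snd_H fst_bl2 fst_V0 Int_commute\<close>)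
  have R2: "snd R2 (0, 0) = Exc f2 (line (1, 0))" by (simp add: snd_bl1[of T1] centres)
  have "\<forall>\<^sub>F z in nhds 0. (z, 0) \<in> fst H_inf \<and> (0, 1 * (z - 0)) \<in> fst R2' \<and>
      snd H_inf (z, 0) = snd R2' (0, 1 * (z - 0))"
    using ev_neq[of 0 4] by (rule eventually_mono) (simp_all add: H_inf_def)
  then show "has_intersection_number S9 (boundary 3) (boundary 7) 1"
    by (rule has_intersection_number_1[OF adapted_boundary(7,13), rotated 2])
      (use boundary_Int(7) in \<open>simp_all add: H_inf_def R2\<close>)
  show "has_intersection_number S9 (boundary 7) (boundary 3) 1"
    by (rule has_intersection_number_1[OF adapted_boundary(13,7), where a = 0 and b = 0 and \<kappa> = 1])
      (use boundary_Int(7) in \<open>simp_all add: R2 H_inf_def Int_commute\<close>)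
qed

lemma boundary_disjoint:
  "boundary 0 \<inter> boundary 2 = {}" "boundary 0 \<inter> boundary 3 = {}" "boundary 0 \<inter> boundary 4 = {}"
  "boundary 0 \<inter> boundary 5 = {}" "boundary 0 \<inter> boundary 6 = {}" "boundary 0 \<inter> boundary 7 = {}"
  "boundary 1 \<inter> boundary 3 = {}" "boundary 1 \<inter> boundary 4 = {}"
  "boundary 1 \<inter> boundary 5 = {}" "boundary 1 \<inter> boundary 6 = {}" "boundary 1 \<inter> boundary 7 = {}"
  "boundary 2 \<inter> boundary 4 = {}" "boundary 2 \<inter> boundary 5 = {}" "boundary 2 \<inter> boundary 6 = {}"
  "boundary 2 \<inter> boundary 7 = {}" "boundary 3 \<inter> boundary 5 = {}" "boundary 3 \<inter> boundary 6 = {}"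
  "boundary 4 \<inter> boundary 6 = {}" "boundary 4 \<inter> boundary 7 = {}"
  "boundary 5 \<inter> boundary 7 = {}" "boundary 6 \<inter> boundary 7 = {}"
  unfolding boundary_eqs One_nat_def by (simp_all add: boundary_Int_simps)

lemma has_intersection_number_0_sym: "C \<inter> D = {} \<Longrightarrow> has_intersection_number S D C 0"
  by (rule has_intersection_number_0) (simp add: Int_commute)

lemmas boundary_intersections =
  boundary_adjacent[unfolded One_nat_def]
  boundary_disjoint[unfolded One_nat_def, THEN has_intersection_number_0]
  boundary_disjoint[unfolded One_nat_def, THEN has_intersection_number_0_sym]

lemma E7_affine_edges:
  "snd E7_affine i j = (if (i, j) \<in> {(0, 1), (1, 0), (1, 2), (2, 1), (2, 3), (3, 2), (3, 4), (4, 3),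
    (4, 5), (5, 4), (5, 6), (6, 5), (3, 7), (7, 3)} then 1 else 0)"
  by (auto simp: E7_affine_def doubleton_eq_iff)

lemma boundary_intersection:
  assumes "i \<in> {0..7}" "j \<in> {0..7}" "i \<noteq> j"
  shows "has_intersection_number S9 (boundary i) (boundary j) (int (snd E7_affine i j))"
proof -
  have i: "i = 0 \<or> i = Suc 0 \<or> i = 2 \<or> i = 3 \<or> i = 4 \<or> i = 5 \<or> i = 6 \<or> i = 7"
    and j: "j = 0 \<or> j = Suc 0 \<or> j = 2 \<or> j = 3 \<or> j = 4 \<or> j = 5 \<or> j = 6 \<or> j = 7"
    using assms(1,2) unfolding nodes by simp_all
  show ?thesis
    using i j assms(3) unfolding E7_affine_edges
    by (elim disjE) (simp_all add: boundary_intersections)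
qed

lemma (in minus_two_curve) infinite_curve: "infinite curve"
proof
  assume "finite curve"
  then have "finite (range (\<lambda>z. snd c0 (z, 0)))" unfolding curve_def by simp
  moreover have "inj (\<lambda>z. snd c0 (z, 0))"
    using inj0[OF axis0 axis0] by (auto intro: injI)
  ultimately show False using finite_imageD infinite_UNIV_char_0 by blast
qed

text \<open>Curves with different indices have finite intersection, while each of them is infinite;
  so they cannot coincide.\<close>

lemma inj_on_boundary: "inj_on boundary {0..7}"
proof (rule inj_onI, rule ccontr)
  fix i j assume ij: "i \<in> {0..7 :: nat}" "j \<in> {0..7}" "boundary i = boundary j" "i \<noteq> j"
  then have "finite (boundary i \<inter> boundary j)"
    using boundary_intersection[OF ij(1,2,4)] by (simp add: has_intersection_number_def)
  then have "finite (boundary i)" using ij(3) by simp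
  moreover have "infinite (boundary i)"
    using ij(1) minus_two_0 minus_two_1 minus_two_2 minus_two_3 minus_two_4 minus_two_5 minus_two_6
      minus_two_7 unfolding nodes boundary_def
    by (elim insertE emptyE) (simp_all add: minus_two_curve.infinite_curve)
  ultimately show False by simp
qed

section \<open>The points of the last surface and the complement of the boundary\<close>

definition exc :: "ipoint \<Rightarrow> ipoint set"
  where "exc p = insert (Exc p (line (0, 1))) (range (\<lambda>v. Exc p (line (1, v))))"

text \<open>Which affine chart of the exceptional curve is convenient depends on which of its points
  is blown up next.\<close>

lemma exc_alt: "exc p = insert (Exc p (line (1, 0))) (range (\<lambda>u. Exc p (line (u, 1))))"
proof (intro subset_antisym subsetI)
  fix q assume "q \<in> exc p"
  then consider "q = Exc p (line (0, 1))" | v where "q = Exc p (line (1, v))" by (auto simp: exc_def)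
  then show "q \<in> insert (Exc p (line (1, 0))) (range (\<lambda>u. Exc p (line (u, 1))))"
  proof cases
    case 2
    have "line (1, v) = line (1 / v, 1)" if "v \<noteq> 0" using that by (simp add: line2_eq_iff)
    with 2 show ?thesis by (cases "v = 0") auto
  qed auto
next
  fix q assume "q \<in> insert (Exc p (line (1, 0))) (range (\<lambda>u. Exc p (line (u, 1))))"
  then consider "q = Exc p (line (1, 0))" | u where "q = Exc p (line (u, 1))" by auto
  then show "q \<in> exc p"
  proof cases
    case 2
    have "line (u, 1) = line (1, 1 / u)" if "u \<noteq> 0" using that by (simp add: line2_eq_iff)
    with 2 show ?thesis by (cases "u = 0") (auto simp: exc_def)
  qed (auto simp: exc_def)
qed

lemma stage_points:
  assumes "stage A (c # cs)" "(0, 0) \<in> fst c"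
  shows "points (blow_up A c) = points A - {snd c (0, 0)} \<union> exc (snd c (0, 0))"
proof -
  interpret blow_up_point A c
    using assms by unfold_locales (simp_all add: stage_def)
  show ?thesis by (auto simp: points_blow_up exc_def)
qed

text \<open>For a centre \<open>p\<close> on the newest exceptional curve \<open>exc q\<close>:
  \<open>B\<close> collects the older points, which do not contain \<open>p\<close>, and
  \<open>C\<close> is \<open>exc q\<close> without \<open>p\<close>.\<close>

lemma stage_points_next:
  assumes "stage A cs" "c \<in> set cs" "(0, 0) \<in> fst c" "snd c (0, 0) = p" "p = Exc q l"
    and "points A = B \<union> exc q" "Exc q l \<notin> B" "exc q - {Exc q l} = C"
  shows "points (blow_up A c) = B \<union> C \<union> exc p"
proof -
  have "stage A [c]" by (rule stage_subset[OF assms(1)]) (use assms(2) in simp)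
  from stage_points[OF this assms(3)] have "points (blow_up A c) = points A - {p} \<union> exc p"
    unfolding assms(4) .
  also have "points A - {p} = B \<union> C"
    unfolding assms(6) Un_Diff using assms(5,7,8) by simp
  finally show ?thesis .
qed

lemma Exc_in_exc: "Exc p l \<in> exc q \<Longrightarrow> p = q"
  by (auto simp: exc_def)

lemma Exc_in_image: "Exc p l \<in> (\<lambda>u. Exc q (f u)) ` X \<longleftrightarrow> p = q \<and> l \<in> f ` X"
  by auto

lemma Plane_notin: "Plane l \<notin> exc q" "Plane l \<notin> (\<lambda>u. Exc q (f u)) ` X"
  by (auto simp: exc_def)

lemma line_notin:
  "line (1 :: complex, 0 :: complex) \<notin> (\<lambda>u. line (u, 1)) ` X"
  "line (0 :: complex, 1 :: complex) \<notin> (\<lambda>v. line (1, v)) ` X"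
  by (simp_all add: image_iff line2_eq_iff)

lemma exc_minus_10: "exc p - {Exc p (line (1, 0))} = range (\<lambda>u. Exc p (line (u, 1)))"
  unfolding exc_alt by (rule Diff_insert_absorb) (simp only: Exc_in_image line_notin simp_thms not_False_eq_True)

lemma exc_minus_01: "exc p - {Exc p (line (0, 1))} = range (\<lambda>v. Exc p (line (1, v)))"
  unfolding exc_def by (rule Diff_insert_absorb) (simp only: Exc_in_image line_notin simp_thms not_False_eq_True)

lemma exc_minus:
  "exc p - {Exc p (line (a, 1))} = insert (Exc p (line (1, 0))) ((\<lambda>u. Exc p (line (u, 1))) ` (- {a}))"
proof -
  let ?f = "\<lambda>u. Exc p (line (u, 1 :: complex))"
  have "inj ?f" by (rule injI) (simp add: line2_eq_iff)
  then have "?f ` (UNIV - {a}) = range ?f - ?f ` {a}" by (rule image_set_diff)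
  then have "range ?f - {?f a} = ?f ` (- {a})" by (simp add: Compl_eq_Diff_UNIV)
  moreover have "line (1, 0 :: complex) \<noteq> line (a, 1)" by (simp add: line2_eq_iff)
  ultimately show ?thesis unfolding exc_alt by (simp add: insert_Diff_if)
qed

text \<open>The future image of the fibre. On the exceptional curves over \<open>e3\<close> and
  \<open>f6\<close> the omitted point has direction \<open>line (0, 1)\<close>; there they meet
  \<open>boundary 0\<close> and \<open>boundary 6\<close>.\<close>

definition inner :: "ipoint set"
  where "inner = range (\<lambda>(a, b). Plane (line (1, a, b))) \<union> range (\<lambda>v. Exc e3 (line (1, v))) \<union>
    range (\<lambda>v. Exc f6 (line (1, v)))"

lemma points_proj_plane_minus: "points proj_plane - {e1} - {f1} =
    range (\<lambda>(a, b). Plane (line (1, a, b))) \<union> (\<lambda>z. Plane (line (0, z, 1))) ` (- {0})"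
proof -
  have "range (\<lambda>b. Plane (line (0 :: complex, 1 :: complex, b))) - {f1} = (\<lambda>z. Plane (line (0, z, 1))) ` (- {0})"
  proof (intro subset_antisym subsetI)
    fix q assume "q \<in> range (\<lambda>b. Plane (line (0 :: complex, 1 :: complex, b))) - {f1}"
    then obtain b where b: "q = Plane (line (0, 1, b))" "b \<noteq> 0" by (auto simp: f1_def)
    then have "line (0 :: complex, 1 :: complex, b) = line (0, 1 / b, 1)" by (simp add: line3_23)
    with b show "q \<in> (\<lambda>z. Plane (line (0, z, 1))) ` (- {0})" by (intro image_eqI[of _ _ "1 / b"]) auto
  next
    fix q assume "q \<in> (\<lambda>z. Plane (line (0 :: complex, z, 1 :: complex))) ` (- {0})"
    then obtain z where z: "q = Plane (line (0, z, 1))" "z \<noteq> 0" by auto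
    then have e: "line (0 :: complex, z, 1) = line (0, 1, 1 / z)" by (simp add: line3_32)
    have "1 / z \<noteq> 0" using z(2) by simp
    then have "q \<noteq> f1" unfolding z(1) e f1_def by simp
    then show "q \<in> range (\<lambda>b. Plane (line (0 :: complex, 1 :: complex, b))) - {f1}"
      unfolding z(1) e by simp
  qed
  moreover have "e1 \<notin> range (\<lambda>(a, b). Plane (line (1, a, b)))" "f1 \<notin> range (\<lambda>(a, b). Plane (line (1, a, b)))"
    by (auto simp: e1_def f1_def line3_eqs)
  moreover have "e1 \<notin> range (\<lambda>b. Plane (line (0 :: complex, 1 :: complex, b)))"
    by (auto simp: e1_def line3_eqs)
  ultimately show ?thesis unfolding points_proj_plane e1_def[symmetric] by blast
qed

lemma points_S9: "points S9 = inner \<union> (\<Union>i\<in>{0..7}. boundary i)"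
proof -
  let ?E1 = "range (\<lambda>u. Exc e1 (line (u, 1)))" and ?E2 = "range (\<lambda>u. Exc e2 (line (u, 1)))"
  let ?F1 = "range (\<lambda>v. Exc f1 (line (1, v)))"
  let ?F2 = "insert (Exc f2 (line (1, 0))) ((\<lambda>u. Exc f2 (line (u, 1))) ` (- {1 / 4}))"
  let ?F3 = "range (\<lambda>u. Exc f3 (line (u, 1)))" and ?F4 = "range (\<lambda>u. Exc f4 (line (u, 1)))"
    and ?F5 = "range (\<lambda>u. Exc f5 (line (u, 1)))"
  let ?P = "points proj_plane - {e1}"
  have PE: "Exc p l \<notin> ?P" for p l unfolding points_proj_plane by auto
  have XE: "Exc p l \<notin> exc q" if "p \<noteq> q" for p q l using that Exc_in_exc by blast
  have PE': "Exc p l \<notin> ?P - {q}" for p q l using PE by blast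
  note N = Un_iff insert_iff Exc_in_image distinct PE PE' XE ipoint.inject simp_thms not_False_eq_True
  have S1: "points S1 = ?P \<union> exc e1"
    using stage_points[OF stage_S0] unfolding S1_def by (simp add: centres)
  have S2: "points S2 = ?P \<union> ?E1 \<union> exc e2"
    unfolding S2_def
    by (rule stage_points_next[OF stage_S1 _ _ _ e2_def S1 _ exc_minus_10], simp, simp, simp only: centres, simp only: N)
  have "points S3 = ?P \<union> ?E1 \<union> ?E2 \<union> exc e3"
    unfolding S3_def
    by (rule stage_points_next[OF stage_S2 _ _ _ e3_def S2 _ exc_minus_10], simp, simp, simp only: centres, simp only: N)
  \<comment> \<open>The next centre \<open>f1\<close> lies in the plane and not on an exceptional
    curve, so the plane part is moved to the end, where the point will be removed.\<close>
  then have S3: "points S3 = ?E1 \<union> ?E2 \<union> exc e3 \<union> ?P" by (simp only: Un_ac)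
  have f1: "f1 \<notin> ?E1 \<union> ?E2 \<union> exc e3" by (simp only: f1_def Un_iff Plane_notin simp_thms not_False_eq_True)
  have "stage S3 [Z2]" by (rule stage_subset[OF stage_S3]) simp
  from stage_points[OF this] have "points S4 = points S3 - {f1} \<union> exc f1"
    unfolding S4_def centres by simp
  then have S4: "points S4 = (?E1 \<union> ?E2 \<union> exc e3 \<union> (?P - {f1})) \<union> exc f1"
    unfolding S3 Un_Diff[of "?E1 \<union> ?E2 \<union> exc e3" ?P] Diff_insert0[OF f1] Diff_empty .
  let ?B = "?E1 \<union> ?E2 \<union> exc e3 \<union> (?P - {f1})"
  have S5: "points S5 = ?B \<union> ?F1 \<union> exc f2"
    unfolding S5_def
    by (rule stage_points_next[OF stage_S4 _ _ _ f2_def S4 _ exc_minus_01], simp, simp, simp only: centres, simp only: N)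
  have S6: "points S6 = ?B \<union> ?F1 \<union> ?F2 \<union> exc f3"
    unfolding S6_def
    by (rule stage_points_next[OF stage_insert[OF stage_S5 local_coordinates_V0] _ _ _ f3_def S5 _ exc_minus],
        simp, simp add: fst_V0, simp only: centres, simp only: N)
  have S7: "points S7 = ?B \<union> ?F1 \<union> ?F2 \<union> ?F3 \<union> exc f4"
    unfolding S7_def
    by (rule stage_points_next[OF stage_S6 _ _ _ f4_def S6 _ exc_minus_10],
        simp, simp add: fst_bl1 fst_V0, simp only: centres, simp only: N)
  have S8: "points S8 = ?B \<union> ?F1 \<union> ?F2 \<union> ?F3 \<union> ?F4 \<union> exc f5"
    unfolding S8_def
    by (rule stage_points_next[OF stage_S7 _ _ _ f5_def S7 _ exc_minus_10],
        simp, simp add: fst_bl1 fst_V0, simp only: centres, simp only: N)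
  have S9: "points S9 = ?B \<union> ?F1 \<union> ?F2 \<union> ?F3 \<union> ?F4 \<union> ?F5 \<union> exc f6"
    unfolding S9_def
    by (rule stage_points_next[OF stage_S8 _ _ _ f6_def S8 _ exc_minus_10],
        simp, simp add: fst_bl1 fst_V0, simp only: centres, simp only: N)
  let ?D = "\<lambda>p. Exc p (line (0, 1))"
  have D: "?D e2 \<in> ?E2" "?D e1 \<in> ?E1" "?D f3 \<in> ?F3" "?D f4 \<in> ?F4" "?D f5 \<in> ?F5"
    by (rule rangeI)+
  have D': "?D f2 \<in> ?F2" by (rule insertI2, rule image_eqI[of _ _ 0]) simp_all
  have bd: "(\<Union>i\<in>{0..7}. boundary i) = boundary 0 \<union> boundary (Suc 0) \<union> boundary 2 \<union> boundary 3 \<union>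
      boundary 4 \<union> boundary 5 \<union> boundary 6 \<union> boundary 7"
    unfolding nodes One_nat_def by (simp only: UN_insert UN_empty Un_empty_right Un_assoc)
  show ?thesis
    unfolding S9 points_proj_plane_minus bd boundary_eqs inner_def exc_def
    using D D' by blast
qed

lemma inner_disjoint: "inner \<inter> (\<Union>i\<in>{0..7}. boundary i) = {}"
proof -
  have "inner \<inter> boundary i = {}" if "i \<in> {0..7}" for i
  proof -
    have Z': "range (\<lambda>x :: c2. Plane (line (1 :: complex, x))) \<inter>
        (\<lambda>z. Plane (line (0 :: complex, z, 1 :: complex))) ` (- {0}) = {}"
      by (auto simp: line3_13 line3_31)
    have P: "range (\<lambda>x :: c2. Plane (line (1 :: complex, x))) \<inter> (\<lambda>u. Exc p (f u)) ` X = {}"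
      "Exc p l \<notin> range (\<lambda>x :: c2. Plane (line (1 :: complex, x)))" for p l and f :: "complex \<Rightarrow> c2 set" and X
      by auto
    have i: "i = 0 \<or> i = Suc 0 \<or> i = 2 \<or> i = 3 \<or> i = 4 \<or> i = 5 \<or> i = 6 \<or> i = 7"
      using that unfolding nodes by simp
    note l = line_notin
    show ?thesis
      using i unfolding inner_def
      by (elim disjE; hypsubst; unfold boundary_eqs)
        (simp_all add: Int_Un_distrib2 Int_insert_right Exc_in_image P Z' l Exc_image_disjoint distinct)
  qed
  then show ?thesis by blast
qed

lemma boundary_complement: "points S9 - inner = (\<Union>i\<in>{0..7}. boundary i)"
  unfolding points_S9 using inner_disjoint by blast

section \<open>The gluing relation\<close>

text \<open>According to \<open>poly2\<close>, the outer variable of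
  \<open>complex poly poly\<close> is y and the inner one is x.\<close>

definition Xp :: "complex poly poly" where "Xp = [:[:0, 1:]:]"
definition Yp :: "complex poly poly" where "Yp = [:0, 1:]"
definition Cp :: "complex \<Rightarrow> complex poly poly" where "Cp c = [:[:c:]:]"

lemma poly2_simps [simp]:
  "poly2 Xp z = fst z" "poly2 Yp z = snd z" "poly2 (Cp c) z = c" "poly2 0 z = 0" "poly2 1 z = 1"
  "poly2 (P + Q) z = poly2 P z + poly2 Q z" "poly2 (P - Q) z = poly2 P z - poly2 Q z"
  "poly2 (P * Q) z = poly2 P z * poly2 Q z" "poly2 (- P) z = - poly2 P z"
  "poly2 (P ^ n) z = poly2 P z ^ n"
  by (simp_all add: poly2_def Xp_def Yp_def Cp_def poly_power)

lemma poly2_pCons: "poly2 (pCons a P) z = poly a (fst z) + snd z * poly2 P z"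
  by (simp add: poly2_def)

lemma poly_cdiff:
  fixes f :: "'m::complex_space \<Rightarrow> complex"
  assumes "cdifferentiable_at f z" shows "cdifferentiable_at (\<lambda>x. poly p (f x)) z"
  by (induction p) (auto intro!: cdiff_intros assms)

lemma poly2_cdiff: "cdifferentiable_at (poly2 P) z"
proof (induction P)
  case (pCons a P)
  have "cdifferentiable_at (\<lambda>z. poly a (fst z) + snd z * poly2 P z) z"
    by (intro cdiff_intros poly_cdiff pCons)
  then show ?case by (simp add: poly2_pCons[abs_def])
qed (simp add: poly2_def cdiff_const)

lemma infinite_open:
  fixes A :: "complex set"
  assumes "open A" "z \<in> A" shows "infinite A"
proof
  assume "finite A"
  obtain r where "r > 0" "ball z r \<subseteq> A" using assms by (rule openE)
  then have "countable (ball z r)"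
    using \<open>finite A\<close> by (meson countable_finite finite_subset)
  then show False using uncountable_ball[OF \<open>r > 0\<close>, of z] by simp
qed

text \<open>An open set contains a product of two infinite sets. First y is chosen off the finitely
  many values that kill the polynomial, then x off the finitely many roots that remain.\<close>

lemma poly2_dense:
  assumes "e \<noteq> 0" "open W" "z \<in> W" shows "\<exists>w\<in>W. poly2 e w \<noteq> 0"
proof -
  obtain A B where AB: "open A" "open B" "z \<in> A \<times> B" "A \<times> B \<subseteq> W"
    using assms(2,3) by (rule open_prod_elim)
  have inf: "infinite A" "infinite B"
    using AB infinite_open[of A "fst z"] infinite_open[of B "snd z"] by auto
  have "finite ((\<lambda>y. [:y:]) -` {c. poly e c = 0})"
    using poly_roots_finite[OF assms(1)] by (intro finite_vimageI injI) auto
  with inf(2) obtain y where y: "y \<in> B" "poly e [:y:] \<noteq> 0"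
    using finite_subset[of B "(\<lambda>y. [:y:]) -` {c. poly e c = 0}"] by auto
  have "finite {x. poly (poly e [:y:]) x = 0}" by (rule poly_roots_finite[OF y(2)])
  with inf(1) obtain x where "x \<in> A" "poly (poly e [:y:]) x \<noteq> 0"
    using finite_subset[of A "{x. poly (poly e [:y:]) x = 0}"] by auto
  then show ?thesis using AB(4) y(1) by (intro bexI[of _ "(x, y)"]) (auto simp: poly2_def)
qed

lemma Yp_nonzero [simp]: "Yp \<noteq> 0" by (simp add: Yp_def)

text \<open>(P - Q) y vanishes everywhere, so it is the zero polynomial. This carries identities
  across the line y = 0, where the formulas for the coordinate changes break down.\<close>

lemma poly2_identity:
  assumes "\<And>w. snd w \<noteq> 0 \<Longrightarrow> poly2 P w = poly2 Q w" shows "poly2 P w = poly2 Q w"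
proof -
  have "P - Q = 0"
  proof (rule ccontr)
    assume "P - Q \<noteq> 0"
    then have "(P - Q) * Yp \<noteq> 0" by simp
    then obtain w where "poly2 ((P - Q) * Yp) w \<noteq> 0" using poly2_dense[of _ UNIV] by blast
    then show False using assms[of w] by auto
  qed
  then show ?thesis by simp
qed

lemma generically_dense:
  assumes "generically P" "open W" "z \<in> W" shows "\<exists>w\<in>W. P w"
  using assms poly2_dense unfolding generically_def by blast

lemma generically_nonzero: "(\<And>z. snd z \<noteq> 0 \<Longrightarrow> P z) \<Longrightarrow> generically P"
  unfolding generically_def by (intro exI[of _ Yp]) auto

section \<open>The rational coordinate changes and where they are biregular\<close>

definition inv_coords :: "nat \<Rightarrow> c2 \<Rightarrow> c2"
  where "inv_coords j = (\<lambda>(x, y). if j = 0 then (x, y)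
    else if j = 1 then (1 / (4 * y\<^sup>2) - x * y\<^sup>2, 1 / y) else (- x * y\<^sup>2, 1 / y))"

definition J :: "nat set" where "J = {0, 1, 2}"

lemma inv_coords_coords: "snd z \<noteq> 0 \<Longrightarrow> inv_coords j (coords j z) = z"
  by (cases z) (simp add: inv_coords_def coords_def field_simps power2_eq_square)

lemma coords_inv_coords: "snd z \<noteq> 0 \<Longrightarrow> coords j (inv_coords j z) = z"
  by (cases z) (simp add: inv_coords_def coords_def field_simps power2_eq_square)

lemma snd_coords: "snd z \<noteq> 0 \<Longrightarrow> snd (coords j z) \<noteq> 0"
  and snd_inv_coords: "snd z \<noteq> 0 \<Longrightarrow> snd (inv_coords j z) \<noteq> 0"
  by (auto simp: inv_coords_def coords_def split: prod.splits)

lemma coords_0: "coords 0 = id" and inv_coords_0: "inv_coords 0 = id"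
  by (auto simp: coords_def inv_coords_def)

lemma coords_cdiff: "snd z \<noteq> 0 \<Longrightarrow> cdifferentiable_at (coords j) z"
  unfolding coords_def case_prod_unfold
  by (cases "j = 0"; cases "j = 1") (auto intro!: cdiff_intros)

lemma inv_coords_cdiff: "snd z \<noteq> 0 \<Longrightarrow> cdifferentiable_at (inv_coords j) z"
  unfolding inv_coords_def case_prod_unfold
  by (cases "j = 0"; cases "j = 1") (auto intro!: cdiff_intros)

text \<open>A triple has one common denominator, here up to a constant a power of y. Between charts
  1 and 2 the relation is x_2 = x_1 - 1 / (4 y^4) with the same y; the change between charts 0 and 2
  is an involution, so one triple serves both ways.\<close>

lemma rational_transition:
  assumes "i \<in> J" "j \<in> J"
  shows "\<exists>R. \<forall>w. snd w \<noteq> 0 \<longrightarrow> regular R w \<and> ratval R w = coords j (inv_coords i w)"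
proof -
  let ?id = "(Xp, Yp, 1)" and ?r01 = "((- Xp * Yp ^ 2 + Cp (1 / 4) * Yp ^ 4) * Yp, 1, Yp)"
    and ?r02 = "(- Xp * Yp ^ 3, 1, Yp)" and ?r10 = "(1 - Cp 4 * Xp * Yp ^ 4, Cp 4 * Yp, Cp 4 * Yp ^ 2)"
    and ?r12 = "(Cp 4 * Xp * Yp ^ 4 - 1, Cp 4 * Yp ^ 5, Cp 4 * Yp ^ 4)"
    and ?r21 = "(Cp 4 * Xp * Yp ^ 4 + 1, Cp 4 * Yp ^ 5, Cp 4 * Yp ^ 4)"
  consider "i = j" | "i = 0" "j = 1" | "i = 0" "j = 2" | "i = 1" "j = 0" | "i = 2" "j = 0"
    | "i = 1" "j = 2" | "i = 2" "j = 1"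
    using assms unfolding J_def by blast
  then show ?thesis
  proof cases
    case 1
    then show ?thesis
      by (intro exI[of _ ?id]) (simp add: regular_def ratval_def coords_inv_coords)
  next
    case 2
    then show ?thesis by (intro exI[of _ ?r01])
      (auto simp: regular_def ratval_def coords_def inv_coords_def field_simps eval_nat_numeral)
  next
    case 3
    then show ?thesis by (intro exI[of _ ?r02])
      (auto simp: regular_def ratval_def coords_def inv_coords_def field_simps eval_nat_numeral)
  next
    case 4
    then show ?thesis by (intro exI[of _ ?r10])
      (auto simp: regular_def ratval_def coords_def inv_coords_def field_simps eval_nat_numeral)
  next
    case 5
    then show ?thesis by (intro exI[of _ ?r02])
      (auto simp: regular_def ratval_def coords_def inv_coords_def field_simps eval_nat_numeral)
  next
    case 6
    then show ?thesis by (intro exI[of _ ?r12])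
      (auto simp: regular_def ratval_def coords_def inv_coords_def field_simps eval_nat_numeral)
  next
    case 7
    then show ?thesis by (intro exI[of _ ?r21])
      (auto simp: regular_def ratval_def coords_def inv_coords_def field_simps eval_nat_numeral)
  qed
qed

lemma biregular_atI:
  assumes ij: "i \<in> J" "j \<in> J" and pq: "snd p \<noteq> 0" "snd q \<noteq> 0" "inv_coords i p = inv_coords j q"
  shows "biregular_at (coords i) (coords j) p q"
proof -
  obtain R where R: "\<And>w. snd w \<noteq> 0 \<Longrightarrow> regular R w \<and> ratval R w = coords j (inv_coords i w)"
    using rational_transition[OF ij] by blast
  obtain R' where R': "\<And>w. snd w \<noteq> 0 \<Longrightarrow> regular R' w \<and> ratval R' w = coords i (inv_coords j w)"
    using rational_transition[OF ij(2,1)] by blast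
  have "regular R p \<and> ratval R p = q" "regular R' q \<and> ratval R' q = p"
    using R[OF pq(1)] R'[OF pq(2)] pq coords_inv_coords[OF pq(1)] coords_inv_coords[OF pq(2)] by metis+
  moreover have "generically (\<lambda>z. regular R (coords i z) \<and> ratval R (coords i z) = coords j z)"
    "generically (\<lambda>z. regular R' (coords j z) \<and> ratval R' (coords j z) = coords i z)"
    by (rule generically_nonzero; use R[OF snd_coords] R'[OF snd_coords] in \<open>simp add: inv_coords_coords\<close>)+
  ultimately show ?thesis unfolding biregular_at_def by blast
qed

lemma biregular_at_refl:
  assumes "i \<in> J" shows "biregular_at (coords i) (coords i) p p"
proof -
  have "regular (Xp, Yp, 1) z" "ratval (Xp, Yp, 1) z = z" for z
    by (simp_all add: regular_def ratval_def)
  then show ?thesis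
    unfolding biregular_at_def
    by (intro exI[of _ "(Xp, Yp, 1)"]) (auto intro!: generically_nonzero)
qed

text \<open>A rational representative of a coordinate change satisfies the defining identities wherever
  these make sense, since the points that \<open>coords i\<close> maps to generic points are dense.\<close>

lemma representative_identity:
  assumes g: "generically (\<lambda>z. regular (a, b, d) (coords i z) \<and> ratval (a, b, d) (coords i z) = coords j z)"
    and w: "snd w \<noteq> 0"
  shows "poly2 a w = poly2 d w * fst (coords j (inv_coords i w))"
    "poly2 b w = poly2 d w * snd (coords j (inv_coords i w))"
proof -
  define T where "T w = coords j (inv_coords i w)" for w
  define G where "G w = (poly2 a w - poly2 d w * fst (T w), poly2 b w - poly2 d w * snd (T w))" for w
  have "G w = (0, 0)"
  proof (rule ccontr)
    assume "G w \<noteq> (0, 0)"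
    have T: "cdifferentiable_at T w"
      unfolding T_def by (rule cdiff_compose[OF inv_coords_cdiff[OF w] coords_cdiff[OF snd_inv_coords[OF w]]])
    have G: "cdifferentiable_at G w"
      unfolding G_def by (intro cdiff_intros poly2_cdiff T)
    let ?z = "inv_coords i w"
    have z: "snd ?z \<noteq> 0" "coords i ?z = w" using w by (simp_all add: snd_inv_coords coords_inv_coords)
    have "cdifferentiable_at (\<lambda>z. G (coords i z)) ?z"
      using cdiff_compose[OF coords_cdiff[OF z(1)], of G] G by (simp add: z(2))
    then have "\<forall>\<^sub>F z in nhds ?z. G (coords i z) \<noteq> (0, 0)"
      by (rule cdiff_eventually_neq) (simp add: z(2) \<open>G w \<noteq> (0, 0)\<close>)
    moreover have "\<forall>\<^sub>F z in nhds ?z. snd z \<noteq> 0"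
      by (rule cdiff_eventually_neq[OF cdiff_snd[OF cdiff_ident] z(1)])
    ultimately have "\<forall>\<^sub>F z in nhds ?z. G (coords i z) \<noteq> (0, 0) \<and> snd z \<noteq> 0"
      by (rule eventually_conj)
    then obtain W where W: "open W" "?z \<in> W" "\<And>z. z \<in> W \<Longrightarrow> G (coords i z) \<noteq> (0, 0) \<and> snd z \<noteq> 0"
      unfolding eventually_nhds by blast
    obtain y where y: "y \<in> W" "regular (a, b, d) (coords i y)" "ratval (a, b, d) (coords i y) = coords j y"
      using generically_dense[OF g W(1,2)] by blast
    have "T (coords i y) = coords j y" using W(3)[OF y(1)] by (simp add: T_def inv_coords_coords)
    then have "G (coords i y) = (0, 0)"
      using y(2,3) by (auto simp: G_def regular_def ratval_def prod_eq_iff field_simps)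
    then show False using W(3)[OF y(1)] by blast
  qed
  then show "poly2 a w = poly2 d w * fst (coords j (inv_coords i w))"
    "poly2 b w = poly2 d w * snd (coords j (inv_coords i w))"
    by (simp_all add: G_def T_def)
qed

text \<open>A representative may differ from the given formula, but multiplied out it satisfies the
  same polynomial identities, also on y = 0. There the pole of the coordinate change forces its
  denominator to vanish, against regularity.\<close>

lemma biregular_atD:
  assumes ij: "i \<in> J" "j \<in> J" and b: "biregular_at (coords i) (coords j) p q"
  shows "i = j \<and> p = q \<or> i \<noteq> j \<and> snd p \<noteq> 0 \<and> snd q \<noteq> 0 \<and> inv_coords i p = inv_coords j q"
proof -
  obtain a b d where R: "regular (a, b, d) p" "ratval (a, b, d) p = q"
    and g: "generically (\<lambda>z. regular (a, b, d) (coords i z) \<and> ratval (a, b, d) (coords i z) = coords j z)"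
    using b unfolding biregular_at_def by auto
  have d: "poly2 d p \<noteq> 0" using R(1) by (simp add: regular_def)
  note id = representative_identity[OF g]
  show ?thesis
  proof (cases "i = j")
    case True
    have "poly2 a p = poly2 (d * Xp) p"
      by (rule poly2_identity) (use id(1) in \<open>simp add: True coords_inv_coords\<close>)
    moreover have "poly2 b p = poly2 (d * Yp) p"
      by (rule poly2_identity) (use id(2) in \<open>simp add: True coords_inv_coords\<close>)
    ultimately show ?thesis using R(2) d True by (auto simp: ratval_def prod_eq_iff)
  next
    case False
    have p: "snd p \<noteq> 0"
    proof
      assume p0: "snd p = 0"
      consider "i = 0 \<or> j = 0" | "i = 1" "j = 2" | "i = 2" "j = 1"
        using ij False unfolding J_def by blast
      then have "poly2 d p = 0"
      proof cases
        case 1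
        \<comment> \<open>If one of the charts is chart 0, the second component of the change is 1 /
          y.\<close>
        have "poly2 (b * Yp) w = poly2 d w" if "snd w \<noteq> 0" for w
          using id(2)[OF that] that 1 ij False
          by (cases w) (auto simp: J_def coords_def inv_coords_def field_simps)
        then have "poly2 (b * Yp) p = poly2 d p" by (rule poly2_identity)
        then show ?thesis using p0 by simp
      next
        case 2
        \<comment> \<open>Between charts 1 and 2 the second coordinate is unchanged, so the pole has
          to be found in the first component x - 1 / (4 y^4).\<close>
        have "poly2 (a * (Cp 4 * Yp ^ 4)) w = poly2 (d * (Cp 4 * Xp * Yp ^ 4 - 1)) w" if "snd w \<noteq> 0" for w
          using id(1)[OF that] that 2
          by (cases w) (auto simp: coords_def inv_coords_def field_simps eval_nat_numeral)
        then have "poly2 (a * (Cp 4 * Yp ^ 4)) p = poly2 (d * (Cp 4 * Xp * Yp ^ 4 - 1)) p"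
          by (rule poly2_identity)
        then show ?thesis using p0 by simp
      next
        case 3
        have "poly2 (a * (Cp 4 * Yp ^ 4)) w = poly2 (d * (Cp 4 * Xp * Yp ^ 4 + 1)) w" if "snd w \<noteq> 0" for w
          using id(1)[OF that] that 3
          by (cases w) (auto simp: coords_def inv_coords_def field_simps eval_nat_numeral)
        then have "poly2 (a * (Cp 4 * Yp ^ 4)) p = poly2 (d * (Cp 4 * Xp * Yp ^ 4 + 1)) p"
          by (rule poly2_identity)
        then show ?thesis using p0 by simp
      qed
      then show False using d by simp
    qed
    have "q = coords j (inv_coords i p)"
      using R(2) id[OF p] d by (auto simp: ratval_def prod_eq_iff)
    moreover have "snd (inv_coords i p) \<noteq> 0" using p by (rule snd_inv_coords)
    ultimately show ?thesis using False p by (simp add: snd_coords inv_coords_coords)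
  qed
qed

lemma biregular_at_iff:
  assumes "i \<in> J" "j \<in> J"
  shows "biregular_at (coords i) (coords j) p q \<longleftrightarrow>
    i = j \<and> p = q \<or> snd p \<noteq> 0 \<and> snd q \<noteq> 0 \<and> inv_coords i p = inv_coords j q"
  using biregular_atD[OF assms] biregular_atI[OF assms] biregular_at_refl[OF assms(1)] by blast

section \<open>The fibres as open subsets of the surface\<close>

text \<open>The coordinates of the final charts \<open>Q7\<close> and \<open>Q3\<close> are (y_1,
  -x_1) and (y_2, -x_2): the last one is (x - y^2 / 4) y^2, respectively x y^2. Hence the exchange
  and the sign.\<close>

definition fibre_chart :: "nat \<Rightarrow> c2 \<Rightarrow> ipoint"
  where "fibre_chart j p = (if j = 0 then snd Z1 p
    else if j = 1 then snd Q7 (snd p, - fst p) else snd Q3 (snd p, - fst p))"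

lemma snd_Q3: "snd Q3 (u, v) = (if u = 0 then Exc e3 (line (1, v)) else Plane (line (1, u\<^sup>2 * v, 1 / u)))"
  unfolding snd_bl1[of Q2] centres
  by (simp add: snd_bl1 snd_Z line3_31 power2_eq_square)

lemma snd_Q7: "snd Q7 (u, v) = (if u = 0 then Exc f6 (line (1, v))
    else Plane (line (1, u\<^sup>2 * v + 1 / (4 * u\<^sup>2), 1 / u)))"
  unfolding snd_bl1[of Q6] centres
  by (simp add: snd_bl1 snd_V0 field_simps power2_eq_square)

lemma fibre_chart_affine:
  assumes "j = 0 \<or> snd p \<noteq> 0" shows "fibre_chart j p = Plane (line (1, inv_coords j p))"
  using assms by (cases p) (auto simp: fibre_chart_def inv_coords_def snd_Z snd_Q3 snd_Q7)

lemma fibre_chart_exceptional: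
  "snd p = 0 \<Longrightarrow> fibre_chart 1 p = Exc f6 (line (1, - fst p))"
  "snd p = 0 \<Longrightarrow> fibre_chart 2 p = Exc e3 (line (1, - fst p))"
  by (simp_all add: fibre_chart_def snd_Q3 snd_Q7)

text \<open>Points with y = 0 in chart 1 or 2 lie on the exceptional curve over \<open>f6\<close> or
  \<open>e3\<close> and meet no other chart. The right-hand side is exactly that of
  \<open>biregular_at_iff\<close>.\<close>

lemma fibre_chart_eq_iff:
  assumes "i \<in> J" "j \<in> J"
  shows "fibre_chart i p = fibre_chart j q \<longleftrightarrow>
    i = j \<and> p = q \<or> snd p \<noteq> 0 \<and> snd q \<noteq> 0 \<and> inv_coords i p = inv_coords j q"
proof -
  have f: "f6 \<noteq> e3" "e3 \<noteq> f6" by (simp_all add: distinct)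
  \<comment> \<open>Points of chart 0 with y = 0 are out of reach of charts 1 and 2, because the
    second component of their inverse is 1 / y.\<close>
  have snd_inv: "snd q \<noteq> 0"
    if "j = 0 \<or> snd q \<noteq> 0" "i \<noteq> 0" "i = 0 \<or> snd p \<noteq> 0" "inv_coords i p = inv_coords j q" for i j p q
  proof (cases "j = 0")
    case True
    then have "q = inv_coords i p" using that(4) by (simp add: inv_coords_0)
    then show ?thesis using that(2,3) snd_inv_coords[of p i] by simp
  qed (use that(1) in simp)
  consider (aff) "i = 0 \<or> snd p \<noteq> 0" "j = 0 \<or> snd q \<noteq> 0"
    | (ea) "i \<noteq> 0" "snd p = 0" "j = 0 \<or> snd q \<noteq> 0" | (ae) "j \<noteq> 0" "snd q = 0" "i = 0 \<or> snd p \<noteq> 0"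
    | (ee) "i \<noteq> 0" "snd p = 0" "j \<noteq> 0" "snd q = 0" by blast
  then show ?thesis
  proof cases
    case aff
    have "fibre_chart i p = fibre_chart j q \<longleftrightarrow> inv_coords i p = inv_coords j q"
      using fibre_chart_affine[OF aff(1)] fibre_chart_affine[OF aff(2)] by simp
    moreover have "inv_coords i p = inv_coords j q \<longleftrightarrow>
        i = j \<and> p = q \<or> snd p \<noteq> 0 \<and> snd q \<noteq> 0 \<and> inv_coords i p = inv_coords j q"
    proof
      assume eq: "inv_coords i p = inv_coords j q"
      consider "i = 0" "j = 0" | "i \<noteq> 0" | "j \<noteq> 0" by blast
      then show "i = j \<and> p = q \<or> snd p \<noteq> 0 \<and> snd q \<noteq> 0 \<and> inv_coords i p = inv_coords j q"
      proof cases
        case 1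
        then show ?thesis using eq by (simp add: inv_coords_0)
      next
        case 2
        then show ?thesis using snd_inv[OF aff(2) 2 aff(1) eq] aff(1) eq by simp
      next
        case 3
        then show ?thesis using snd_inv[OF aff(1) 3 aff(2) eq[symmetric]] aff(2) eq by simp
      qed
    qed auto
    ultimately show ?thesis by blast
  next
    case ea
    then have "i = 1 \<or> i = 2" using assms(1) by (auto simp: J_def)
    then show ?thesis using ea fibre_chart_exceptional[OF ea(2)] fibre_chart_affine[OF ea(3)] by auto
  next
    case ae
    then have "j = 1 \<or> j = 2" using assms(2) by (auto simp: J_def)
    then show ?thesis using ae fibre_chart_exceptional[OF ae(2)] fibre_chart_affine[OF ae(3)] by auto
  next
    case ee
    then have "i = 1 \<or> i = 2" "j = 1 \<or> j = 2" using assms by (auto simp: J_def)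
    then show ?thesis
      using ee f fibre_chart_exceptional[OF ee(2)] fibre_chart_exceptional[OF ee(4)]
      by (auto simp: prod_eq_iff)
  qed
qed

lemma glue_iff: "((i, p, s), (j, q, t)) \<in> glue J coords \<longleftrightarrow>
    i \<in> J \<and> j \<in> J \<and> s = t \<and> fibre_chart i p = fibre_chart j q"
proof -
  have "((i, p, s), (j, q, t)) \<in> glue J coords \<longleftrightarrow>
      i \<in> J \<and> j \<in> J \<and> s = t \<and> biregular_at (coords i) (coords j) p q"
    by (simp add: glue_def)
  then show ?thesis
    using fibre_chart_eq_iff[of i j p q] biregular_at_iff[of i j p q]
    by (cases "i \<in> J"; cases "j \<in> J"; simp only: simp_thms)
qed

text \<open>The relation is the kernel of the map to time and point of the surface, which makes
  transitivity automatic.\<close>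

lemma equiv_glue: "equiv (J \<times> UNIV) (glue J coords)"
proof -
  define key where "key x = (snd (snd x), fibre_chart (fst x) (fst (snd x)))" for x :: "nat \<times> c2 \<times> complex"
  have mem: "(x, y) \<in> glue J coords \<longleftrightarrow> fst x \<in> J \<and> fst y \<in> J \<and> key x = key y" for x y
    using glue_iff[of "fst x" "fst (snd x)" "snd (snd x)" "fst y" "fst (snd y)" "snd (snd y)"]
    by (simp only: prod.collapse key_def prod.inject)
  show ?thesis
  proof (rule equivI)
    show "glue J coords \<subseteq> (J \<times> UNIV) \<times> J \<times> UNIV"
    proof
      fix z assume "z \<in> glue J coords"
      then show "z \<in> (J \<times> UNIV) \<times> J \<times> UNIV"
        using mem[of "fst z" "snd z"] by (simp add: mem_Times_iff)
    qed
    show "refl_on (J \<times> UNIV) (glue J coords)"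
      by (rule refl_onI) (simp only: mem mem_Times_iff simp_thms)
    show "sym (glue J coords)"
      by (rule symI) (simp only: mem simp_thms)
    show "trans (glue J coords)"
      by (rule transI) (simp only: mem simp_thms)
  qed
qed

lemma glue_pt_eq_iff:
  assumes "i \<in> J" "j \<in> J"
  shows "glue_pt J coords i (p, s) = glue_pt J coords j (q, t) \<longleftrightarrow> s = t \<and> fibre_chart i p = fibre_chart j q"
proof -
  have "glue_pt J coords i (p, s) = glue_pt J coords j (q, t) \<longleftrightarrow> ((i, p, s), (j, q, t)) \<in> glue J coords"
    unfolding glue_pt_def prod.case using assms
    by (intro eq_equiv_class_iff[OF equiv_glue]) (simp_all only: mem_Times_iff fst_conv UNIV_I simp_thms)
  then show ?thesis using assms by (simp only: glue_iff simp_thms)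
qed

lemma local_coordinates_fibre_chart:
  assumes "j \<in> J" shows "local_coordinates S9 (UNIV, fibre_chart j)"
proof -
  have rot: "local_coordinates S9 (UNIV, \<lambda>p. snd c (snd p, - fst p))"
    if "local_coordinates S9 c" "fst c = UNIV" for c
    by (rule local_coordinates_reparam[OF S9 that(1) open_UNIV open_UNIV,
          where h = "\<lambda>p. (snd p, - fst p)" and k = "\<lambda>p. (- snd p, fst p)"])
      (auto intro!: cdiff_intros simp: that(2))
  have "fst Q7 = UNIV" by (auto simp: fst_bl1 fst_V0)
  then have "local_coordinates S9 (UNIV, \<lambda>p. snd Q7 (snd p, - fst p))"
    by (rule rot[OF S9_charts(1)])
  moreover have "local_coordinates S9 (UNIV, \<lambda>p. snd Q3 (snd p, - fst p))"
    by (rule rot[OF S9_charts(9)]) simp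
  moreover have "local_coordinates S9 (UNIV, snd Z1)"
    using S9_charts(13) by (simp add: Z1_def)
  ultimately show ?thesis using assms by (auto simp: J_def fibre_chart_def[abs_def])
qed

lemma fibre_charts_image: "(\<Union>j\<in>J. range (fibre_chart j)) = inner"
proof (intro subset_antisym subsetI)
  fix q assume "q \<in> (\<Union>j\<in>J. range (fibre_chart j))"
  then obtain j p where q: "j \<in> J" "q = fibre_chart j p" by auto
  show "q \<in> inner"
  proof (cases "j = 0 \<or> snd p \<noteq> 0")
    case True
    then show ?thesis
      unfolding q(2) fibre_chart_affine[OF True] inner_def by (cases "inv_coords j p") auto
  next
    case False
    then have "j = 1 \<or> j = 2" using q(1) by (auto simp: J_def)
    then show ?thesis
      using False fibre_chart_exceptional[of p] unfolding q(2) inner_def by auto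
  qed
next
  fix q assume "q \<in> inner"
  then consider p where "q = Plane (line (1, p :: c2))" | v where "q = Exc e3 (line (1, v))"
    | v where "q = Exc f6 (line (1, v))"
    unfolding inner_def by auto
  then show "q \<in> (\<Union>j\<in>J. range (fibre_chart j))"
  proof cases
    case 1
    then have "q = fibre_chart 0 p" using fibre_chart_affine[of 0 p] by (simp add: inv_coords_0)
    then show ?thesis by (auto simp: J_def)
  next
    case 2
    then have "q = fibre_chart 2 (- v, 0)" using fibre_chart_exceptional(2)[of "(- v, 0)"] by simp
    then show ?thesis by (auto simp: J_def)
  next
    case 3
    then have "q = fibre_chart 1 (- v, 0)" using fibre_chart_exceptional(1)[of "(- v, 0)"] by simp
    then show ?thesis by (auto simp: J_def)
  qed
qed

lemma fibre_transition:
  assumes "i \<in> J" "j \<in> J" "fibre_chart i p = fibre_chart j q"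
  obtains f where "cdifferentiable_at f p" "f p = q" "\<forall>\<^sub>F x in nhds p. fibre_chart j (f x) = fibre_chart i x"
proof -
  note ij = local_coordinates_fibre_chart[OF assms(1)] local_coordinates_fibre_chart[OF assms(2)]
  obtain f where "cdifferentiable_at f p" "f p = q"
    "lifts f (UNIV, fibre_chart i) (UNIV, fibre_chart j) p"
    by (rule holomorphic_transitionE[OF local_coordinates_holomorphic_transition[OF ij]
          local_coordinates_inj[OF ij(2)], of p q]) (use assms(3) in auto)
  then show ?thesis by (intro that[of f]) simp_all
qed

text \<open>The coordinate changes are taken over from the surface, since glued points are equal
  exactly when their images there are.\<close>

lemma compatible_atlas_fibre: "compatible_atlas (fibre J coords t)"
proof (rule compatible_atlasI)
  have inj: "inj (\<lambda>p. glue_pt J coords j (p, t))" if "j \<in> J" for j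
  proof (rule injI)
    fix p q assume "glue_pt J coords j (p, t) = glue_pt J coords j (q, t)"
    then have "fibre_chart j p = fibre_chart j q" using that by (simp add: glue_pt_eq_iff)
    moreover have "inj (fibre_chart j)"
      using local_coordinates_inj[OF local_coordinates_fibre_chart[OF that]] by simp
    ultimately show "p = q" by (simp add: inj_eq)
  qed
  show "open (fst c) \<and> inj_on (snd c) (fst c)" if "c \<in> fibre J coords t" for c
    using that inj unfolding fibre_def by auto
  fix c d assume "c \<in> fibre J coords t" "d \<in> fibre J coords t"
  then obtain i j where ij: "i \<in> J" "j \<in> J" "c = (UNIV, \<lambda>p. glue_pt J coords i (p, t))"
    "d = (UNIV, \<lambda>p. glue_pt J coords j (p, t))"
    unfolding fibre_def by blast
  show "holomorphic_transition c d"
  proof (rule holomorphic_transitionI)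
    show "inj_on (snd d) (fst d)" using inj[OF ij(2)] by (simp add: ij(4))
    fix p q assume "snd c p = snd d q"
    then have "fibre_chart i p = fibre_chart j q" using ij by (simp add: glue_pt_eq_iff)
    then obtain f where f: "cdifferentiable_at f p"
      "\<forall>\<^sub>F x in nhds p. fibre_chart j (f x) = fibre_chart i x"
      using fibre_transition[OF ij(1,2)] by metis
    from f(2) have "lifts f c d p"
      by eventually_elim (use ij in \<open>simp add: glue_pt_eq_iff\<close>)
    with f(1) show "\<exists>f. cdifferentiable_at f p \<and> lifts f c d p" by blast
  qed
qed

lemma zero_in_J: "0 \<in> J" by (simp add: J_def)

lemma rational_surface_fibre:
  "rational_surface_of_type E7_affine S9 (fibre J coords t) (\<lambda>p. glue_pt J coords 0 (p, t))"
proof -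
  \<comment> \<open>The class of a point is sent to its image on the surface;
    \<open>glue_pt_eq_iff\<close> makes this both well defined and injective. The same surface
    serves for every \<open>t\<close>.\<close>
  define \<iota> where "\<iota> X = (THE r. \<exists>j\<in>J. \<exists>p. X = glue_pt J coords j (p, t) \<and> r = fibre_chart j p)" for X
  have \<iota>: "\<iota> (glue_pt J coords j (p, t)) = fibre_chart j p" if "j \<in> J" for j p
    unfolding \<iota>_def
  proof (rule the_equality)
    show "\<exists>i\<in>J. \<exists>q. glue_pt J coords j (p, t) = glue_pt J coords i (q, t) \<and> fibre_chart j p = fibre_chart i q"
      using that by blast
    fix r assume "\<exists>i\<in>J. \<exists>q. glue_pt J coords j (p, t) = glue_pt J coords i (q, t) \<and> r = fibre_chart i q"
    then obtain i q where "i \<in> J" "glue_pt J coords j (p, t) = glue_pt J coords i (q, t)" "r = fibre_chart i q"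
      by blast
    then show "r = fibre_chart j p" using that by (simp add: glue_pt_eq_iff)
  qed
  have pts: "points (fibre J coords t) = (\<Union>j\<in>J. range (\<lambda>p. glue_pt J coords j (p, t)))"
    unfolding fibre_def points_def by auto
  have img: "\<iota> ` points (fibre J coords t) = inner"
    unfolding pts fibre_charts_image[symmetric] image_UN image_image by (simp add: \<iota>)
  have "inj_on \<iota> (points (fibre J coords t))"
  proof (rule inj_onI)
    fix X Y assume "X \<in> points (fibre J coords t)" "Y \<in> points (fibre J coords t)" "\<iota> X = \<iota> Y"
    then obtain i p j q where "i \<in> J" "j \<in> J" "X = glue_pt J coords i (p, t)" "Y = glue_pt J coords j (q, t)"
      unfolding pts by blast
    with \<open>\<iota> X = \<iota> Y\<close> show "X = Y" by (simp add: \<iota> glue_pt_eq_iff)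
  qed
  moreover have "local_coordinates S9 (fst c, \<iota> \<circ> snd c)" if "c \<in> fibre J coords t" for c
  proof -
    from that obtain j where j: "j \<in> J" "c = (UNIV, \<lambda>p. glue_pt J coords j (p, t))"
      unfolding fibre_def by blast
    then have "(fst c, \<iota> \<circ> snd c) = (UNIV, fibre_chart j)" by (simp add: \<iota> comp_def)
    then show ?thesis using local_coordinates_fibre_chart[OF j(1)] by simp
  qed
  ultimately have emb: "open_embedding (fibre J coords t) S9 \<iota>"
    by (intro open_embeddingI[OF compatible_atlas_fibre S9])
  obtain \<pi> where \<pi>: "blown_up_plane S9 \<pi>" "\<And>l. \<pi> (Plane l) = Plane l"
    using stage_S9 unfolding stage_def by blast
  have "\<pi> (\<iota> (glue_pt J coords 0 ((x, y), t))) = Plane (line (1, x, y))" for x y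
    using \<pi>(2) fibre_chart_affine[of 0 "(x, y)"] by (simp add: \<iota> zero_in_J inv_coords_0)
  moreover have "complex_manifold S9" using stage_S9 by (simp add: stage_def surface_def)
  moreover have "fst E7_affine = {0..7}" by (simp add: E7_affine_def)
  ultimately show ?thesis
    unfolding rational_surface_of_type_def
    using \<pi>(1) emb inj_on_boundary boundary_complement[folded img] boundary_curves boundary_intersection
    by (intro conjI exI[of _ \<pi>] exI[of _ \<iota>] exI[of _ boundary]) auto
qed

section \<open>The total space\<close>

lemma compatible_atlas_total_space: "compatible_atlas (total_space J coords)"
  and total_space_inj: "j \<in> J \<Longrightarrow> inj (glue_pt J coords j)"
proof -
  have inj: "inj (glue_pt J coords j)" if "j \<in> J" for j
  proof (rule injI)
    fix x y assume "glue_pt J coords j x = glue_pt J coords j y"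
    then have "snd x = snd y" "fibre_chart j (fst x) = fibre_chart j (fst y)"
      using glue_pt_eq_iff[OF that that, of "fst x" "snd x" "fst y" "snd y"] by simp_all
    note xy = this
    have "inj (fibre_chart j)"
      using local_coordinates_inj[OF local_coordinates_fibre_chart[OF that]] by simp
    then have "fst x = fst y" using xy(2) by (rule injD)
    then show "x = y" using xy(1) by (rule prod_eqI)
  qed
  then show "j \<in> J \<Longrightarrow> inj (glue_pt J coords j)" .
  show "compatible_atlas (total_space J coords)"
  proof (rule compatible_atlasI)
    show "open (fst c) \<and> inj_on (snd c) (fst c)" if "c \<in> total_space J coords" for c
      using that inj unfolding total_space_def by auto
    fix c d assume "c \<in> total_space J coords" "d \<in> total_space J coords"
    then obtain i j where ij: "i \<in> J" "j \<in> J" "c = (UNIV, glue_pt J coords i)" "d = (UNIV, glue_pt J coords j)"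
      unfolding total_space_def by blast
    show "holomorphic_transition c d"
    proof (rule holomorphic_transitionI)
      show "inj_on (snd d) (fst d)" using inj[OF ij(2)] by (simp add: ij(4))
      fix x y assume "snd c x = snd d y"
      then have "fibre_chart i (fst x) = fibre_chart j (fst y)"
        using glue_pt_eq_iff[OF ij(1,2), of "fst x" "snd x" "fst y" "snd y"] by (simp add: ij)
      then obtain f where f: "cdifferentiable_at f (fst x)"
        "\<forall>\<^sub>F p in nhds (fst x). fibre_chart j (f p) = fibre_chart i p"
        using fibre_transition[OF ij(1,2)] by metis
      have "\<forall>\<^sub>F z in nhds x. fibre_chart j (f (fst z)) = fibre_chart i (fst z)"
        by (rule cdiff_eventually[OF cdiff_fst[OF cdiff_ident] f(2)])
      then have "\<forall>\<^sub>F z in nhds x. z \<in> fst c \<and> (f (fst z), snd z) \<in> fst d \<and>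
          snd d (f (fst z), snd z) = snd c z"
      proof eventually_elim
        case (elim z)
        then show ?case using glue_pt_eq_iff[OF ij(2,1), of "f (fst z)" "snd z" "fst z" "snd z"]
          by (simp add: ij)
      qed
      moreover have "cdifferentiable_at (\<lambda>z. (f (fst z), snd z)) x"
        by (intro cdiff_Pair cdiff_snd cdiff_ident cdiff_compose[OF cdiff_fst[OF cdiff_ident] f(1)])
      ultimately show "\<exists>f. cdifferentiable_at f x \<and> lifts f c d x"
        by (intro exI[of _ "\<lambda>z. (f (fst z), snd z)"] conjI)
    qed
  qed
qed

text \<open>Two points differ either in time, which is an open condition, or in the fibre direction,
  where Hausdorffness of the surface separates them.\<close>

lemma complex_manifold_total_space: "complex_manifold (total_space J coords)"
proof (rule complex_manifoldI[OF compatible_atlas_total_space])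
  show "finite (total_space J coords)" by (simp add: total_space_def J_def)
  fix c d assume "c \<in> total_space J coords" "d \<in> total_space J coords"
  then obtain i j where ij: "i \<in> J" "j \<in> J" "c = (UNIV, glue_pt J coords i)" "d = (UNIV, glue_pt J coords j)"
    unfolding total_space_def by blast
  note iff = glue_pt_eq_iff[OF ij(1,2)]
  show "separated c d"
  proof (rule separatedI)
    fix z w assume ne: "snd c z \<noteq> snd d w"
    have "\<forall>\<^sub>F q in nhds (z, w). snd (fst q) \<noteq> snd (snd q) \<or> fibre_chart i (fst (fst q)) \<noteq> fibre_chart j (fst (snd q))"
    proof (cases "snd z = snd w")
      case False
      have "cdifferentiable_at (\<lambda>q. snd (fst q) - snd (snd q)) (z, w)" by (intro cdiff_intros)
      then have "\<forall>\<^sub>F q in nhds (z, w). snd (fst q) - snd (snd q) \<noteq> 0"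
        by (rule cdiff_eventually_neq) (simp add: False)
      then show ?thesis by eventually_elim simp
    next
      case True
      then have "fibre_chart i (fst z) \<noteq> fibre_chart j (fst w)"
        using ne iff[of "fst z" "snd z" "fst w" "snd w"] True
        unfolding ij prod.collapse snd_conv by blast
      moreover have "Hausdorff_space (mtop S9)"
        using stage_S9 by (simp add: stage_def surface_def complex_manifold_def)
      ultimately have ev: "\<forall>\<^sub>F q in nhds (fst z, fst w). fibre_chart i (fst q) \<noteq> fibre_chart j (snd q)"
        using separatedD[OF separated_local_coordinates[OF S9 _ local_coordinates_fibre_chart[OF ij(1)]
            local_coordinates_fibre_chart[OF ij(2)]], of "fst z" "fst w"] by simp
      have "cdifferentiable_at (\<lambda>q. (fst (fst q), fst (snd q))) (z, w)" by (intro cdiff_intros)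
      from cdiff_eventually[OF this, of "\<lambda>q. fibre_chart i (fst q) \<noteq> fibre_chart j (snd q)"] ev
      have "\<forall>\<^sub>F q in nhds (z, w). fibre_chart i (fst (fst q)) \<noteq> fibre_chart j (fst (snd q))" by simp
      then show ?thesis by eventually_elim simp
    qed
    then show "apart c d z w"
    proof eventually_elim
      case (elim q)
      then show ?case
        using iff[of "fst (fst q)" "snd (fst q)" "fst (snd q)" "snd (snd q)"] by (auto simp: ij)
    qed
  qed
qed

lemma time_map: "\<exists>\<tau>. holomorphic_map (total_space J coords) {(UNIV, id)} \<tau> \<and>
    (\<forall>j\<in>J. \<forall>p t. \<tau> (glue_pt J coords j (p, t)) = (t :: complex))"
proof -
  define \<tau> where "\<tau> X = (THE t. \<exists>j\<in>J. \<exists>p. X = glue_pt J coords j (p, t))" for X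
  have \<tau>: "\<tau> (glue_pt J coords j (p, t)) = t" if "j \<in> J" for j p t
    unfolding \<tau>_def
  proof (rule the_equality)
    show "\<exists>i\<in>J. \<exists>q. glue_pt J coords j (p, t) = glue_pt J coords i (q, t)" using that by blast
    fix s assume "\<exists>i\<in>J. \<exists>q. glue_pt J coords j (p, t) = glue_pt J coords i (q, s)"
    then obtain i q where "i \<in> J" "glue_pt J coords j (p, t) = glue_pt J coords i (q, s)" by blast
    then show "s = t" using that by (simp add: glue_pt_eq_iff)
  qed
  have "holomorphic_transition (fst c, \<tau> \<circ> snd c) (UNIV, id)" if "c \<in> total_space J coords" for c
  proof -
    from that obtain j where j: "j \<in> J" "c = (UNIV, glue_pt J coords j)"
      unfolding total_space_def by blast
    show ?thesis
    proof (rule holomorphic_transitionI)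
      fix z show "\<exists>f. cdifferentiable_at f z \<and> lifts f (fst c, \<tau> \<circ> snd c) (UNIV, id) z"
        using \<tau>[OF j(1), of "fst x" "snd x" for x]
        by (intro exI[of _ snd]) (auto simp: j(2) intro!: cdiff_snd cdiff_ident always_eventually)
    qed simp
  qed
  then have "holomorphic_map (total_space J coords) {(UNIV, id)} \<tau>"
    unfolding holomorphic_map_iff by (simp add: points_def)
  then show ?thesis using \<tau> by blast
qed

section \<open>The system in the three charts\<close>

lemma birational_coords: "j \<in> J \<Longrightarrow> birational (coords j)"
proof -
  assume j: "j \<in> J"
  obtain R where R: "\<And>w. snd w \<noteq> 0 \<Longrightarrow> regular R w \<and> ratval R w = coords j w"
    using rational_transition[OF zero_in_J j] by (auto simp: inv_coords_0)
  obtain R' where R': "\<And>w. snd w \<noteq> 0 \<Longrightarrow> regular R' w \<and> ratval R' w = inv_coords j w"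
    using rational_transition[OF j zero_in_J] by (auto simp: coords_0)
  show ?thesis
    unfolding birational_def
    by (intro exI[of _ R] exI[of _ R'] conjI; rule generically_nonzero)
      (simp_all add: R R' snd_coords snd_inv_coords inv_coords_coords coords_inv_coords)
qed

text \<open>For j = 1 and 2 the derivative is triangular, with diagonal entries -y^2 and -1 / y^2,
  so its determinant is 1.\<close>

lemma symplectic_coords: "symplectic (coords j)"
  unfolding symplectic_def
proof (rule generically_nonzero)
  fix z :: c2 assume "snd z \<noteq> 0"
  then obtain x y where z: "z = (x, y)" "y \<noteq> 0" by (cases z) auto
  consider "j = 0" | "j = 1" | "j \<noteq> 0" "j \<noteq> 1" by blast
  then show "\<exists>D. (coords j has_derivative D) (at z) \<and> (\<forall>v w. area_form (D v) (D w) = area_form v w)"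
  proof cases
    case 1
    then show ?thesis
      by (intro exI[of _ "\<lambda>h. h"]) (simp add: coords_0 id_def)
  next
    case 2
    let ?D = "\<lambda>h. (- (fst h - y * snd h / 2) * y\<^sup>2 - (x - y\<^sup>2 / 4) * (2 * y * snd h), - snd h / y\<^sup>2)"
    have "((\<lambda>z. (- (fst z - (snd z)\<^sup>2 / 4) * (snd z)\<^sup>2, 1 / snd z)) has_derivative ?D) (at (x, y))"
      by (rule has_derivative_Pair)
        (use z(2) in \<open>auto intro!: derivative_eq_intros simp: fun_eq_iff field_simps power2_eq_square\<close>)
    moreover have "area_form (?D v) (?D w) = area_form v w" for v w
      using z(2) by (simp add: area_form_def field_simps power2_eq_square)
    ultimately show ?thesis
      using 2 z by (intro exI[of _ ?D]) (simp add: coords_def case_prod_unfold)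
  next
    case 3
    let ?D = "\<lambda>h. (- fst h * y\<^sup>2 - x * (2 * y * snd h), - snd h / y\<^sup>2)"
    have "((\<lambda>z. (- fst z * (snd z)\<^sup>2, 1 / snd z)) has_derivative ?D) (at (x, y))"
      by (rule has_derivative_Pair)
        (use z(2) in \<open>auto intro!: derivative_eq_intros simp: fun_eq_iff field_simps power2_eq_square\<close>)
    moreover have "area_form (?D v) (?D w) = area_form v w" for v w
      using z(2) by (simp add: area_form_def field_simps power2_eq_square)
    ultimately show ?thesis
      using 3 z by (intro exI[of _ ?D]) (simp add: coords_def case_prod_unfold)
  qed
qed

text \<open>The system is Hamiltonian, x' = H_y and y' = -H_x, with H = x y^2 / 2 - 2 x^2. In charts
  1 and 2 this function becomes x_1 / 2 - 2 x_1^2 y_1^4 and -x_2 / 2 - 2 x_2^2 y_2^4, and the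
  symplectic changes preserve the Hamiltonian form.\<close>

definition chart_system :: "nat \<Rightarrow> system"
  where "chart_system j t = (\<lambda>(x, y). if j = 0 then (x * y, - (y\<^sup>2 / 2) + 4 * x)
    else if j = 1 then (- 8 * x\<^sup>2 * y ^ 3, - (1 / 2) + 4 * x * y ^ 4)
    else (- 8 * x\<^sup>2 * y ^ 3, 1 / 2 + 4 * x * y ^ 4))"

lemma chart_system_0: "chart_system 0 = the_system"
  by (auto simp: chart_system_def the_system_def fun_eq_iff)

lemma polynomial_systemI:
  fixes a b :: "nat \<Rightarrow> nat \<Rightarrow> complex"
  assumes "\<And>t x y. g t (x, y) = ((\<Sum>i\<le>N. \<Sum>k\<le>N. a i k * x ^ i * y ^ k), (\<Sum>i\<le>N. \<Sum>k\<le>N. b i k * x ^ i * y ^ k))"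
  shows "polynomial_system g"
  unfolding polynomial_system_def using assms
  by (intro exI[of _ N] exI[of _ "\<lambda>i k t. a i k"] exI[of _ "\<lambda>i k t. b i k"]) auto

text \<open>\<open>polynomial_system\<close> asks for a square array of coefficients; each monomial
  is an array with one entry. Size 4 is enough, as y^4 is the highest power in the three
  systems.\<close>

definition monomial_coeff :: "nat \<Rightarrow> nat \<Rightarrow> complex \<Rightarrow> nat \<Rightarrow> nat \<Rightarrow> complex"
  where "monomial_coeff u v c i k = (if i = u then if k = v then c else 0 else 0)"

lemma sum_mono:
  assumes "u \<le> N" "v \<le> N"
  shows "(\<Sum>i\<le>N. \<Sum>k\<le>N. monomial_coeff u v c i k * x ^ i * y ^ k) = c * x ^ u * y ^ v"
proof -
  have "(\<Sum>k\<le>N. monomial_coeff u v c i k * x ^ i * y ^ k) = (if i = u then c * x ^ u * y ^ v else 0)" for i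
  proof -
    have "(\<Sum>k\<le>N. monomial_coeff u v c i k * x ^ i * y ^ k) =
        (\<Sum>k\<le>N. if k = v then if i = u then c * x ^ u * y ^ v else 0 else 0)"
      by (rule sum.cong) (auto simp: monomial_coeff_def)
    then show ?thesis using assms(2) by simp
  qed
  then show ?thesis using assms(1) by simp
qed

lemma polynomial_chart_system: "polynomial_system (chart_system j)"
proof -
  note sums = sum_mono distrib_right sum.distrib
  consider "j = 0" | "j = 1" | "j \<noteq> 0" "j \<noteq> 1" by blast
  then show ?thesis
  proof cases
    case 1
    show ?thesis
      by (rule polynomial_systemI[where N = 4 and a = "monomial_coeff 1 1 1"
            and b = "\<lambda>i k. monomial_coeff 0 2 (- (1 / 2)) i k + monomial_coeff 1 0 4 i k"])
        (simp add: 1 chart_system_def sums)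
  next
    case 2
    show ?thesis
      by (rule polynomial_systemI[where N = 4 and a = "monomial_coeff 2 3 (- 8)"
            and b = "\<lambda>i k. monomial_coeff 0 0 (- (1 / 2)) i k + monomial_coeff 1 4 4 i k"])
        (simp add: 2 chart_system_def sums)
  next
    case 3
    show ?thesis
      by (rule polynomial_systemI[where N = 4 and a = "monomial_coeff 2 3 (- 8)"
            and b = "\<lambda>i k. monomial_coeff 0 0 (1 / 2) i k + monomial_coeff 1 4 4 i k"])
        (use 3 in \<open>simp add: chart_system_def sums\<close>)
  qed
qed

section \<open>Solutions under changes of chart\<close>

lemma solves_at_cong:
  assumes "open A" "t \<in> A" "\<And>s. s \<in> A \<Longrightarrow> u s = v s"
  shows "solves_at f u t \<longleftrightarrow> solves_at f v t"
proof -
  have "\<forall>\<^sub>F s in nhds t. s \<in> A" using assms(1,2) by (rule eventually_nhds_in_open)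
  then have e: "\<forall>\<^sub>F s in nhds t. fst (u s) = fst (v s)" "\<forall>\<^sub>F s in nhds t. snd (u s) = snd (v s)"
    by (eventually_elim, simp add: assms(3))+
  show ?thesis
    unfolding solves_at_def assms(3)[OF assms(2)] DERIV_cong_ev[OF refl e(1) refl]
      DERIV_cong_ev[OF refl e(2) refl] by (rule refl)
qed

lemma solves_at_coords:
  assumes s: "solves_at the_system u t" and y: "snd (u t) \<noteq> 0" and j: "j \<in> J"
  shows "solves_at (chart_system j) (\<lambda>s. coords j (u s)) t"
proof -
  obtain x y where u: "u t = (x, y)" by (cases "u t")
  have d: "((\<lambda>s. fst (u s)) has_field_derivative x * y) (at t)"
    "((\<lambda>s. snd (u s)) has_field_derivative - (y\<^sup>2 / 2) + 4 * x) (at t)"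
    using s by (simp_all add: solves_at_def the_system_def u)
  have y0: "y \<noteq> 0" using y by (simp add: u)
  have d2: "((\<lambda>s. 1 / snd (u s)) has_field_derivative - (- (y\<^sup>2 / 2) + 4 * x) / y\<^sup>2) (at t)"
    by (rule derivative_eq_intros refl d | simp add: u y0 power2_eq_square)+
  consider "j = 0" | "j = 1" | "j = 2" using j by (auto simp: J_def)
  then show ?thesis
  proof cases
    case 1 then show ?thesis using s by (simp add: chart_system_0 coords_0)
  next
    case 2
    have "((\<lambda>s. - (fst (u s) - (snd (u s))\<^sup>2 / 4) * (snd (u s))\<^sup>2) has_field_derivative
        - (x * y - y * (- (y\<^sup>2 / 2) + 4 * x) / 2) * y\<^sup>2 - (x - y\<^sup>2 / 4) * (2 * y * (- (y\<^sup>2 / 2) + 4 * x))) (at t)"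
      by (rule derivative_eq_intros refl d | simp add: u field_simps)+
    moreover have "- (x * y - y * (- (y\<^sup>2 / 2) + 4 * x) / 2) * y\<^sup>2 - (x - y\<^sup>2 / 4) * (2 * y * (- (y\<^sup>2 / 2) + 4 * x))
        = - 8 * (- (x - y\<^sup>2 / 4) * y\<^sup>2)\<^sup>2 * (1 / y) ^ 3"
      using y0 by (simp add: field_simps eval_nat_numeral)
    moreover have "- (- (y\<^sup>2 / 2) + 4 * x) / y\<^sup>2 = - (1 / 2) + 4 * (- (x - y\<^sup>2 / 4) * y\<^sup>2) * (1 / y) ^ 4"
      using y0 by (simp add: field_simps eval_nat_numeral)
    ultimately show ?thesis
      using d2 2 by (simp add: solves_at_def chart_system_def coords_def case_prod_unfold u)
  next
    case 3
    have "((\<lambda>s. - fst (u s) * (snd (u s))\<^sup>2) has_field_derivative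
        - x * y * y\<^sup>2 - x * (2 * y * (- (y\<^sup>2 / 2) + 4 * x))) (at t)"
      by (rule derivative_eq_intros refl d | simp add: u field_simps)+
    moreover have "- x * y * y\<^sup>2 - x * (2 * y * (- (y\<^sup>2 / 2) + 4 * x)) = - 8 * (- x * y\<^sup>2)\<^sup>2 * (1 / y) ^ 3"
      using y0 by (simp add: field_simps eval_nat_numeral)
    moreover have "- (- (y\<^sup>2 / 2) + 4 * x) / y\<^sup>2 = 1 / 2 + 4 * (- x * y\<^sup>2) * (1 / y) ^ 4"
      using y0 by (simp add: field_simps eval_nat_numeral)
    ultimately show ?thesis
      using d2 3 by (simp add: solves_at_def chart_system_def coords_def case_prod_unfold u)
  qed
qed

lemma solves_at_inv_coords:
  assumes s: "solves_at (chart_system j) v t" and y: "snd (v t) \<noteq> 0" and j: "j \<in> J"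
  shows "solves_at the_system (\<lambda>s. inv_coords j (v s)) t"
proof -
  obtain x y where v: "v t = (x, y)" by (cases "v t")
  define x' y' where "x' = fst (chart_system j t (x, y))" and "y' = snd (chart_system j t (x, y))"
  have d: "((\<lambda>s. fst (v s)) has_field_derivative x') (at t)"
    "((\<lambda>s. snd (v s)) has_field_derivative y') (at t)"
    using s by (simp_all add: solves_at_def x'_def y'_def v)
  have y0: "y \<noteq> 0" using y by (simp add: v)
  have d2: "((\<lambda>s. 1 / snd (v s)) has_field_derivative - y' / y\<^sup>2) (at t)"
    by (rule derivative_eq_intros refl d | simp add: v y0 power2_eq_square)+
  consider "j = 0" | "j = 1" | "j = 2" using j by (auto simp: J_def)
  then show ?thesis
  proof cases
    case 1 then show ?thesis using s by (simp add: chart_system_0 inv_coords_0)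
  next
    case 2
    have "((\<lambda>s. 1 / (4 * (snd (v s))\<^sup>2) - fst (v s) * (snd (v s))\<^sup>2) has_field_derivative
        - y' / (2 * y ^ 3) - x' * y\<^sup>2 - x * (2 * y * y')) (at t)"
      by (rule derivative_eq_intros refl d | simp add: v y0 field_simps eval_nat_numeral)+
    moreover have "- y' / (2 * y ^ 3) - x' * y\<^sup>2 - x * (2 * y * y') = (1 / (4 * y\<^sup>2) - x * y\<^sup>2) * (1 / y)"
      "- y' / y\<^sup>2 = - ((1 / y)\<^sup>2 / 2) + 4 * (1 / (4 * y\<^sup>2) - x * y\<^sup>2)"
      using y0 2 by (simp_all add: x'_def y'_def chart_system_def field_simps eval_nat_numeral)
    ultimately show ?thesis
      using d2 2 by (simp add: solves_at_def the_system_def inv_coords_def case_prod_unfold v)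
  next
    case 3
    have "((\<lambda>s. - fst (v s) * (snd (v s))\<^sup>2) has_field_derivative - x' * y\<^sup>2 - x * (2 * y * y')) (at t)"
      by (rule derivative_eq_intros refl d | simp add: v field_simps)+
    moreover have "- x' * y\<^sup>2 - x * (2 * y * y') = (- x * y\<^sup>2) * (1 / y)"
      and e: "- y' / y\<^sup>2 = - ((1 / y)\<^sup>2 / 2) + 4 * (- x * y\<^sup>2)"
      using y0 3 by (simp_all add: x'_def y'_def chart_system_def field_simps eval_nat_numeral)
    moreover have "(\<lambda>s. fst (inv_coords j (v s))) = (\<lambda>s. - fst (v s) * (snd (v s))\<^sup>2)"
      "(\<lambda>s. snd (inv_coords j (v s))) = (\<lambda>s. 1 / snd (v s))"
      "the_system t (inv_coords j (v t)) = ((- x * y\<^sup>2) * (1 / y), - ((1 / y)\<^sup>2 / 2) + 4 * (- x * y\<^sup>2))"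
      using 3 by (simp_all add: inv_coords_def the_system_def case_prod_unfold v)
    ultimately show ?thesis
      using d2 unfolding solves_at_def e by (simp only: fst_conv snd_conv simp_thms)
  qed
qed

lemma rewritten_chart_system:
  assumes j: "j \<in> J" shows "rewritten the_system (coords j) (chart_system j)"
  unfolding rewritten_def
proof (intro allI impI)
  fix A :: "complex set" and u v
  assume A: "open A" and "\<forall>t\<in>A. biregular_at id (coords j) (u t) (v t)"
  \<comment> \<open>Biregularity at every point of \<open>A\<close> says that \<open>u\<close> and
    \<open>v\<close> are related by the explicit formulas on an open set, where derivatives can be
    compared.\<close>
  then have b: "0 = j \<and> u t = v t \<or> snd (u t) \<noteq> 0 \<and> snd (v t) \<noteq> 0 \<and> u t = inv_coords j (v t)" if "t \<in> A" for t
    using biregular_at_iff[OF zero_in_J j, of "u t" "v t"] that by (simp add: coords_0 inv_coords_0)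
  show "(\<forall>t\<in>A. solves_at the_system u t) \<longleftrightarrow> (\<forall>t\<in>A. solves_at (chart_system j) v t)"
  proof (cases "j = 0")
    case True
    have "u t = v t" if "t \<in> A" for t using b[OF that] by (auto simp: True inv_coords_0)
    then have "solves_at the_system u t \<longleftrightarrow> solves_at the_system v t" if "t \<in> A" for t
      using that by (intro solves_at_cong[OF A])
    then show ?thesis by (simp add: True chart_system_0)
  next
    case False
    have uv: "snd (u t) \<noteq> 0" "snd (v t) \<noteq> 0" "u t = inv_coords j (v t)" "v t = coords j (u t)" if "t \<in> A" for t
      using b[OF that] False by (auto simp: coords_inv_coords)
    show ?thesis
    proof (intro iffI ballI)
      fix t assume u: "\<forall>t\<in>A. solves_at the_system u t" and t: "t \<in> A"
      from u t have "solves_at the_system u t" by (rule bspec)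
      then have "solves_at (chart_system j) (\<lambda>s. coords j (u s)) t" using uv(1)[OF t] j by (rule solves_at_coords)
      moreover have "solves_at (chart_system j) v t \<longleftrightarrow> solves_at (chart_system j) (\<lambda>s. coords j (u s)) t"
        by (rule solves_at_cong[OF A t]) (rule uv(4))
      ultimately show "solves_at (chart_system j) v t" by blast
    next
      fix t assume v: "\<forall>t\<in>A. solves_at (chart_system j) v t" and t: "t \<in> A"
      from v t have "solves_at (chart_system j) v t" by (rule bspec)
      then have "solves_at the_system (\<lambda>s. inv_coords j (v s)) t" using uv(2)[OF t] j by (rule solves_at_inv_coords)
      moreover have "solves_at the_system u t \<longleftrightarrow> solves_at the_system (\<lambda>s. inv_coords j (v s)) t"
        by (rule solves_at_cong[OF A t]) (rule uv(3))
      ultimately show "solves_at the_system u t" by blast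
    qed
  qed
qed

section \<open>Extension of meromorphic solutions\<close>

text \<open>With a primitive \<open>H\<close> of \<open>h\<close>, the product f exp(-H) has
  derivative zero on the punctured disc. This disc is connected, so f = c exp(H) there, and the
  right-hand side is holomorphic at the centre too.\<close>

lemma linear_ode_extends:
  fixes h f :: "complex \<Rightarrow> complex"
  assumes h: "h holomorphic_on ball a r"
    and f: "\<And>t. t \<in> ball a r - {a} \<Longrightarrow> (f has_field_derivative h t * f t) (at t)"
  obtains g where "g holomorphic_on ball a r" "\<And>t. t \<in> ball a r - {a} \<Longrightarrow> g t = f t"
proof -
  obtain H where "\<And>t. t \<in> ball a r \<Longrightarrow> (H has_field_derivative h t) (at t within ball a r)"
    using holomorphic_convex_primitive'[OF convex_ball open_ball h] by blast
  then have H: "(H has_field_derivative h t) (at t)" if "t \<in> ball a r" for t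
    using that by (metis at_within_open open_ball)
  define k where "k t = f t * exp (- H t)" for t
  have k: "(k has_field_derivative 0) (at t)" if "t \<in> ball a r - {a}" for t
  proof -
    have "t \<in> ball a r" using that by blast
    then have "(k has_field_derivative (h t * f t) * exp (- H t) + exp (- H t) * - h t * f t) (at t)"
      unfolding k_def using f[OF that] H by (auto intro!: derivative_eq_intros)
    then show ?thesis by simp
  qed
  have "open (ball a r - {a})" "connected (ball a r - {a})"
    by (auto intro!: connected_open_delete simp: DIM_complex)
  moreover have "continuous_on (ball a r - {a}) k"
    using k by (meson DERIV_isCont continuous_at_imp_continuous_on)
  ultimately obtain c where c: "\<And>t. t \<in> ball a r - {a} \<Longrightarrow> k t = c"
    using DERIV_zero_connected_constant[of "ball a r - {a}" "{}" k] k by auto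
  have "H holomorphic_on ball a r"
    unfolding holomorphic_on_open[OF open_ball] using H by blast
  then have "(\<lambda>t. c * exp (H t)) holomorphic_on ball a r" by (intro holomorphic_intros)
  moreover have "c * exp (H t) = f t" if "t \<in> ball a r - {a}" for t
    using c[OF that] by (simp add: k_def exp_minus field_simps)
  ultimately show ?thesis by (rule that)
qed

text \<open>Holomorphy is seen directly in chart \<open>j\<close>, which contains the whole curve;
  the other charts follow by composition with coordinate changes.\<close>

lemma solution_in_chart:
  assumes j: "j \<in> J" and r: "r > 0" and X: "X holomorphic_on ball a r" and V: "V holomorphic_on ball a r"
    and eq: "\<And>t. t \<in> ball a r - {a} \<Longrightarrow>
      fibre_chart j (X t, V t) = fibre_chart 0 (x t, y t)"
  shows "\<exists>r>0. \<exists>\<sigma>. holomorphic_map {(ball a r, id)} (total_space J coords) \<sigma> \<and>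
    (\<forall>t\<in>ball a r - {a}. \<sigma> t = glue_pt J coords 0 ((x t, y t), t))"
proof -
  define \<sigma> where "\<sigma> t = glue_pt J coords j ((X t, V t), t)" for t
  let ?c = "(UNIV, glue_pt J coords j)"
  have c: "?c \<in> total_space J coords" using j by (simp add: total_space_def)
  note lc = local_coordinates_member[OF compatible_atlas_total_space c]
  have t: "holomorphic_transition (ball a r, \<sigma>) ?c"
  proof (rule holomorphic_transitionI)
    show "inj_on (snd ?c) (fst ?c)" using total_space_inj[OF j] by simp
    fix t assume "t \<in> fst (ball a r, \<sigma>)"
    then have t: "t \<in> ball a r" by simp
    have "X field_differentiable at t" "V field_differentiable at t"
      using X V t by (auto intro: holomorphic_on_imp_differentiable_at[OF _ open_ball])
    then have "cdifferentiable_at (\<lambda>t. ((X t, V t), t)) t"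
      by (intro cdiff_Pair cdiff_ident cdiff_field)
    moreover have "\<forall>\<^sub>F s in nhds t. s \<in> ball a r" using t by (intro eventually_nhds_in_open) auto
    then have "\<forall>\<^sub>F s in nhds t. s \<in> fst (ball a r, \<sigma>) \<and> ((X s, V s), s) \<in> fst ?c \<and>
        snd ?c ((X s, V s), s) = snd (ball a r, \<sigma>) s"
      by eventually_elim (simp add: \<sigma>_def)
    ultimately show "\<exists>f. cdifferentiable_at f t \<and> lifts f (ball a r, \<sigma>) ?c t" by blast
  qed
  have img: "\<sigma> ` ball a r \<subseteq> range (glue_pt J coords j)" by (auto simp: \<sigma>_def)
  have "holomorphic_transition (ball a r, \<sigma>) d" if "d \<in> total_space J coords" for d
  proof -
    note d = local_coordinates_member[OF compatible_atlas_total_space that]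
    show ?thesis
      by (rule holomorphic_transition_via[OF local_coordinates_inj[OF d] local_coordinates_inj[OF lc] t
            local_coordinates_holomorphic_transition[OF lc d]]) (use img in simp)
  qed
  moreover have "\<sigma> ` ball a r \<subseteq> points (total_space J coords)"
    using local_coordinates_points[OF lc] by (auto simp: \<sigma>_def)
  ultimately have "holomorphic_map {(ball a r, id)} (total_space J coords) \<sigma>"
    unfolding holomorphic_map_iff by (simp add: points_def)
  moreover have "\<sigma> t = glue_pt J coords 0 ((x t, y t), t)" if "t \<in> ball a r - {a}" for t
    unfolding \<sigma>_def glue_pt_eq_iff[OF j zero_in_J] using eq[OF that] by simp
  ultimately show ?thesis using r by blast
qed

text \<open>Where \<open>y\<close> has a pole, \<open>v = 1 / y\<close> and \<open>P = x / y\<^sup>2\<close> are holomorphic, because \<open>v' = 1 / 2 - 4 P\<close>,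
  and \<open>v P' = 2 P (1 - 4 P)\<close> leaves only the values 0 and 1/4 for \<open>P\<close>.  In both cases \<open>v\<close> has a simple
  zero, and \<open>x\<^sub>2 = - P / v\<^sup>4\<close>, respectively \<open>x\<^sub>1 = - (P - 1 / 4) / v\<^sup>4\<close>, solves a linear equation
  with holomorphic coefficient \<open>8 P / v\<close>, respectively \<open>8 (P - 1 / 4) / v\<close>.\<close>

lemma solution_extends:
  assumes y: "y meromorphic_on {a}"
    and sol: "\<forall>\<^sub>F t in at a. solves_at the_system (\<lambda>t. (x t, y t)) t"
  shows "\<exists>r>0. \<exists>\<sigma>. holomorphic_map {(ball a r, id)} (total_space J coords) \<sigma> \<and>
    (\<forall>t\<in>ball a r - {a}. \<sigma> t = glue_pt J coords 0 ((x t, y t), t))"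
proof -
  have "not_essential y a" using y by (simp add: meromorphic_at_iff)
  then consider l where "y \<midarrow>a\<rightarrow> l" | "is_pole y a" unfolding not_essential_def by blast
  then show ?thesis
  proof cases
    \<comment> \<open>If \<open>y\<close> stays finite it extends to the centre, and x' = y x is
      then linear in \<open>x\<close> with holomorphic coefficient. The solution stays in chart
      0.\<close>
    case 1
    obtain r where r: "r > 0" "\<And>t. t \<in> ball a r - {a} \<Longrightarrow> solves_at the_system (\<lambda>t. (x t, y t)) t"
      using sol unfolding eventually_at by (auto simp: dist_commute)
    have d: "(x has_field_derivative y t * x t) (at t)" "(y has_field_derivative - ((y t)\<^sup>2 / 2) + 4 * x t) (at t)"
      if "t \<in> ball a r - {a}" for t
      using r(2)[OF that] by (simp_all add: solves_at_def the_system_def mult.commute)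
    define V where "V t = (if t = a then l else y t)" for t
    have "y holomorphic_on ball a r - {a}"
      unfolding holomorphic_on_open[OF open_delete[OF open_ball]] using d(2) by blast
    then have V: "V holomorphic_on ball a r"
      unfolding V_def using 1 by (intro removable_singularity) auto
    have "(x has_field_derivative V t * x t) (at t)" if "t \<in> ball a r - {a}" for t
      using d(1)[OF that] that by (simp add: V_def)
    then obtain X where X: "X holomorphic_on ball a r" "\<And>t. t \<in> ball a r - {a} \<Longrightarrow> X t = x t"
      using linear_ode_extends[OF V] by metis
    show ?thesis
      by (rule solution_in_chart[OF zero_in_J r(1) X(1) V]) (simp add: X(2) V_def)
  next
    case 2
    have "\<forall>\<^sub>F t in at a. y t \<noteq> 0" using 2 by (rule non_zero_neighbour_pole)
    with sol have "\<forall>\<^sub>F t in at a. solves_at the_system (\<lambda>t. (x t, y t)) t \<and> y t \<noteq> 0"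
      by (rule eventually_conj)
    then obtain r where r: "r > 0" and
      r': "\<And>t. t \<in> ball a r - {a} \<Longrightarrow> solves_at the_system (\<lambda>t. (x t, y t)) t \<and> y t \<noteq> 0"
      unfolding eventually_at by (auto simp: dist_commute)
    define B where "B = ball a r - {a}"
    have B: "open B" by (simp add: B_def open_delete)
    have y0: "y t \<noteq> 0" if "t \<in> B" for t using r' that by (simp add: B_def)
    have dx: "(x has_field_derivative x t * y t) (at t)"
      and dy: "(y has_field_derivative - ((y t)\<^sup>2 / 2) + 4 * x t) (at t)" if "t \<in> B" for t
      using r'[of t] that by (simp_all add: solves_at_def the_system_def B_def)
    define v where "v t = (if t = a then 0 else 1 / y t)" for t
    have v_eq: "v t = 1 / y t" if "t \<in> B" for t using that by (auto simp: v_def B_def)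
    have "((\<lambda>t. inverse (y t)) \<longlongrightarrow> 0) (at a)"
      using 2 unfolding is_pole_def by (rule tendsto_inverse_0[THEN filterlim_compose])
    then have "(\<lambda>t. 1 / y t) \<midarrow>a\<rightarrow> 0" by (simp add: inverse_eq_divide)
    moreover have hol_y: "y holomorphic_on B" unfolding holomorphic_on_open[OF B] using dy by blast
    then have "(\<lambda>t. 1 / y t) holomorphic_on ball a r - {a}"
      using y0 unfolding B_def by (intro holomorphic_intros) auto
    ultimately have v: "v holomorphic_on ball a r"
      unfolding v_def by (intro removable_singularity) auto
    have dv: "deriv v t = 1 / 2 - 4 * (x t / (y t)\<^sup>2)" if t: "t \<in> B" for t
    proof -
      have "((\<lambda>t. 1 / y t) has_field_derivative - (- ((y t)\<^sup>2 / 2) + 4 * x t) / (y t)\<^sup>2) (at t)"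
        by (rule derivative_eq_intros refl dy t | simp add: y0 t power2_eq_square)+
      then have "(v has_field_derivative - (- ((y t)\<^sup>2 / 2) + 4 * x t) / (y t)\<^sup>2) (at t)"
        by (rule has_field_derivative_transform_within_open[OF _ B t]) (simp add: v_eq)
      then show ?thesis using y0[OF t] by (simp add: DERIV_imp_deriv field_simps)
    qed
    \<comment> \<open>Defining \<open>P\<close> through v' rather than as a quotient makes it
      holomorphic at \<open>a\<close> at once; off \<open>a\<close> it agrees with x / y^2.\<close>
    define P where "P t = (1 / 2 - deriv v t) / 4" for t
    have P: "P holomorphic_on ball a r"
      unfolding P_def using v by (intro holomorphic_intros) auto
    have P_eq: "P t = x t / (y t)\<^sup>2" if "t \<in> B" for t using dv[OF that] by (simp add: P_def)
    have dP: "(P has_field_derivative deriv P t) (at t)" if "t \<in> ball a r" for t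
      using holomorphic_derivI[OF P open_ball that] .
    have dP_eq: "deriv P t = 2 * y t * P t * (1 - 4 * P t)" if t: "t \<in> B" for t
    proof -
      have "((\<lambda>t. x t / (y t)\<^sup>2) has_field_derivative
          (x t * y t * (y t)\<^sup>2 - x t * (2 * y t * (- ((y t)\<^sup>2 / 2) + 4 * x t))) / ((y t)\<^sup>2)\<^sup>2) (at t)"
        by (rule derivative_eq_intros refl dx dy t | simp add: y0 t power2_eq_square)+
      then have "(P has_field_derivative
          (x t * y t * (y t)\<^sup>2 - x t * (2 * y t * (- ((y t)\<^sup>2 / 2) + 4 * x t))) / ((y t)\<^sup>2)\<^sup>2) (at t)"
        by (rule has_field_derivative_transform_within_open[OF _ B t]) (simp add: P_eq)
      then show ?thesis
        using y0[OF t] by (simp add: DERIV_imp_deriv P_eq[OF t] field_simps eval_nat_numeral)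
    qed
    have a: "a \<in> ball a r" using r by simp
    have lim: "(f \<longlongrightarrow> f a) (at a)" if "f holomorphic_on ball a r" for f
      using that a by (metis at_within_open continuous_on_def holomorphic_on_imp_continuous_on open_ball)
    have inB: "\<forall>\<^sub>F t in at a. t \<in> B"
      unfolding B_def using eventually_at_in_open[OF open_ball a] by simp
    \<comment> \<open>Comparing limits at \<open>a\<close> in v P' = 2 P (1 - 4 P): the left side
      tends to 0, since v(a) = 0 and P' is holomorphic.\<close>
    have "((\<lambda>t. v t * deriv P t) \<longlongrightarrow> v a * deriv P a) (at a)"
      using v P by (intro lim holomorphic_intros) auto
    moreover have "\<forall>\<^sub>F t in at a. v t * deriv P t = 2 * P t * (1 - 4 * P t)"
      using inB by eventually_elim (simp add: v_eq dP_eq y0)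
    ultimately have "((\<lambda>t. 2 * P t * (1 - 4 * P t)) \<longlongrightarrow> v a * deriv P a) (at a)"
      by (rule Lim_transform_eventually)
    moreover have "((\<lambda>t. 2 * P t * (1 - 4 * P t)) \<longlongrightarrow> 2 * P a * (1 - 4 * P a)) (at a)"
      using P by (intro lim holomorphic_intros) auto
    ultimately have "v a * deriv P a = 2 * P a * (1 - 4 * P a)"
      by (rule tendsto_unique[OF at_neq_bot])
    then have "P a = 0 \<or> 1 - 4 * P a = 0" by (simp add: v_def)
    then have Pa: "P a = 0 \<or> P a = 1 / 4" by (auto simp: eq_divide_eq mult.commute)
    have va: "v a = 0" by (simp add: v_def)
    \<comment> \<open>The value \<open>c\<close> decides which chart the solution enters: 0 leads to
      chart 2, and 1/4 to chart 1. Both cases are treated together, with \<open>w\<close> for x_2 or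
      x_1.\<close>
    define c where "c = P a"
    define w where "w t = - (P t - c) / v t ^ 4" for t
    have c: "c = 0 \<or> c = 1 / 4" using Pa by (simp add: c_def)
    \<comment> \<open>v'(a) = 1/2 - 4 c is 1/2 or -1/2, so the zero of \<open>v\<close> is
      simple.\<close>
    have dva: "deriv v a \<noteq> 0" using c by (auto simp: c_def P_def field_simps)
    have v0: "v t \<noteq> 0" if "t \<in> B" for t using that y0 by (simp add: v_eq)
    \<comment> \<open>Numerator and denominator both vanish at \<open>a\<close>, the latter simply;
      the value put in there is the limit of the quotient of their difference quotients.\<close>
    define h where "h t = (if t = a then 8 * deriv P a / deriv v a else 8 * (P t - c) / v t)" for t
    have h: "h holomorphic_on ball a r"
      unfolding h_def
    proof (rule removable_singularity)
      show "(\<lambda>t. 8 * (P t - c) / v t) holomorphic_on ball a r - {a}"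
        using P v v0 by (intro holomorphic_intros) (auto simp: B_def intro: holomorphic_on_subset)
      have "((\<lambda>t. (P t - P a) / (t - a)) \<longlongrightarrow> deriv P a) (at a)"
        using dP[OF a] by (simp add: has_field_derivative_iff)
      moreover have "((\<lambda>t. (v t - v a) / (t - a)) \<longlongrightarrow> deriv v a) (at a)"
        using holomorphic_derivI[OF v open_ball a] by (simp add: has_field_derivative_iff)
      ultimately have "((\<lambda>t. 8 * ((P t - P a) / (t - a)) / ((v t - v a) / (t - a))) \<longlongrightarrow>
          8 * deriv P a / deriv v a) (at a)"
        using dva by (intro tendsto_intros)
      moreover have "\<forall>\<^sub>F t in at a. 8 * ((P t - P a) / (t - a)) / ((v t - v a) / (t - a)) = 8 * (P t - c) / v t"
        using inB by eventually_elim (auto simp: va c_def B_def)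
      ultimately show "(\<lambda>t. 8 * (P t - c) / v t) \<midarrow>a\<rightarrow> 8 * deriv P a / deriv v a"
        by (rule Lim_transform_eventually)
    qed simp
    define j :: nat where "j = (if c = 0 then 2 else 1)"
    have j: "j \<in> J" by (simp add: j_def J_def)
    have chart: "coords j (x t, y t) = (w t, v t)" if t: "t \<in> B" for t
      using c y0[OF t]
      by (auto simp: j_def coords_def w_def v_eq[OF t] P_eq[OF t] field_simps eval_nat_numeral)
    have dw: "(w has_field_derivative h t * w t) (at t)" if t: "t \<in> B" for t
    proof -
      have chart_fst: "fst (chart_system j t (w t, v t)) = - 8 * (w t)\<^sup>2 * v t ^ 3"
        by (simp add: chart_system_def j_def)
      have "solves_at (chart_system j) (\<lambda>s. coords j (x s, y s)) t"
        using r'[of t] t by (intro solves_at_coords j) (auto simp: B_def)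
      then have "((\<lambda>s. fst (coords j (x s, y s))) has_field_derivative - 8 * (w t)\<^sup>2 * v t ^ 3) (at t)"
        using chart_fst unfolding solves_at_def chart[OF t] by simp
      then have "(w has_field_derivative - 8 * (w t)\<^sup>2 * v t ^ 3) (at t)"
        by (rule has_field_derivative_transform_within_open[OF _ B t]) (simp add: chart)
      \<comment> \<open>The equation of the chart is quadratic in \<open>w\<close>. Replacing one
        factor \<open>w\<close> by -(P - c) / v^4, with \<open>P\<close> already known to be
        holomorphic, turns it into a linear one.\<close>
      moreover have Pw: "P t - c = - w t * v t ^ 4" using v0[OF t] by (simp add: w_def)
      have "h t * w t = 8 * (P t - c) / v t * w t" using t by (simp add: h_def B_def)
      then have "- 8 * (w t)\<^sup>2 * v t ^ 3 = h t * w t"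
        unfolding Pw using v0[OF t] by (simp add: field_simps eval_nat_numeral)
      ultimately show ?thesis by simp
    qed
    obtain W where W: "W holomorphic_on ball a r" "\<And>t. t \<in> ball a r - {a} \<Longrightarrow> W t = w t"
      by (rule linear_ode_extends[OF h, of w]) (use dw in \<open>simp_all add: B_def\<close>)
    show ?thesis
    proof (rule solution_in_chart[OF j r W(1) v])
      fix t assume t: "t \<in> ball a r - {a}"
      then have e: "coords j (x t, y t) = (W t, v t)" and y: "snd (x t, y t) \<noteq> 0"
        using W(2) chart y0 by (simp_all add: B_def)
      have "fibre_chart j (coords j (x t, y t)) = Plane (line (1, inv_coords j (coords j (x t, y t))))"
        using snd_coords[OF y] by (intro fibre_chart_affine) blast
      also have "\<dots> = Plane (line (1, x t, y t))"
        unfolding inv_coords_coords[OF y] by (rule refl)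
      also have "\<dots> = fibre_chart 0 (x t, y t)"
        using fibre_chart_affine[of 0 "(x t, y t)"] by (simp add: inv_coords_0)
      finally show "fibre_chart j (W t, v t) = fibre_chart 0 (x t, y t)" unfolding e .
    qed
  qed
qed

lemma phase_space_the_system: "phase_space the_system J coords"
  unfolding phase_space_def
proof (intro conjI allI impI)
  show "\<forall>j\<in>J. \<exists>g. polynomial_system g \<and> rewritten the_system (coords j) g"
    using polynomial_chart_system rewritten_chart_system by blast
  fix a x y assume "y meromorphic_on {a}" "\<forall>\<^sub>F t in at a. solves_at the_system (\<lambda>t. (x t, y t)) t"
  then show "\<exists>r>0. \<exists>\<sigma>. holomorphic_map {(ball a r, id)} (total_space J coords) \<sigma> \<and>
      (\<forall>t\<in>ball a r - {a}. \<sigma> t = glue_pt J coords 0 ((x t, y t), t))"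
    by (rule solution_extends)
qed (fact zero_in_J coords_0 equiv_glue complex_manifold_total_space time_map)+

theorem theorem18p2:
  shows "(\<forall>j\<in>{0, 1, 2}. birational (coords j) \<and> symplectic (coords j)) \<and>
    phase_space the_system {0, 1, 2} coords \<and>
    (\<forall>t. \<exists>S. rational_surface_of_type E7_affine S
      (fibre {0, 1, 2} coords t) (\<lambda>p. glue_pt {0, 1, 2} coords 0 (p, t)))"
  unfolding J_def[symmetric]
  using birational_coords symplectic_coords phase_space_the_system rational_surface_fibre by blast

end
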